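(* Let $\theta\in[0,1)$ be either $\theta=0$ or an irrational number with finite Diophantine approximation exponent $\gamma$; if $\theta=0$ set $\gamma=1$. Let $\psi:\mathbb{N}\to(0,\infty)$ be a positive decreasing function such that the limit $\tau=\lambda(\psi)$ exists and \[\tau>\frac{2+\gamma^2+\sqrt{(2+\gamma^2)^2-4}}{2}.\] Put $\beta:=\gamma^{-2}(\tau-1)^2$ (the hypothesis implies $\beta>\tau$). Then $\dim_F \mathrm{Exact}(\psi,\theta)>0$; more precisely \[\dim_F \mathrm{Exact}(\psi,\theta)\ \ge\ \frac{2(\beta-\tau)}{\tau(\beta-1)}.\]
   Context: For a function $\psi:\mathbb{N}\to(0,\infty)$, $\lambda(\psi):=-\lim_{q\to\infty}\frac{\log\psi(q)}{\log q}$ (assumed to exist). The Diophantine approximation exponent of an irrational $\theta$ is the infimum of all $\gamma$ such that $|\theta-p/q|\le q^{-\gamma}$ has only finitely many integer solutions $(p,q)$. For $\theta\in[0,1)$, $\mathrm{Exact}(\psi,\theta)$ is the set of real $x$ such that (i) $|x-\frac{r-\theta}{q}|\le\psi(q)$ for infinitely many pairs $(r,q)$ of relatively prime integers, and (ii) for every $c>0$, $|x-\frac{r-\theta}{q}|\le\psi(q)-c\psi(q)$ holds for only finitely many pairs $(r,q)$ of relatively prime integers. Fourier transform: $\hat\mu(\xi)=\int e^{-2\pi i x\xi}\,d\mu(x)$. For $E\subset\mathbb{R}$, the Fourier dimension $\dim_F E$ is the supremum of $s\in[0,1]$ such that there exists a nonzero finite positive Borel measure $\mu$ with compact support contained in $E$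 and a constant $C$ with $|\hat\mu(\xi)|\le C(1+|\xi|)^{-s/2}$ for all $\xi\in\mathbb{R}$. *)

theory Defs
  imports "HOL-Analysis.Analysis"
begin

definition lambda_exp :: "(nat \<Rightarrow> real) \<Rightarrow> real \<Rightarrow> bool" where
  "lambda_exp \<psi> \<tau> \<longleftrightarrow> ((\<lambda>q. - ln (\<psi> q) / ln (real q)) \<longlongrightarrow> \<tau>) sequentially"

definition dioph_exponent :: "real \<Rightarrow> ereal" where
  "dioph_exponent \<theta> = Inf {ereal g | g. finite {(p :: int, q :: int).
       q > 0 \<and> \<bar>\<theta> - real_of_int p / real_of_int q\<bar> \<le> real_of_int q powr (- g)}}"

definition Exact :: "(nat \<Rightarrow> real) \<Rightarrow> real \<Rightarrow> real set" where
  "Exact \<psi> \<theta> = {x. infinite {(r :: int, q :: nat). q > 0 \<and> coprime r (int q) \<and>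
          \<bar>x - (real_of_int r - \<theta>) / real q\<bar> \<le> \<psi> q}
     \<and> (\<forall>c > 0. finite {(r :: int, q :: nat). q > 0 \<and> coprime r (int q) \<and>
          \<bar>x - (real_of_int r - \<theta>) / real q\<bar> \<le> \<psi> q - c * \<psi> q})}"

definition fourier_transform :: "real measure \<Rightarrow> real \<Rightarrow> complex" where
  "fourier_transform \<mu> \<xi> = integral\<^sup>L \<mu> (\<lambda>x. exp (- 2 * pi * \<i> * complex_of_real (x * \<xi>)))"

text \<open>Admissible exponents s for the Fourier dimension of E: a nonzero finite positive Borel
  measure with compact support contained in E whose Fourier transform decays like
  (1+|xi|)^(-s/2).  "Compact support contained in E" is expressed as: some compact K \<subseteq> E
  carries all of the mass (the closed support is then a compact subset of K).\<close>
definition fourier_admissible :: "real set \<Rightarrow> real \<Rightarrow> bool" where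
  "fourier_admissible E s \<longleftrightarrow> s \<in> {0..1} \<and>
     (\<exists>\<mu> :: real measure. sets \<mu> = sets borel \<and> finite_measure \<mu> \<and> emeasure \<mu> (space \<mu>) \<noteq> 0 \<and>
        (\<exists>K. compact K \<and> K \<subseteq> E \<and> emeasure \<mu> (UNIV - K) = 0) \<and>
        (\<exists>C. \<forall>\<xi>. norm (fourier_transform \<mu> \<xi>) \<le> C * (1 + \<bar>\<xi>\<bar>) powr (- s / 2)))"

definition fourier_dim :: "real set \<Rightarrow> real" where
  "fourier_dim E = Sup (insert 0 {s. fourier_admissible E s})"

end

theory Submission
  imports
    Defs
    "HOL-Probability.Probability"
    "HOL-Number_Theory.Prime_Powers"
    "HOL-Real_Asymp.Real_Asymp"
begin

text \<open>
  Put \<open>M\<^sub>k\<^sub>+\<^sub>1 = M\<^sub>k\<^sup>b\<close> with \<open>b\<close> slightly below \<open>\<beta>\<close>. At scale \<open>M\<^sub>k\<close> take the average \<open>F\<^sub>k\<close> over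
  the primes \<open>q\<close> with \<open>M\<^sub>k\<^bsup>1-\<epsilon>\<^esup> \<le> q \<le> M\<^sub>k\<close> of \<open>1/q\<close>-periodic bumps that live where \<open>x - (r - \<theta>)/q\<close>
  is just below \<open>\<psi>(q)\<close>. The Fourier coefficient of \<open>F\<^sub>k\<close> at \<open>l \<noteq> 0\<close> only sees the primes dividing
  \<open>l\<close>, so it is about \<open>1/M\<^sub>k\<close> up to frequency \<open>M\<^sub>k\<^sup>\<tau>\<close> and small beyond. If \<open>f\<^sub>k\<close> is a fixed bump
  times \<open>F\<^sub>0 \<cdots> F\<^sub>k\<^sub>-\<^sub>1\<close>, then the \<open>l\<^sup>1\<close> norm of its transform along translates of \<open>\<int>\<close> is at most
  about the product of the \<open>M\<^sub>i\<^bsup>\<tau>-1\<^esup>\<close> with \<open>i < k\<close>, that is \<open>M\<^sub>k\<^bsup>(\<tau>-1)/(\<beta>-1)\<^esup>\<close>. Hence passing from \<open>f\<^sub>k\<close>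
  to \<open>f\<^sub>k\<^sub>+\<^sub>1\<close> changes the transform by at most about \<open>M\<^sub>k\<^bsup>-1+(\<tau>-1)/(\<beta>-1)\<^esup>\<close> at frequencies up to \<open>M\<^sub>k\<^sup>\<tau>\<close>,
  which is decay with exponent \<open>(\<beta>-\<tau>)/(\<tau>(\<beta>-1))\<close>; a weak limit of the \<open>f\<^sub>k\<close> inherits it.

  No mass has to be removed to make the approximation exact. Distinct points \<open>(r - \<theta>)/q\<close> and
  \<open>(r' - \<theta>)/q'\<close> with \<open>q \<le> q'\<close> are at distance at least about \<open>q'\<^bsup>-\<gamma>\<^esup>/q\<close>, and for \<open>b < \<beta>\<close> this
  rules out every competitor with denominator between two consecutive prescribed ones.
\<close>

section \<open>Fourier integrals and absolutely convergent Fourier series\<close>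

definition cis2pi :: "real \<Rightarrow> complex" where
  "cis2pi x = cis (2 * pi * x)"

lemma cis2pi_add: "cis2pi (x + y) = cis2pi x * cis2pi y"
  by (simp add: cis2pi_def cis_mult ring_distribs)

lemma norm_cis2pi [simp]: "norm (cis2pi x) = 1"
  by (simp add: cis2pi_def)

lemma cis2pi_0 [simp]: "cis2pi 0 = 1"
  by (simp add: cis2pi_def)

lemma cis2pi_of_int [simp]: "cis2pi (of_int n) = 1"
  by (simp add: cis2pi_def cis_multiple_2pi)

lemma cis2pi_of_int_mult_frac: "cis2pi (of_int j * frac x) = cis2pi (of_int j * x)"
proof -
  have "of_int j * x = of_int j * frac x + of_int (j * \<lfloor>x\<rfloor>)"
    by (simp add: frac_def algebra_simps)
  then show ?thesis
    by (simp only: cis2pi_add cis2pi_of_int mult_1_right)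
qed

lemma continuous_on_cis2pi [continuous_intros]:
  "continuous_on S f \<Longrightarrow> continuous_on S (\<lambda>x. cis2pi (f x))"
  unfolding cis2pi_def cis_conv_exp by (intro continuous_intros)

lemma borel_measurable_cis2pi [measurable]: "cis2pi \<in> borel_measurable borel"
  by (intro borel_measurable_continuous_onI continuous_intros)

lemma has_vector_derivative_cis2pi:
  "((\<lambda>x. cis2pi (a * x)) has_vector_derivative (2 * pi * \<i> * a) * cis2pi (a * x)) (at x within S)"
  unfolding cis2pi_def cis_conv_exp
  by (auto intro!: derivative_eq_intros has_vector_derivative_real_field simp: scaleR_conv_of_real)

lemma integral_cis2pi_of_int:
  "integral {0..1} (\<lambda>x. cis2pi (of_int m * x)) = (if m = 0 then 1 else 0)"
proof (cases "m = 0")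
  case False
  let ?G = "\<lambda>x. cis2pi (of_int m * x) / (2 * pi * \<i> * of_int m)"
  have "(?G has_vector_derivative cis2pi (of_int m * x)) (at x within {0..1})" for x
    using has_vector_derivative_divide[OF has_vector_derivative_cis2pi[of "of_int m"],
        where a = "2 * pi * \<i> * of_int m"] False
    by simp
  then have "((\<lambda>x. cis2pi (of_int m * x)) has_integral (?G 1 - ?G 0)) {0..1}"
    by (intro fundamental_theorem_of_calculus) auto
  then show ?thesis
    using False by (simp add: integral_unique)
qed simp

definition fourier_integral :: "(real \<Rightarrow> complex) \<Rightarrow> real \<Rightarrow> complex" where
  "fourier_integral f \<xi> = (\<integral>x. f x * cis2pi (- (x * \<xi>)) \<partial>lborel)"

lemma integrable_mult_bounded:
  fixes f g :: "'a \<Rightarrow> complex"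
  assumes f: "integrable M f" and g [measurable]: "g \<in> borel_measurable M"
    and bound: "\<And>x. norm (g x) \<le> B"
  shows "integrable M (\<lambda>x. f x * g x)"
proof (rule Bochner_Integration.integrable_bound)
  show "integrable M (\<lambda>x. B *\<^sub>R f x)"
    using f by auto
  show "(\<lambda>x. f x * g x) \<in> borel_measurable M"
    using f by measurable
  have "norm (f x * g x) \<le> norm (B *\<^sub>R f x)" for x
    using mult_left_mono[OF order_trans[OF bound[of x] abs_ge_self[of B]], of "norm (f x)"]
    by (simp add: norm_mult mult.commute)
  then show "AE x in M. norm (f x * g x) \<le> norm (B *\<^sub>R f x)"
    by simp
qed

lemma integrable_mult_cis2pi:
  assumes "integrable lborel f"
  shows "integrable lborel (\<lambda>x. f x * cis2pi (a * x))"
  by (rule integrable_mult_bounded[OF assms, of _ 1]) auto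

lemma integrable_fourier_integrand:
  assumes "integrable lborel f"
  shows "integrable lborel (\<lambda>x. f x * cis2pi (- (x * \<xi>)))"
  using integrable_mult_cis2pi[OF assms, of "- \<xi>"] by (simp add: mult.commute)

lemma norm_fourier_integral_le:
  "norm (fourier_integral f \<xi>) \<le> (\<integral>x. norm (f x) \<partial>lborel)"
proof -
  have "norm (fourier_integral f \<xi>) \<le> (\<integral>x. norm (f x * cis2pi (- (x * \<xi>))) \<partial>lborel)"
    unfolding fourier_integral_def by (rule integral_norm_bound)
  then show ?thesis
    by (simp add: norm_mult)
qed

lemma norm_fourier_integral_mult_le:
  assumes f: "integrable lborel f" and g: "g \<in> borel_measurable borel"
    and bound: "\<And>x. norm (g x) \<le> B"
  shows "norm (fourier_integral (\<lambda>x. f x * g x) \<xi>) \<le> B * (\<integral>x. norm (f x) \<partial>lborel)"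
proof -
  have "norm (fourier_integral (\<lambda>x. f x * g x) \<xi>) \<le> (\<integral>x. norm (f x * g x) \<partial>lborel)"
    by (rule norm_fourier_integral_le)
  also have "\<dots> \<le> (\<integral>x. B * norm (f x) \<partial>lborel)"
  proof (rule integral_mono)
    show "integrable lborel (\<lambda>x. norm (f x * g x))"
      using integrable_mult_bounded[OF f _ bound] g by (intro integrable_norm) auto
    show "norm (f x * g x) \<le> B * norm (f x)" for x
      using mult_left_mono[OF bound[of x], of "norm (f x)"] by (simp add: norm_mult mult.commute)
  qed (use f in auto)
  finally show ?thesis
    by simp
qed

lemma fourier_integral_diff:
  assumes "integrable lborel f" "integrable lborel g"
  shows "fourier_integral (\<lambda>x. f x - g x) \<xi> = fourier_integral f \<xi> - fourier_integral g \<xi>"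
  unfolding fourier_integral_def
  using assms by (simp add: left_diff_distrib integrable_fourier_integrand)

lemma fourier_integral_add:
  assumes "integrable lborel f" "integrable lborel g"
  shows "fourier_integral (\<lambda>x. f x + g x) \<xi> = fourier_integral f \<xi> + fourier_integral g \<xi>"
  unfolding fourier_integral_def
  using assms by (simp add: distrib_right integrable_fourier_integrand)

lemma fourier_integral_cmult:
  "fourier_integral (\<lambda>x. a * f x) \<xi> = a * fourier_integral f \<xi>"
  unfolding fourier_integral_def by (simp add: mult.assoc)

lemma fourier_integral_mult_cis2pi:
  "fourier_integral (\<lambda>x. f x * cis2pi (a * x)) \<xi> = fourier_integral f (\<xi> - a)"
proof -
  have "cis2pi (- (x * (\<xi> - a))) = cis2pi (a * x) * cis2pi (- (x * \<xi>))" for x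
    by (simp add: cis2pi_add[symmetric] algebra_simps)
  then show ?thesis
    by (simp add: fourier_integral_def mult.assoc)
qed

lemma fourier_integral_mult_trig_poly:
  assumes "integrable lborel f"
  shows "fourier_integral (\<lambda>x. f x * (\<Sum>l\<in>X. c l * cis2pi (of_int l * x))) \<xi>
    = (\<Sum>l\<in>X. c l * fourier_integral f (\<xi> - of_int l))"
proof -
  have "(\<Sum>l\<in>X. c l * fourier_integral f (\<xi> - of_int l))
    = (\<Sum>l\<in>X. \<integral>x. c l * (f x * cis2pi (of_int l * x) * cis2pi (- (x * \<xi>))) \<partial>lborel)"
    by (simp add: fourier_integral_mult_cis2pi[symmetric]) (simp add: fourier_integral_def)
  also have "\<dots> = (\<integral>x. (\<Sum>l\<in>X. c l * (f x * cis2pi (of_int l * x) * cis2pi (- (x * \<xi>)))) \<partial>lborel)"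
    using assms
    by (intro Bochner_Integration.integral_sum[symmetric] integrable_mult_right
        integrable_fourier_integrand integrable_mult_cis2pi)
  finally show ?thesis
    by (simp add: fourier_integral_def sum_distrib_left sum_distrib_right mult_ac)
qed

lemma tendsto_fourier_integral_mult:
  assumes f: "integrable lborel f" and lim: "uniform_limit UNIV G g net"
    and G: "\<And>X. continuous_on UNIV (G X)" and net: "net \<noteq> bot"
    and bound: "\<And>x. norm (g x) \<le> B"
  shows "((\<lambda>X. fourier_integral (\<lambda>x. f x * G X x) \<xi>) \<longlongrightarrow> fourier_integral (\<lambda>x. f x * g x) \<xi>) net"
proof (rule tendstoI)
  fix e :: real assume "e > 0"
  define N where "N = (\<integral>x. norm (f x) \<partial>lborel)"
  define d where "d = e / (N + 1)"
  have "N \<ge> 0"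
    unfolding N_def by simp
  with \<open>e > 0\<close> have d: "d > 0" "d * N < e"
    by (auto simp: d_def field_simps)
  have "continuous_on UNIV g"
    by (rule uniform_limit_theorem[OF _ lim net]) (simp add: G)
  then have g [measurable]: "g \<in> borel_measurable borel"
    by (rule borel_measurable_continuous_onI)
  have G_meas [measurable]: "G X \<in> borel_measurable borel" for X
    by (rule borel_measurable_continuous_onI[OF G])
  show "\<forall>\<^sub>F X in net. dist (fourier_integral (\<lambda>x. f x * G X x) \<xi>)
      (fourier_integral (\<lambda>x. f x * g x) \<xi>) < e"
    using uniform_limitD[OF lim d(1)]
  proof eventually_elim
    case (elim X)
    then have close: "norm (G X x - g x) \<le> d" for x
      by (auto simp: dist_norm less_imp_le)
    have "norm (G X x) \<le> B + d" for x
      using norm_triangle_sub[of "G X x" "g x"] close[of x] bound[of x] by linarith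
    then have "fourier_integral (\<lambda>x. f x * G X x) \<xi> - fourier_integral (\<lambda>x. f x * g x) \<xi>
        = fourier_integral (\<lambda>x. f x * (G X x - g x)) \<xi>"
      using integrable_mult_bounded[OF f _ bound] integrable_mult_bounded[OF f, of "G X" "B + d"]
      by (subst fourier_integral_diff[symmetric]) (auto simp: right_diff_distrib)
    also have "norm \<dots> \<le> d * N"
      unfolding N_def by (intro norm_fourier_integral_mult_le f close) measurable
    finally show ?case
      using d(2) by (simp add: dist_norm)
  qed
qed

definition abs_fourier_series :: "(real \<Rightarrow> complex) \<Rightarrow> (int \<Rightarrow> complex) \<Rightarrow> bool" where
  "abs_fourier_series F c \<longleftrightarrow> (\<lambda>l. norm (c l)) summable_on UNIV \<and>
     (\<forall>x. ((\<lambda>l. c l * cis2pi (of_int l * x)) has_sum F x) UNIV)"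

lemma abs_fourier_seriesD:
  assumes "abs_fourier_series F c"
  shows "(\<lambda>l. norm (c l)) summable_on UNIV"
    and "((\<lambda>l. c l * cis2pi (of_int l * x)) has_sum F x) UNIV"
  using assms by (auto simp: abs_fourier_series_def)

lemma abs_fourier_series_infsum:
  assumes "(\<lambda>l. norm (c l)) summable_on UNIV"
  shows "abs_fourier_series (\<lambda>x. \<Sum>\<^sub>\<infinity>l. c l * cis2pi (of_int l * x)) c"
proof -
  have "(\<lambda>l. c l * cis2pi (of_int l * x)) summable_on UNIV" for x
    by (rule abs_summable_summable) (use assms in \<open>simp add: norm_mult\<close>)
  then show ?thesis
    using assms by (simp add: abs_fourier_series_def)
qed

lemma uniform_limit_fourier_series:
  assumes "abs_fourier_series F c"
  shows "uniform_limit A (\<lambda>X x. \<Sum>l\<in>X. c l * cis2pi (of_int l * x)) F (finite_subsets_at_top UNIV)"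
  by (rule Weierstrass_m_test_general'[where M = "\<lambda>l. norm (c l)"])
     (use abs_fourier_seriesD[OF assms] in \<open>auto simp: norm_mult\<close>)

lemma continuous_on_abs_fourier_series:
  assumes "abs_fourier_series F c"
  shows "continuous_on A F"
  by (rule uniform_limit_theorem[OF _ uniform_limit_fourier_series[OF assms]])
     (auto intro!: always_eventually continuous_intros)

lemma norm_abs_fourier_series_le:
  assumes "abs_fourier_series F c"
  shows "norm (F x) \<le> (\<Sum>\<^sub>\<infinity>l. norm (c l))"
  by (rule norm_infsum_le[OF abs_fourier_seriesD(2)[OF assms]])
     (use abs_fourier_seriesD(1)[OF assms] in \<open>auto simp: norm_mult\<close>)

lemma integrable_mult_fourier_series:
  assumes "integrable lborel f" "abs_fourier_series F c"
  shows "integrable lborel (\<lambda>x. f x * F x)"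
  using continuous_on_abs_fourier_series[OF assms(2)]
  by (intro integrable_mult_bounded[OF assms(1) _ norm_abs_fourier_series_le[OF assms(2)]])
     (simp add: borel_measurable_continuous_onI)

lemma fourier_integral_mult_series_has_sum:
  assumes "integrable lborel f" "abs_fourier_series F c"
  shows "((\<lambda>l. c l * fourier_integral f (\<xi> - of_int l)) has_sum
    fourier_integral (\<lambda>x. f x * F x) \<xi>) UNIV"
proof -
  have "((\<lambda>X. fourier_integral (\<lambda>x. f x * (\<Sum>l\<in>X. c l * cis2pi (of_int l * x))) \<xi>)
      \<longlongrightarrow> fourier_integral (\<lambda>x. f x * F x) \<xi>) (finite_subsets_at_top UNIV)"
    by (rule tendsto_fourier_integral_mult[OF assms(1) uniform_limit_fourier_series[OF assms(2)]
          _ _ norm_abs_fourier_series_le[OF assms(2)]])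
       (auto intro!: continuous_intros)
  then show ?thesis
    by (simp add: has_sum_def fourier_integral_mult_trig_poly[OF assms(1)])
qed

lemma abs_fourier_series_add:
  assumes "abs_fourier_series F c" "abs_fourier_series G d"
  shows "abs_fourier_series (\<lambda>x. F x + G x) (\<lambda>l. c l + d l)"
proof -
  note F = abs_fourier_seriesD[OF assms(1)] and G = abs_fourier_seriesD[OF assms(2)]
  have "(\<lambda>l. norm (c l + d l)) summable_on UNIV"
    by (rule Infinite_Sum.abs_summable_on_comparison_test'[OF summable_on_add[OF F(1) G(1)]])
       (rule norm_triangle_ineq)
  then show ?thesis
    using has_sum_add[OF F(2) G(2)] by (simp add: abs_fourier_series_def distrib_right)
qed

lemma abs_fourier_series_sum:
  assumes "finite I" "\<And>i. i \<in> I \<Longrightarrow> abs_fourier_series (F i) (c i)"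
  shows "abs_fourier_series (\<lambda>x. \<Sum>i\<in>I. F i x) (\<lambda>l. \<Sum>i\<in>I. c i l)"
  using assms
proof (induction I rule: finite_induct)
  case (insert i I)
  then have series: "abs_fourier_series (F i) (c i)"
    "abs_fourier_series (\<lambda>x. \<Sum>i\<in>I. F i x) (\<lambda>l. \<Sum>i\<in>I. c i l)"
    by auto
  with insert show ?case
    by (simp add: abs_fourier_series_add)
qed (simp add: abs_fourier_series_def)

lemma abs_fourier_series_cmult:
  assumes "abs_fourier_series F c"
  shows "abs_fourier_series (\<lambda>x. a * F x) (\<lambda>l. a * c l)"
  using abs_fourier_seriesD[OF assms]
  by (auto simp: abs_fourier_series_def norm_mult mult.assoc
        intro: has_sum_cmult_right summable_on_cmult_right)

lemma abs_fourier_series_const: "abs_fourier_series (\<lambda>x. a) (\<lambda>l. if l = 0 then a else 0)"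
  unfolding abs_fourier_series_def
proof (intro conjI allI)
  show "(\<lambda>l::int. norm (if l = 0 then a else 0)) summable_on UNIV"
    using has_sum_finite_neutralI[of "{0}" UNIV "\<lambda>l::int. norm (if l = 0 then a else 0)" "norm a"]
    by (auto intro: has_sum_imp_summable)
  show "((\<lambda>l. (if l = 0 then a else 0) * cis2pi (of_int l * x)) has_sum a) UNIV" for x
    by (rule has_sum_finite_neutralI[of "{0}"]) auto
qed

lemma abs_fourier_series_dilate:
  assumes "abs_fourier_series F c" and q: "q > 0"
  shows "abs_fourier_series (\<lambda>x. F (of_int q * x + \<alpha>))
    (\<lambda>l. if q dvd l then c (l div q) * cis2pi (of_int (l div q) * \<alpha>) else 0)"
    (is "abs_fourier_series _ ?d")
proof -
  have reindex: "((\<lambda>l. ?d l * cis2pi (of_int l * x)) has_sum s) UNIV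
      \<longleftrightarrow> ((\<lambda>j. c j * cis2pi (of_int j * (of_int q * x + \<alpha>))) has_sum s) UNIV" for x s
  proof -
    let ?h = "\<lambda>l. ?d l * cis2pi (of_int l * x)"
    have "(?h has_sum s) UNIV \<longleftrightarrow> (?h has_sum s) (range ((*) q))"
      by (rule has_sum_cong_neutral) (auto elim!: dvdE)
    also have "\<dots> \<longleftrightarrow> ((?h \<circ> (*) q) has_sum s) UNIV"
      by (rule has_sum_reindex) (use q in \<open>auto simp: inj_on_def\<close>)
    also have "?h \<circ> (*) q = (\<lambda>j. c j * cis2pi (of_int j * (of_int q * x + \<alpha>)))"
      using q by (auto simp: fun_eq_iff cis2pi_add[symmetric] algebra_simps)
    finally show ?thesis .
  qed
  have "(\<lambda>l. norm (?d l)) summable_on UNIV \<longleftrightarrow> (\<lambda>l. norm (?d l)) summable_on range ((*) q)"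
    by (rule summable_on_cong_neutral) (auto elim!: dvdE)
  also have "\<dots> \<longleftrightarrow> ((\<lambda>l. norm (?d l)) \<circ> (*) q) summable_on UNIV"
    by (rule summable_on_reindex) (use q in \<open>auto simp: inj_on_def\<close>)
  also have "(\<lambda>l. norm (?d l)) \<circ> (*) q = (\<lambda>j. norm (c j))"
    using q by (auto simp: fun_eq_iff norm_mult)
  finally show ?thesis
    using abs_fourier_seriesD[OF assms(1)] by (simp add: abs_fourier_series_def reindex)
qed

section \<open>Fourier coefficients\<close>

definition fourier_coeff :: "(real \<Rightarrow> complex) \<Rightarrow> int \<Rightarrow> complex" where
  "fourier_coeff h j = integral {0..1} (\<lambda>x. h x * cis2pi (- (of_int j * x)))"

lemma integrable_fourier_coeff_integrand:
  assumes "continuous_on {0..1} h"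
  shows "(\<lambda>x. h x * cis2pi (- (a * x))) integrable_on {0..1}"
  by (intro integrable_continuous_interval continuous_intros assms)

lemma fourier_coeff_add:
  assumes "continuous_on {0..1} g" "continuous_on {0..1} h"
  shows "fourier_coeff (\<lambda>x. g x + h x) j = fourier_coeff g j + fourier_coeff h j"
  unfolding fourier_coeff_def
  using assms by (simp add: distrib_right integral_add integrable_fourier_coeff_integrand)

lemma fourier_coeff_diff:
  assumes "continuous_on {0..1} g" "continuous_on {0..1} h"
  shows "fourier_coeff (\<lambda>x. g x - h x) j = fourier_coeff g j - fourier_coeff h j"
  unfolding fourier_coeff_def
  using assms by (simp add: left_diff_distrib integral_diff integrable_fourier_coeff_integrand)

lemma fourier_coeff_cmult:
  "fourier_coeff (\<lambda>x. a * h x) j = a * fourier_coeff h j"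
  unfolding fourier_coeff_def by (simp add: mult.assoc)

lemma fourier_coeff_mult_cis2pi:
  "fourier_coeff (\<lambda>x. cis2pi (of_int m * x) * h x) j = fourier_coeff h (j - m)"
proof -
  have "cis2pi (- (of_int (j - m) * x)) = cis2pi (of_int m * x) * cis2pi (- (of_int j * x))" for x
    by (simp add: cis2pi_add[symmetric] algebra_simps)
  then show ?thesis
    by (simp add: fourier_coeff_def mult_ac)
qed

lemma fourier_coeff_eq_fourier_integral:
  assumes cont: "continuous_on {0..1} h" and outside: "\<And>x. x \<notin> {0..1} \<Longrightarrow> h x = 0"
  shows "fourier_coeff h j = fourier_integral h (of_int j)"
proof -
  let ?k = "\<lambda>x. h x * cis2pi (- (of_int j * x))"
  have "set_integrable lborel {0..1} ?k"
    by (intro borel_integrable_atLeastAtMost' continuous_intros cont)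
  then have "fourier_coeff h j = (\<integral>x. indicator {0..1} x *\<^sub>R ?k x \<partial>lborel)"
    unfolding fourier_coeff_def
    by (simp add: set_borel_integral_eq_integral(2)[symmetric] set_lebesgue_integral_def)
  also have "(\<lambda>x. indicator {0..1} x *\<^sub>R ?k x) = ?k"
    using outside by (auto simp: indicator_def fun_eq_iff)
  finally show ?thesis
    by (simp add: fourier_integral_def mult.commute)
qed

lemma fourier_coeff_abs_fourier_series:
  assumes "abs_fourier_series F c"
  shows "fourier_coeff F m = c m"
proof -
  let ?P = "\<lambda>X x. (\<Sum>l\<in>X. c l * cis2pi (of_int l * x)) * cis2pi (- (of_int m * x))"
  have "uniform_limit {0..1} ?P (\<lambda>x. F x * cis2pi (- (of_int m * x))) (finite_subsets_at_top UNIV)"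
    using uniform_limit_fourier_series[OF assms, of "{0..1}"]
    by (simp add: uniform_limit_iff dist_norm norm_mult flip: left_diff_distrib)
  then obtain I J where I: "\<And>X. (?P X has_integral I X) {0..1}"
    and J: "((\<lambda>x. F x * cis2pi (- (of_int m * x))) has_integral J) {0..1}"
    and lim: "(I \<longlongrightarrow> J) (finite_subsets_at_top UNIV)"
    by (rule uniform_limit_integral) (auto intro!: continuous_intros)
  have orthogonal: "((\<lambda>x. c l * cis2pi (of_int l * x) * cis2pi (- (of_int m * x)))
      has_integral (if l = m then c m else 0)) {0..1}" for l
  proof -
    have eq: "c l * cis2pi (of_int l * x) * cis2pi (- (of_int m * x))
        = c l * cis2pi (of_int (l - m) * x)" for x
      by (simp add: mult.assoc cis2pi_add[symmetric] algebra_simps)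
    have "((\<lambda>x. c l * cis2pi (of_int (l - m) * x)) has_integral
        (c l * integral {0..1} (\<lambda>x. cis2pi (of_int (l - m) * x)))) {0..1}"
      by (intro has_integral_mult_right integrable_integral integrable_continuous_interval
          continuous_intros)
    then show ?thesis
      unfolding eq integral_cis2pi_of_int by (auto split: if_splits)
  qed
  have "I X = (\<Sum>l\<in>X. if l = m then c m else 0)" if "finite X" for X
    by (rule has_integral_unique[OF I])
       (simp add: sum_distrib_right has_integral_sum[OF that orthogonal])
  then have "\<forall>\<^sub>F X in finite_subsets_at_top UNIV. I X = c m"
    by (auto simp: eventually_finite_subsets_at_top sum.delta intro!: exI[of _ "{m}"])
  from tendsto_eventually[OF this] have "J = c m"
    using lim tendsto_unique finite_subsets_at_top_neq_bot by blast
  then show ?thesis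
    using J by (simp add: fourier_coeff_def integral_unique)
qed

lemma continuous_on_polynomial_cis2pi:
  fixes p :: "complex \<Rightarrow> 'a::euclidean_space"
  assumes "polynomial_function p"
  shows "continuous_on S (\<lambda>x. p (cis2pi x))"
  by (rule continuous_on_compose2[OF continuous_on_polymonial_function[OF assms, of UNIV]])
     (auto intro!: continuous_intros)

lemma bounded_linear_cis2pi:
  assumes "bounded_linear (g :: complex \<Rightarrow> real)"
  obtains a where "\<And>x. complex_of_real (g (cis2pi x)) = a * cis2pi x + cnj a * cis2pi (- x)"
proof (rule that)
  fix x
  have "g (cis2pi x) = g (Re (cis2pi x) *\<^sub>R 1 + Im (cis2pi x) *\<^sub>R \<i>)"
    by (rule arg_cong[where f = g]) (simp add: complex_eq_iff)
  also have "\<dots> = Re (cis2pi x) * g 1 + Im (cis2pi x) * g \<i>"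
    using assms by (simp only: bounded_linear.linear linear_add linear_scale real_scaleR_def)
  finally show "complex_of_real (g (cis2pi x))
      = (g 1 - \<i> * g \<i>) / 2 * cis2pi x + cnj ((g 1 - \<i> * g \<i>) / 2) * cis2pi (- x)"
    by (simp add: complex_eq_iff cis2pi_def field_simps)
qed

text \<open>The functions with vanishing Fourier coefficients are stable under multiplication by
  \<open>exp (\<plusminus>2 \<pi> i x)\<close>, hence by every polynomial on the unit circle, and these are dense.\<close>

lemma fourier_coeff_mult_real_polynomial_eq_0:
  assumes "real_polynomial_function g" "continuous_on {0..1} h" "\<And>j. fourier_coeff h j = 0"
  shows "fourier_coeff (\<lambda>x. complex_of_real (g (cis2pi x)) * h x) j = 0"
  using assms
proof (induction g arbitrary: h j rule: real_polynomial_function.induct)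
  case (linear g)
  obtain a where "\<And>x. complex_of_real (g (cis2pi x)) = a * cis2pi x + cnj a * cis2pi (- x)"
    using bounded_linear_cis2pi[OF linear(1)] by metis
  then have "(\<lambda>x. complex_of_real (g (cis2pi x)) * h x)
      = (\<lambda>x. a * (cis2pi (of_int 1 * x) * h x) + cnj a * (cis2pi (of_int (-1) * x) * h x))"
    by (auto simp: distrib_right mult.assoc)
  then show ?case
    using linear(2,3)
    by (simp add: fourier_coeff_add fourier_coeff_cmult fourier_coeff_mult_cis2pi
        continuous_on_mult continuous_on_cis2pi del: of_int_1 of_int_minus)
next
  case (add f g)
  have "continuous_on {0..1} (\<lambda>x. complex_of_real (p (cis2pi x)) * h x)"
    if "real_polynomial_function p" for p
    using that add.prems
    by (intro continuous_intros continuous_on_polynomial_cis2pi)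
       (auto simp: real_polynomial_function_eq)
  with add show ?case
    by (simp add: distrib_right fourier_coeff_add)
next
  case (mult f g)
  have "continuous_on {0..1} (\<lambda>x. complex_of_real (g (cis2pi x)) * h x)"
    using mult.prems mult.hyps
    by (intro continuous_intros continuous_on_polynomial_cis2pi)
       (auto simp: real_polynomial_function_eq)
  then have "fourier_coeff
      (\<lambda>x. complex_of_real (f (cis2pi x)) * (complex_of_real (g (cis2pi x)) * h x)) j = 0"
    by (intro mult.IH mult.prems)
  then show ?case
    by (simp add: mult.assoc)
qed (simp add: fourier_coeff_cmult)

lemma fourier_coeff_mult_polynomial_eq_0:
  fixes p :: "complex \<Rightarrow> complex"
  assumes "polynomial_function p" "continuous_on {0..1} h" "\<And>j. fourier_coeff h j = 0"
  shows "fourier_coeff (\<lambda>x. p (cis2pi x) * h x) j = 0"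
proof -
  let ?R = "\<lambda>x. complex_of_real (Re (p (cis2pi x))) * h x"
  let ?I = "\<lambda>x. complex_of_real (Im (p (cis2pi x))) * h x"
  have poly: "real_polynomial_function (\<lambda>z. Re (p z))" "real_polynomial_function (\<lambda>z. Im (p z))"
    using assms(1) bounded_linear_Re bounded_linear_Im by (auto simp: polynomial_function_def o_def)
  have cont: "continuous_on {0..1} ?R" "continuous_on {0..1} (\<lambda>x. \<i> * ?I x)"
    by (intro continuous_intros assms continuous_on_polynomial_cis2pi)+
  have "fourier_coeff (\<lambda>x. p (cis2pi x) * h x) j = fourier_coeff (\<lambda>x. ?R x + \<i> * ?I x) j"
    by (rule arg_cong[where f = "\<lambda>f. fourier_coeff f j"]) (auto simp: fun_eq_iff complex_eq_iff)
  also have "\<dots> = fourier_coeff ?R j + \<i> * fourier_coeff ?I j"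
    by (simp only: fourier_coeff_add[OF cont] fourier_coeff_cmult)
  also have "\<dots> = 0"
    using fourier_coeff_mult_real_polynomial_eq_0[OF poly(1) assms(2,3)]
      fourier_coeff_mult_real_polynomial_eq_0[OF poly(2) assms(2,3)] by simp
  finally show ?thesis .
qed

lemma loop_uniform_approx_polynomial:
  fixes h :: "real \<Rightarrow> complex"
  assumes "continuous_on {0..1} h" "h 0 = h 1" "e > 0"
  obtains p :: "complex \<Rightarrow> complex" where "polynomial_function p"
    "\<And>x. x \<in> {0..1} \<Longrightarrow> norm (h x - p (cis2pi x)) < e"
proof -
  let ?H = "h \<circ> (\<lambda>z. Arg2pi z / (2 * pi))"
  \<comment> \<open>The trivial homotopy yields the continuity of the map that \<open>h\<close> induces on the circle.\<close>
  have "homotopic_loops UNIV h h"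
    using assms by (simp add: homotopic_loops_refl path_def pathstart_def pathfinish_def)
  then have "continuous_on (sphere 0 1) ?H"
    using homotopic_loops_imp_homotopic_circlemaps homotopic_with_imp_continuous by blast
  then obtain p :: "complex \<Rightarrow> complex" where p: "polynomial_function p"
    "\<And>z. z \<in> sphere 0 1 \<Longrightarrow> norm (?H z - p z) < e"
    using Stone_Weierstrass_polynomial_function[of "sphere 0 1" ?H e] assms(3) by auto
  have "?H (cis2pi x) = h x" if "x \<in> {0..1}" for x
  proof (cases "x = 1")
    case True
    then show ?thesis
      using assms(2) cis2pi_of_int[of 1] Arg2pi_of_real[of 1] by simp
  next
    case False
    with that have "Arg2pi (cis2pi x) = 2 * pi * x"
      unfolding cis2pi_def cis_conv_exp by (subst Arg2pi_exp) auto
    then show ?thesis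
      by simp
  qed
  with p show ?thesis
    using that[of p] by (metis mem_sphere_0 norm_cis2pi)
qed

lemma integral_norm_square_le_if_fourier_coeff_eq_0:
  fixes h :: "real \<Rightarrow> complex"
  assumes cont: "continuous_on {0..1} h" and loop: "h 0 = h 1"
    and zero: "\<And>j. fourier_coeff h j = 0"
    and bound: "\<And>x. x \<in> {0..1} \<Longrightarrow> norm (h x) \<le> B" and "e > 0"
  shows "integral {0..1} (\<lambda>x. (norm (h x))\<^sup>2) \<le> e * B"
proof -
  obtain p where p: "polynomial_function p"
    "\<And>x. x \<in> {0..1} \<Longrightarrow> norm (cnj (h x) - p (cis2pi x)) < e"
    by (rule loop_uniform_approx_polynomial[of "\<lambda>x. cnj (h x)" e])
       (use cont loop \<open>e > 0\<close> in \<open>auto intro!: continuous_intros\<close>)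
  have int: "(\<lambda>x. cnj (h x) * h x) integrable_on {0..1}"
    "(\<lambda>x. p (cis2pi x) * h x) integrable_on {0..1}"
    using p(1) cont
    by (intro integrable_continuous_interval continuous_intros
        continuous_on_polynomial_cis2pi; simp)+
  have "((\<lambda>x. complex_of_real ((norm (h x))\<^sup>2)) has_integral
      complex_of_real (integral {0..1} (\<lambda>x. (norm (h x))\<^sup>2))) {0..1}"
    by (intro has_integral_of_real integrable_integral integrable_continuous_interval
        continuous_intros cont)
  then have "complex_of_real (integral {0..1} (\<lambda>x. (norm (h x))\<^sup>2))
      = integral {0..1} (\<lambda>x. cnj (h x) * h x)"
    unfolding complex_norm_square by (simp add: integral_unique mult.commute)
  also have "\<dots> = integral {0..1} (\<lambda>x. (cnj (h x) - p (cis2pi x)) * h x)"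
    using fourier_coeff_mult_polynomial_eq_0[OF p(1) cont zero, of 0] int
    by (simp add: fourier_coeff_def left_diff_distrib integral_diff)
  also have "norm \<dots> \<le> integral {0..1} (\<lambda>x::real. e * B)"
  proof (rule integral_norm_bound_integral)
    show "(\<lambda>x. (cnj (h x) - p (cis2pi x)) * h x) integrable_on {0..1}"
      using int by (simp add: left_diff_distrib integrable_diff)
    show "norm ((cnj (h x) - p (cis2pi x)) * h x) \<le> e * B" if "x \<in> {0..1}" for x
      using p(2)[OF that] bound[OF that] \<open>e > 0\<close> unfolding norm_mult
      by (intro mult_mono) auto
  qed auto
  finally show ?thesis
    by simp
qed

lemma continuous_eq_0_if_fourier_coeff_eq_0:
  fixes h :: "real \<Rightarrow> complex"
  assumes cont: "continuous_on {0..1} h" and loop: "h 0 = h 1"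
    and zero: "\<And>j. fourier_coeff h j = 0" and x: "x \<in> {0..1}"
  shows "h x = 0"
proof -
  have "bounded (h ` {0..1})"
    by (intro compact_imp_bounded compact_continuous_image cont) auto
  then obtain B where B: "\<forall>x\<in>{0..1}. norm (h x) \<le> B" "B > 0"
    by (auto simp: bounded_pos)
  have "integral {0..1} (\<lambda>x. (norm (h x))\<^sup>2) \<le> 0"
  proof (rule field_le_epsilon)
    fix e :: real assume "e > 0"
    then show "integral {0..1} (\<lambda>x. (norm (h x))\<^sup>2) \<le> 0 + e"
      using integral_norm_square_le_if_fourier_coeff_eq_0[OF cont loop zero, of B "e / B"] B by simp
  qed
  moreover have "integral {0..1} (\<lambda>x. (norm (h x))\<^sup>2) \<ge> 0"
    using cont by (intro integral_nonneg integrable_continuous_interval continuous_intros) auto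
  ultimately have "integral {0..1} (\<lambda>x. (norm (h x))\<^sup>2) = 0"
    by simp
  then show ?thesis
    using x cont by (subst (asm) integral_eq_0_iff) (auto intro!: continuous_intros)
qed

lemma abs_fourier_series_periodization:
  assumes cont: "continuous_on {0..1} h" and loop: "h 0 = h 1"
    and summable: "(\<lambda>j. norm (fourier_coeff h j)) summable_on UNIV"
  shows "abs_fourier_series (\<lambda>x. h (frac x)) (fourier_coeff h)"
proof -
  define S where "S x = (\<Sum>\<^sub>\<infinity>j. fourier_coeff h j * cis2pi (of_int j * x))" for x
  have series: "abs_fourier_series S (fourier_coeff h)"
    unfolding S_def by (rule abs_fourier_series_infsum[OF summable])
  have S_frac: "S (frac x) = S x" for x
    by (simp add: S_def cis2pi_of_int_mult_frac)
  have "S x - h x = 0" if "x \<in> {0..1}" for x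
  proof (rule continuous_eq_0_if_fourier_coeff_eq_0[OF _ _ _ that])
    show "continuous_on {0..1} (\<lambda>x. S x - h x)"
      using cont continuous_on_abs_fourier_series[OF series] by (intro continuous_intros)
    show "S 0 - h 0 = S 1 - h 1"
      using S_frac[of 1] loop by simp
    show "fourier_coeff (\<lambda>x. S x - h x) j = 0" for j
      using cont continuous_on_abs_fourier_series[OF series]
      by (simp add: fourier_coeff_diff fourier_coeff_abs_fourier_series[OF series])
  qed
  from this[of "frac x" for x] have "S = (\<lambda>x. h (frac x))"
    using S_frac by (auto simp: fun_eq_iff frac_ge_0 less_imp_le[OF frac_lt_1])
  then show ?thesis
    using series by simp
qed

section \<open>Inverse quadratic sums over translates of the integers\<close>

lemma inverse_quadratic_le_arctan_diff:
  fixes u w :: real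
  assumes "0 < w" "w \<le> 1"
  shows "1 / (1 + u\<^sup>2) \<le> 3 / w * (arctan (u + w) - arctan u)"
proof -
  have "\<exists>z. u < z \<and> z < u + w \<and> arctan (u + w) - arctan u = (u + w - u) * inverse (1 + z\<^sup>2)"
    by (rule MVT2) (use assms DERIV_arctan in auto)
  then obtain z where z: "u < z" "z < u + w" "arctan (u + w) - arctan u = w * inverse (1 + z\<^sup>2)"
    by auto
  have "\<bar>z\<bar> \<le> \<bar>u\<bar> + 1"
    using z assms by linarith
  then have "z\<^sup>2 \<le> (\<bar>u\<bar> + 1)\<^sup>2"
    by (metis abs_ge_zero power2_abs power_mono)
  also have "\<dots> = u\<^sup>2 + 2 * \<bar>u\<bar> + 1"
    by (simp add: power2_sum)
  also have "\<dots> \<le> 3 * u\<^sup>2 + 2"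
  proof -
    have "2 * \<bar>u\<bar> \<le> u\<^sup>2 + 1"
      using zero_le_power2[of "\<bar>u\<bar> - 1"] by (simp add: power2_diff)
    then show ?thesis
      using zero_le_power2[of u] by linarith
  qed
  finally have "1 + z\<^sup>2 \<le> 3 * (1 + u\<^sup>2)"
    by simp
  moreover have "1 + z\<^sup>2 > 0" "1 + u\<^sup>2 > 0"
    by (auto simp: add_pos_nonneg)
  ultimately have "1 / (1 + u\<^sup>2) \<le> 3 * inverse (1 + z\<^sup>2)"
    by (simp add: field_simps)
  also have "\<dots> = 3 / w * (arctan (u + w) - arctan u)"
    using z(3) assms by simp
  finally show ?thesis .
qed

lemma sum_inverse_quadratic_le:
  fixes S :: "int set" and w \<xi> :: real
  assumes w: "0 < w" "w \<le> 1" and S: "finite S"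
  shows "(\<Sum>l\<in>S. 1 / (1 + (w * (\<xi> - of_int l))\<^sup>2)) \<le> 10 / w"
proof -
  obtain n :: nat where n: "\<forall>l\<in>S. nat \<bar>l\<bar> < n"
    using finite_nat_set_iff_bounded[of "(\<lambda>l. nat \<bar>l\<bar>) ` S"] S by auto
  define a where "a k = arctan (w * (real k - real n - \<xi>))" for k
  have "S \<subseteq> (\<lambda>k. int k - int n) ` {..<2 * n}"
  proof
    fix l assume "l \<in> S"
    then show "l \<in> (\<lambda>k. int k - int n) ` {..<2 * n}"
      using n by (intro image_eqI[of _ _ "nat (l + int n)"]) auto
  qed
  then have "(\<Sum>l\<in>S. 1 / (1 + (w * (\<xi> - of_int l))\<^sup>2))
      \<le> (\<Sum>l\<in>(\<lambda>k. int k - int n) ` {..<2 * n}. 1 / (1 + (w * (\<xi> - of_int l))\<^sup>2))"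
    by (intro sum_mono2) auto
  also have "\<dots> = (\<Sum>k<2 * n. 1 / (1 + (w * (real k - real n - \<xi>))\<^sup>2))"
    by (subst sum.reindex) (auto simp: inj_on_def power_mult_distrib power2_commute algebra_simps)
  also have "\<dots> \<le> (\<Sum>k<2 * n. 3 / w * (a (Suc k) - a k))"
    using inverse_quadratic_le_arctan_diff[OF w, of "w * (real k - real n - \<xi>)" for k]
    by (intro sum_mono) (simp add: a_def algebra_simps)
  also have "\<dots> = 3 / w * (a (2 * n) - a 0)"
    by (simp only: sum_distrib_left[symmetric] sum_lessThan_telescope)
  also have "\<dots> \<le> 3 / w * pi"
    using arctan_bounded[of "w * (real (2 * n) - real n - \<xi>)"]
      arctan_bounded[of "w * (real 0 - real n - \<xi>)"] w
    unfolding a_def by (intro mult_left_mono) auto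
  also have "\<dots> \<le> 10 / w"
    using w pi_approx by (simp add: field_simps)
  finally show ?thesis .
qed

lemma summable_on_inverse_quadratic:
  fixes w :: real
  assumes "0 < w" "w \<le> 1"
  shows "(\<lambda>l::int. 1 / (1 + (w * of_int l)\<^sup>2)) summable_on UNIV"
proof (rule nonneg_bdd_above_summable_on)
  show "bdd_above (sum (\<lambda>l::int. 1 / (1 + (w * of_int l)\<^sup>2)) ` {F. F \<subseteq> UNIV \<and> finite F})"
    using sum_inverse_quadratic_le[OF assms, of _ 0]
    by (intro bdd_aboveI[of _ "10 / w"]) (auto simp: power_mult_distrib)
qed auto

section \<open>Periodic bumps\<close>

definition bump :: "real \<Rightarrow> real" where
  "bump x = (1 + cos (pi * max (-1) (min 1 x))) / 2"

lemma bump_nonneg: "bump x \<ge> 0"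
  unfolding bump_def by (smt (verit) cos_ge_minus_one divide_nonneg_nonneg)

lemma bump_eq_0: "\<bar>x\<bar> \<ge> 1 \<Longrightarrow> bump x = 0"
  unfolding bump_def by (cases "x \<ge> 0") (auto simp: max_def min_def)

lemma bump_eq_indicator: "bump x = indicator {-1..1} x * ((1 + cos (pi * x)) / 2)"
proof (cases "x \<in> {-1..1}")
  case True
  then show ?thesis
    by (auto simp: bump_def)
next
  case False
  then show ?thesis
    using bump_eq_0[of x] by auto
qed

lemma continuous_on_bump [continuous_intros]:
  fixes f :: "'a::t2_space \<Rightarrow> real"
  shows "continuous_on S f \<Longrightarrow> continuous_on S (\<lambda>x. bump (f x))"
  unfolding bump_def by (intro continuous_intros continuous_on_max continuous_on_min) auto

lemma fourier_integral_indicator_Icc: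
  "fourier_integral (\<lambda>x. indicator {-1..1} x) a
      = (if a = 0 then 2 else sin (2 * pi * a) / (pi * a))"
proof (cases "a = 0")
  case True
  have "fourier_integral (\<lambda>x. indicator {-1..1} x) 0
      = complex_of_real (\<integral>x. indicator {-1..1} x \<partial>(lborel :: real measure))"
    unfolding fourier_integral_def of_real_indicator[where 'a = complex, symmetric]
    by (simp add: content_real del: of_real_indicator)
  then show ?thesis
    using True by simp
next
  case False
  let ?G = "\<lambda>x. cis2pi (- a * x) / (2 * pi * \<i> * complex_of_real (- a))"
  have "fourier_integral (\<lambda>x. indicator {-1..1} x) a
      = (\<integral>x. indicator {-1..1} x *\<^sub>R cis2pi (- a * x) \<partial>lborel)"
    unfolding fourier_integral_def
    by (intro Bochner_Integration.integral_cong) (auto simp: indicator_def mult.commute)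
  also have "\<dots> = ?G 1 - ?G (-1)"
  proof (rule integral_FTC_Icc)
    show "(?G has_vector_derivative cis2pi (- a * x)) (at x within {-1..1})" for x
      using has_vector_derivative_divide[OF has_vector_derivative_cis2pi[of "- a"],
          where a = "2 * pi * \<i> * complex_of_real (- a)"] False
      by simp
  qed (auto intro!: continuous_intros)
  also have "\<dots> = (cis2pi a - cis2pi (- a)) / (2 * pi * \<i> * a)"
    by (simp add: diff_divide_distrib)
  also have "cis2pi a - cis2pi (- a) = 2 * \<i> * complex_of_real (sin (2 * pi * a))"
    by (simp add: cis2pi_def complex_eq_iff)
  finally show ?thesis
    using False by simp
qed

lemma integrable_indicator_Icc: "integrable lborel (\<lambda>x::real. indicator {a..b} x :: complex)"
  unfolding of_real_indicator[where 'a = complex, symmetric]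
  by (intro integrable_of_real integrable_real_indicator) (auto simp: emeasure_lborel_Icc_eq)

lemma fourier_integral_bump_eq:
  fixes t :: real
  defines "K \<equiv> fourier_integral (\<lambda>x. indicator {-1..1} x)"
  shows "fourier_integral (\<lambda>x. bump x) t = 1/2 * K t + 1/4 * K (t - 1/2) + 1/4 * K (t - (-1/2))"
proof -
  let ?I = "\<lambda>x::real. indicator {-1..1} x :: complex"
  have "complex_of_real (bump x)
      = 1/2 * ?I x + 1/4 * (?I x * cis2pi (1/2 * x)) + 1/4 * (?I x * cis2pi (-1/2 * x))" for x
    by (auto simp: bump_eq_indicator indicator_def cis2pi_def complex_eq_iff field_simps)
  then show ?thesis
    unfolding K_def
    by (simp only: fourier_integral_add fourier_integral_cmult fourier_integral_mult_cis2pi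
        integrable_indicator_Icc integrable_mult_cis2pi integrable_mult_right
        Bochner_Integration.integrable_add)
qed

lemma fourier_integral_bump_0: "fourier_integral (\<lambda>x. bump x) 0 = 1"
  unfolding fourier_integral_bump_eq fourier_integral_indicator_Icc by simp

lemma fourier_integral_bump:
  assumes "\<bar>t\<bar> > 1/2"
  shows "fourier_integral (\<lambda>x. bump x) t = sin (2 * pi * t) / (2 * pi * t * (1 - 4 * t\<^sup>2))"
proof -
  have t: "t \<noteq> 0" "t - 1/2 \<noteq> 0" "t + 1/2 \<noteq> 0" "1 - 4 * t\<^sup>2 \<noteq> 0"
    using assms power_strict_mono[of "1/2" "\<bar>t\<bar>" 2] by (auto simp: power2_eq_square)
  have shift: "sin (2 * pi * (t - 1/2)) = - sin (2 * pi * t)"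
    "sin (2 * pi * (t + 1/2)) = - sin (2 * pi * t)"
    by (simp_all add: sin_diff sin_add algebra_simps)
  have "fourier_integral (\<lambda>x. bump x) t = complex_of_real (1/2 * (sin (2 * pi * t) / (pi * t))
      - 1/4 * (sin (2 * pi * t) / (pi * (t - 1/2))) - 1/4 * (sin (2 * pi * t) / (pi * (t + 1/2))))"
    unfolding fourier_integral_bump_eq fourier_integral_indicator_Icc using t shift by simp
  also have "\<dots> = complex_of_real (sin (2 * pi * t) / (2 * pi * t * (1 - 4 * t\<^sup>2)))"
    using t by (intro arg_cong[where f = complex_of_real]) (simp add: divide_simps, algebra)
  finally show ?thesis
    by simp
qed

lemma integrable_bump: "integrable lborel (\<lambda>x. complex_of_real (bump x))"
  unfolding bump_eq_indicator of_real_mult of_real_indicator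
proof (rule integrable_mult_bounded[OF integrable_indicator_Icc])
  show "norm (complex_of_real ((1 + cos (pi * x)) / 2)) \<le> 1" for x
  proof -
    have "\<bar>1 + cos (pi * x)\<bar> \<le> 2"
      using cos_ge_minus_one[of "pi * x"] cos_le_one[of "pi * x"] by linarith
    then show ?thesis
      unfolding norm_of_real by simp
  qed
qed simp

lemma norm_fourier_integral_bump_le_1: "norm (fourier_integral (\<lambda>x. bump x) t) \<le> 1"
proof -
  have "norm (fourier_integral (\<lambda>x. bump x) t) \<le> (\<integral>x. norm (complex_of_real (bump x)) \<partial>lborel)"
    by (rule norm_fourier_integral_le)
  also have "(\<lambda>x. norm (complex_of_real (bump x))) = bump"
    using bump_nonneg by (auto simp: fun_eq_iff)
  also have "complex_of_real (\<integral>x. bump x \<partial>lborel) = 1"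
    using fourier_integral_bump_0 by (simp add: fourier_integral_def)
  then have "(\<integral>x. bump x \<partial>lborel) = 1"
    by simp
  finally show ?thesis .
qed

lemma norm_fourier_integral_bump_le: "norm (fourier_integral (\<lambda>x. bump x) t) \<le> 8 / (1 + \<bar>t\<bar>) ^ 3"
proof (cases "\<bar>t\<bar> \<le> 1")
  case True
  then have "(1 + \<bar>t\<bar>) ^ 3 \<le> 2 ^ 3"
    by (intro power_mono) auto
  then have "1 \<le> 8 / (1 + \<bar>t\<bar>) ^ 3"
    by (simp add: field_simps)
  with norm_fourier_integral_bump_le_1[of t] show ?thesis
    by linarith
next
  case False
  define u where "u = \<bar>t\<bar>"
  have u: "u > 1"
    using False by (simp add: u_def)
  then have "1 \<le> u\<^sup>2"
    by simp
  then have "u\<^sup>2 \<le> \<bar>1 - 4 * u\<^sup>2\<bar>"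
    by linarith
  have "norm (fourier_integral (\<lambda>x. bump x) t) = \<bar>sin (2 * pi * t)\<bar> / (2 * pi * u * \<bar>1 - 4 * u\<^sup>2\<bar>)"
    using False
    by (subst fourier_integral_bump)
       (auto simp: u_def norm_divide abs_mult simp del: of_real_mult simp flip: of_real_divide)
  also have "\<dots> \<le> 1 / (1 * u * u\<^sup>2)"
  proof (intro frac_le mult_mono)
    show "1 \<le> 2 * pi"
      using pi_ge_two by simp
  qed (use u \<open>u\<^sup>2 \<le> \<bar>1 - 4 * u\<^sup>2\<bar>\<close> in auto)
  also have "\<dots> = 8 / (2 * u) ^ 3"
    using u by (simp add: power2_eq_square power3_eq_cube)
  also have "\<dots> \<le> 8 / (1 + u) ^ 3"
    using u by (intro divide_left_mono power_mono) auto
  finally show ?thesis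
    by (simp add: u_def)
qed

lemma inverse_cubic_le_inverse_quadratic:
  fixes x :: real
  shows "8 / (1 + \<bar>x\<bar>) ^ 3 \<le> 8 * (1 / (1 + x\<^sup>2))"
proof -
  have "1 + x\<^sup>2 \<le> (1 + \<bar>x\<bar>)\<^sup>2"
    by (simp add: power2_sum)
  also have "\<dots> \<le> (1 + \<bar>x\<bar>) ^ 3"
    by (intro power_increasing) auto
  finally have "1 + x\<^sup>2 \<le> (1 + \<bar>x\<bar>) ^ 3" .
  moreover have "1 + x\<^sup>2 > 0"
    by (simp add: add_pos_nonneg)
  ultimately show ?thesis
    by (simp add: frac_le)
qed

definition scaled_bump :: "real \<Rightarrow> real \<Rightarrow> real \<Rightarrow> real" where
  "scaled_bump x0 v x = bump ((x - x0) / v) / v"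

lemma scaled_bump_nonneg: "v > 0 \<Longrightarrow> scaled_bump x0 v x \<ge> 0"
  by (simp add: scaled_bump_def bump_nonneg)

lemma scaled_bump_eq_0: "v > 0 \<Longrightarrow> \<bar>x - x0\<bar> \<ge> v \<Longrightarrow> scaled_bump x0 v x = 0"
  by (simp add: scaled_bump_def bump_eq_0)

lemma integrable_scaled_bump:
  assumes "v > 0"
  shows "integrable lborel (\<lambda>x. complex_of_real (scaled_bump x0 v x))"
  using lborel_integrable_real_affine[OF integrable_bump, of "1 / v" "- x0 / v"] assms
  by (simp add: scaled_bump_def diff_divide_distrib)

lemma fourier_integral_scaled_bump:
  assumes "v > 0"
  shows "fourier_integral (\<lambda>x. scaled_bump x0 v x) \<xi>
    = cis2pi (- (x0 * \<xi>)) * fourier_integral (\<lambda>x. bump x) (v * \<xi>)"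
proof -
  have shift: "\<bar>v\<bar> *\<^sub>R (scaled_bump x0 v (x0 + v * x) * cis2pi (- ((x0 + v * x) * \<xi>)))
      = cis2pi (- (x0 * \<xi>)) * (bump x * cis2pi (- (x * (v * \<xi>))))" for x
  proof -
    have "cis2pi (- ((x0 + v * x) * \<xi>)) = cis2pi (- (x0 * \<xi>)) * cis2pi (- (x * (v * \<xi>)))"
      by (simp add: cis2pi_add[symmetric] algebra_simps)
    then show ?thesis
      using assms by (simp add: scaled_bump_def scaleR_conv_of_real)
  qed
  have "fourier_integral (\<lambda>x. scaled_bump x0 v x) \<xi>
      = \<bar>v\<bar> *\<^sub>R (\<integral>x. scaled_bump x0 v (x0 + v * x) * cis2pi (- ((x0 + v * x) * \<xi>)) \<partial>lborel)"
    unfolding fourier_integral_def by (rule lborel_integral_real_affine) (use assms in auto)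
  also have "\<dots> = (\<integral>x. cis2pi (- (x0 * \<xi>)) * (bump x * cis2pi (- (x * (v * \<xi>)))) \<partial>lborel)"
    by (simp only: shift flip: Bochner_Integration.integral_scaleR_right)
  finally show ?thesis
    by (simp add: fourier_integral_def)
qed

lemma norm_fourier_integral_scaled_bump_le:
  assumes "v > 0"
  shows "norm (fourier_integral (\<lambda>x. scaled_bump x0 v x) \<xi>) \<le> 8 / (1 + v * \<bar>\<xi>\<bar>) ^ 3"
  using norm_fourier_integral_bump_le[of "v * \<xi>"] assms
  by (simp add: fourier_integral_scaled_bump norm_mult abs_mult)

text \<open>The bump sits in the middle of the period, away from the jump of \<open>frac\<close>.\<close>

definition periodic_bump :: "real \<Rightarrow> real \<Rightarrow> real" where
  "periodic_bump v x = scaled_bump (1/2) v (frac x)"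

definition periodic_bump_coeff :: "real \<Rightarrow> int \<Rightarrow> complex" where
  "periodic_bump_coeff v j = fourier_integral (\<lambda>x. scaled_bump (1/2) v x) (of_int j)"

lemma norm_periodic_bump_coeff_le:
  "v > 0 \<Longrightarrow> norm (periodic_bump_coeff v j) \<le> 8 / (1 + v * \<bar>of_int j\<bar>) ^ 3"
  using norm_fourier_integral_scaled_bump_le[of v "1/2" "of_int j"]
  by (simp add: periodic_bump_coeff_def)

lemma periodic_bump_coeff_0: "v > 0 \<Longrightarrow> periodic_bump_coeff v 0 = 1"
  by (simp add: periodic_bump_coeff_def fourier_integral_scaled_bump fourier_integral_bump_0)

lemma abs_fourier_series_periodic_bump:
  assumes v: "0 < v" "v \<le> 1/2"
  shows "abs_fourier_series (\<lambda>x. periodic_bump v x) (periodic_bump_coeff v)"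
proof -
  let ?h = "\<lambda>x. complex_of_real (scaled_bump (1/2) v x)"
  have cont: "continuous_on {0..1} ?h"
    using v unfolding scaled_bump_def by (intro continuous_intros) auto
  have outside: "?h x = 0" if "x \<notin> {0<..<1}" for x
    using that v by (auto intro!: scaled_bump_eq_0)
  have coeff: "fourier_coeff ?h = periodic_bump_coeff v"
    unfolding periodic_bump_coeff_def
    by (intro ext fourier_coeff_eq_fourier_integral cont outside) auto
  have "(\<lambda>j. norm (periodic_bump_coeff v j)) summable_on UNIV"
  proof (rule Infinite_Sum.abs_summable_on_comparison_test')
    show "(\<lambda>j::int. 8 * (1 / (1 + (v * of_int j)\<^sup>2))) summable_on UNIV"
      using v by (intro summable_on_cmult_right summable_on_inverse_quadratic) auto
    show "norm (periodic_bump_coeff v j) \<le> 8 * (1 / (1 + (v * of_int j)\<^sup>2))" for j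
      using norm_periodic_bump_coeff_le[OF v(1), of j]
        inverse_cubic_le_inverse_quadratic[of "v * of_int j"] v
      by (simp add: abs_mult)
  qed
  then have "abs_fourier_series (\<lambda>x. ?h (frac x)) (fourier_coeff ?h)"
    using outside[of 0] outside[of 1]
    by (intro abs_fourier_series_periodization cont) (auto simp: coeff)
  then show ?thesis
    by (simp add: coeff periodic_bump_def)
qed

definition bump_comb :: "nat \<Rightarrow> real \<Rightarrow> real \<Rightarrow> real \<Rightarrow> real" where
  "bump_comb q w s x = periodic_bump (q * w) (q * (x - s) + 1/2)"

definition bump_comb_coeff :: "nat \<Rightarrow> real \<Rightarrow> real \<Rightarrow> int \<Rightarrow> complex" where
  "bump_comb_coeff q w s l =
    (if int q dvd l
     then periodic_bump_coeff (q * w) (l div int q) * cis2pi (of_int (l div int q) * (1/2 - q * s))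
     else 0)"

lemma bump_comb_nonneg: "q > 0 \<Longrightarrow> w > 0 \<Longrightarrow> bump_comb q w s x \<ge> 0"
  by (simp add: bump_comb_def periodic_bump_def scaled_bump_nonneg)

lemma bump_comb_neq_0:
  assumes "q > 0" "w > 0" "bump_comb q w s x \<noteq> 0"
  obtains r :: int where "\<bar>x - s - of_int r / real q\<bar> < w"
proof -
  define y where "y = q * (x - s) + 1/2"
  have "\<bar>frac y - 1/2\<bar> < q * w"
    using assms scaled_bump_eq_0[of "q * w" "frac y" "1/2"]
    unfolding bump_comb_def periodic_bump_def y_def by force
  also have "frac y - 1/2 = q * (x - s - of_int \<lfloor>y\<rfloor> / real q)"
    using assms(1) by (simp add: frac_def y_def field_simps)
  finally show ?thesis
    using assms(1) that[of "\<lfloor>y\<rfloor>"] by (simp add: abs_mult)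
qed

lemma abs_fourier_series_bump_comb:
  assumes "q > 0" "w > 0" "q * w \<le> 1/2"
  shows "abs_fourier_series (\<lambda>x. bump_comb q w s x) (bump_comb_coeff q w s)"
proof -
  have "abs_fourier_series (\<lambda>x. periodic_bump (q * w) (of_int (int q) * x + (1/2 - q * s)))
      (bump_comb_coeff q w s)"
    unfolding bump_comb_coeff_def
    using assms by (intro abs_fourier_series_dilate abs_fourier_series_periodic_bump) auto
  then show ?thesis
    by (simp add: bump_comb_def algebra_simps)
qed

lemma bump_comb_coeff_0: "q > 0 \<Longrightarrow> w > 0 \<Longrightarrow> bump_comb_coeff q w s 0 = 1"
  by (simp add: bump_comb_coeff_def periodic_bump_coeff_0)

lemma norm_bump_comb_coeff_le:
  assumes "q > 0" "w > 0"
  shows "norm (bump_comb_coeff q w s l) \<le> (if int q dvd l then 8 / (1 + w * \<bar>of_int l\<bar>) ^ 3 else 0)"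
proof (cases "int q dvd l")
  case True
  then obtain j where "l = int q * j" ..
  then show ?thesis
    using norm_periodic_bump_coeff_le[of "q * w" j] assms
    by (simp add: bump_comb_coeff_def norm_mult abs_mult mult_ac)
qed (simp add: bump_comb_coeff_def)

definition bump_average :: "nat set \<Rightarrow> real \<Rightarrow> (nat \<Rightarrow> real) \<Rightarrow> real \<Rightarrow> real" where
  "bump_average P w s x = (\<Sum>q\<in>P. bump_comb q w (s q) x) / card P"

definition bump_average_coeff :: "nat set \<Rightarrow> real \<Rightarrow> (nat \<Rightarrow> real) \<Rightarrow> int \<Rightarrow> complex" where
  "bump_average_coeff P w s l = (\<Sum>q\<in>P. bump_comb_coeff q w (s q) l) / card P"

lemma bump_average_nonneg:
  assumes "\<And>q. q \<in> P \<Longrightarrow> q > 0" "w > 0"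
  shows "bump_average P w s x \<ge> 0"
  using assms by (simp add: bump_average_def sum_nonneg bump_comb_nonneg)

lemma bump_average_neq_0:
  assumes "bump_average P w s x \<noteq> 0" "\<And>q. q \<in> P \<Longrightarrow> q > 0" "w > 0"
  obtains q and r :: int where "q \<in> P" "\<bar>x - s q - of_int r / real q\<bar> < w"
proof -
  have "(\<Sum>q\<in>P. bump_comb q w (s q) x) \<noteq> 0"
    using assms(1) by (auto simp: bump_average_def)
  then obtain q where "q \<in> P" "bump_comb q w (s q) x \<noteq> 0"
    by (meson sum.neutral)
  then show ?thesis
    using assms that by (blast elim: bump_comb_neq_0)
qed

lemma abs_fourier_series_bump_average:
  assumes "finite P" "\<And>q. q \<in> P \<Longrightarrow> q > 0" "w > 0" "\<And>q. q \<in> P \<Longrightarrow> q * w \<le> 1/2"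
  shows "abs_fourier_series (\<lambda>x. bump_average P w s x) (bump_average_coeff P w s)"
proof -
  have "abs_fourier_series (\<lambda>x. 1 / card P * (\<Sum>q\<in>P. complex_of_real (bump_comb q w (s q) x)))
      (\<lambda>l. 1 / card P * (\<Sum>q\<in>P. bump_comb_coeff q w (s q) l))"
    using assms
    by (intro abs_fourier_series_cmult abs_fourier_series_sum abs_fourier_series_bump_comb) auto
  then show ?thesis
    by (simp add: bump_average_def bump_average_coeff_def[abs_def])
qed

lemma bump_average_coeff_0:
  assumes "finite P" "P \<noteq> {}" "\<And>q. q \<in> P \<Longrightarrow> q > 0" "w > 0"
  shows "bump_average_coeff P w s 0 = 1"
  using assms by (simp add: bump_average_coeff_def bump_comb_coeff_0)

lemma norm_bump_average_coeff_le:
  assumes "finite P" "\<And>q. q \<in> P \<Longrightarrow> q > 0" "w > 0"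
  shows "norm (bump_average_coeff P w s l)
    \<le> card {q \<in> P. int q dvd l} / card P * (8 / (1 + w * \<bar>of_int l\<bar>) ^ 3)"
proof -
  have "norm (\<Sum>q\<in>P. bump_comb_coeff q w (s q) l)
      \<le> (\<Sum>q\<in>P. if int q dvd l then 8 / (1 + w * \<bar>of_int l\<bar>) ^ 3 else 0)"
    using assms by (intro sum_norm_le norm_bump_comb_coeff_le) auto
  also have "\<dots> = card {q \<in> P. int q dvd l} * (8 / (1 + w * \<bar>of_int l\<bar>) ^ 3)"
    using assms(1) by (simp add: sum.If_cases Int_def)
  finally have "norm (\<Sum>q\<in>P. bump_comb_coeff q w (s q) l) / card P
      \<le> card {q \<in> P. int q dvd l} * (8 / (1 + w * \<bar>of_int l\<bar>) ^ 3) / card P"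
    by (rule divide_right_mono) simp
  then show ?thesis
    by (simp add: bump_average_coeff_def norm_divide mult.commute)
qed

section \<open>Primes\<close>

lemma ln_fact_eq_sum_mangoldt:
  assumes "n \<le> N"
  shows "ln (fact n :: real) = (\<Sum>d\<in>{1..N}. mangoldt d * real (n div d))"
  using assms
proof (induction n)
  case (Suc n)
  have "ln (fact (Suc n) :: real) = ln (real (Suc n)) + ln (fact n)"
    by (simp add: ln_mult del: of_nat_Suc)
  also have "ln (real (Suc n)) = (\<Sum>d | d dvd Suc n. mangoldt d)"
    using mangoldt_sum[of "Suc n", where ?'a = real] by simp
  also have "\<dots> = (\<Sum>d\<in>{1..N}. if d dvd Suc n then mangoldt d else 0)"
  proof (rule sum.mono_neutral_cong_left)
    show "{d. d dvd Suc n} \<subseteq> {1..N}"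
    proof
      fix d assume "d \<in> {d. d dvd Suc n}"
      then have "d > 0" "d \<le> Suc n"
        by (auto intro: dvd_pos_nat dvd_imp_le)
      then show "d \<in> {1..N}"
        using Suc.prems by simp
    qed
  qed auto
  also have "ln (fact n :: real) = (\<Sum>d\<in>{1..N}. mangoldt d * real (n div d))"
    using Suc by simp
  finally show ?case
    unfolding sum.distrib[symmetric]
    by (auto intro!: sum.cong simp: div_Suc dvd_eq_mod_eq_0 algebra_simps)
qed auto

lemma card_prime_powers_le:
  fixes N p :: nat
  assumes "N > 0" "prime p"
  shows "card {d \<in> {1..N}. primepow d \<and> aprimedivisor d = p} * ln (real p) \<le> ln (real N)"
proof -
  define m where "m = nat \<lfloor>ln (real N) / ln (real p)\<rfloor>"
  have p: "p > 1"
    using assms(2) by (rule prime_gt_1_nat)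
  have "{d \<in> {1..N}. primepow d \<and> aprimedivisor d = p} \<subseteq> (^) p ` {1..m}"
  proof
    fix d assume d: "d \<in> {d \<in> {1..N}. primepow d \<and> aprimedivisor d = p}"
    define k where "k = multiplicity p d"
    have d_eq: "d = p ^ k"
      using d primepow_decompose[of d] by (simp add: k_def)
    have "k > 0"
      using d d_eq by (cases k) auto
    have "k * ln (real p) = ln (real d)"
      using p by (simp add: d_eq ln_realpow)
    also have "\<dots> \<le> ln (real N)"
      using d by simp
    finally have "real k \<le> ln (real N) / ln (real p)"
      using p by (simp add: pos_le_divide_eq)
    then show "d \<in> (^) p ` {1..m}"
      using d_eq \<open>k > 0\<close> by (auto simp: m_def le_nat_iff le_floor_iff)
  qed
  then have "card {d \<in> {1..N}. primepow d \<and> aprimedivisor d = p} \<le> m"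
    using surj_card_le[of "{1..m}" _ "(^) p"] by simp
  also have "real m \<le> ln (real N) / ln (real p)"
    using p assms(1) by (simp add: m_def)
  finally show ?thesis
    using p by (simp add: pos_le_divide_eq)
qed

lemma sum_mangoldt_le:
  fixes N :: nat
  shows "(\<Sum>d\<in>{1..N}. mangoldt d) \<le> card {p. prime p \<and> p \<le> N} * ln (real N)"
proof (cases "N = 0")
  case False
  let ?D = "{d \<in> {1..N}. primepow d}" and ?P = "{p. prime p \<and> p \<le> N}"
  have "(\<Sum>d\<in>{1..N}. mangoldt d :: real) = (\<Sum>d\<in>?D. ln (real (aprimedivisor d)))"
    by (rule sum.mono_neutral_cong_right) (auto simp: mangoldt_def)
  also have "\<dots> = (\<Sum>p\<in>?P. \<Sum>d\<in>{d \<in> ?D. aprimedivisor d = p}. ln (real (aprimedivisor d)))"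
  proof (rule sum.group[symmetric])
    show "aprimedivisor ` ?D \<subseteq> ?P"
    proof clarify
      fix d assume d: "d \<in> {1..N}" "primepow d"
      then show "prime (aprimedivisor d) \<and> aprimedivisor d \<le> N"
        using primepow_gt_Suc_0[of d] aprimedivisor_le_nat[of d]
        by (auto intro: prime_aprimedivisor' order_trans)
    qed
  qed auto
  also have "\<dots> = (\<Sum>p\<in>?P. card {d \<in> ?D. aprimedivisor d = p} * ln (real p))"
    by (intro sum.cong refl) simp
  also have "\<dots> \<le> (\<Sum>p\<in>?P. ln (real N))"
    using card_prime_powers_le[of N] False by (intro sum_mono) (simp add: conj_assoc)
  finally show ?thesis
    by simp
qed auto

lemma double_div_le: "2 * n div d \<le> 2 * (n div d) + (1 :: nat)"
proof (cases "d = 0")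
  case False
  have "2 * n = d * (2 * (n div d)) + 2 * (n mod d)"
    by (metis mult.left_commute mult_div_mod_eq distrib_left)
  then have "2 * n div d = 2 * (n div d) + 2 * (n mod d) div d"
    using False by simp
  moreover have "2 * (n mod d) div d < 2"
    using False by (auto simp: div_less_iff_less_mult)
  ultimately show ?thesis
    by linarith
qed simp

text \<open>Chebyshev: the von Mangoldt expansion of the central binomial coefficient has
  coefficients \<open>2n div d - 2 (n div d) \<le> 1\<close>.\<close>

lemma ln_central_binomial_le_sum_mangoldt:
  "ln (real (2 * n choose n)) \<le> (\<Sum>d\<in>{1..2 * n}. mangoldt d)"
proof -
  have "real (2 * n choose n) = fact (2 * n) / (fact n * fact n)"
    using binomial_fact[of n "2 * n", where ?'a = real] by (simp add: mult_2)
  then have "ln (real (2 * n choose n)) = ln (fact (2 * n)) - 2 * ln (fact n)"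
    by (simp add: ln_div ln_mult)
  also have "\<dots> = (\<Sum>d\<in>{1..2 * n}. mangoldt d * (real (2 * n div d) - 2 * real (n div d)))"
    using ln_fact_eq_sum_mangoldt[of "2 * n" "2 * n"] ln_fact_eq_sum_mangoldt[of n "2 * n"]
    by (simp add: sum_distrib_left sum_subtractf algebra_simps)
  also have "\<dots> \<le> (\<Sum>d\<in>{1..2 * n}. mangoldt d * 1)"
  proof (intro sum_mono mult_left_mono mangoldt_nonneg)
    fix d
    show "real (2 * n div d) - 2 * real (n div d) \<le> 1"
      using double_div_le[of n d] by linarith
  qed
  finally show ?thesis
    by simp
qed

lemma card_primes_lower_bound:
  fixes n :: nat
  assumes "n > 0"
  shows "n * ln 4 - ln (2 * real n) \<le> card {p. prime p \<and> p \<le> 2 * n} * ln (2 * real n)"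
proof -
  have "n * ln 4 - ln (2 * real n) = ln (4 ^ n / (2 * real n))"
    using assms by (simp add: ln_div ln_realpow)
  also have "\<dots> \<le> ln (real (2 * n choose n))"
    using central_binomial_lower_bound[OF assms] assms by (subst ln_le_cancel_iff) auto
  also have "\<dots> \<le> (\<Sum>d\<in>{1..2 * n}. mangoldt d)"
    by (rule ln_central_binomial_le_sum_mangoldt)
  also have "\<dots> \<le> card {p. prime p \<and> p \<le> 2 * n} * ln (2 * real n)"
    using sum_mangoldt_le[of "2 * n"] by simp
  finally show ?thesis .
qed

definition prime_window :: "real \<Rightarrow> real \<Rightarrow> nat set" where
  "prime_window \<epsilon> M = {q. prime q \<and> M powr (1 - \<epsilon>) \<le> real q \<and> real q \<le> M}"

lemma prime_windowD:
  assumes "q \<in> prime_window \<epsilon> M"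
  shows "prime q" "M powr (1 - \<epsilon>) \<le> real q" "real q \<le> M" "q > 0"
  using assms prime_gt_0_nat by (auto simp: prime_window_def)

lemma finite_prime_window: "finite (prime_window \<epsilon> M)"
  by (rule finite_subset[of _ "{..nat \<lfloor>M\<rfloor>}"]) (auto simp: prime_window_def le_nat_floor)

lemma card_primes_le_card_prime_window:
  assumes "real N \<le> M"
  shows "card {p. prime p \<and> p \<le> N} \<le> card (prime_window \<epsilon> M) + M powr (1 - \<epsilon>) + 1"
proof -
  let ?P = "{p. prime p \<and> p \<le> N}" and ?R = "{..nat \<lfloor>M powr (1 - \<epsilon>)\<rfloor>}"
  have "?P \<subseteq> prime_window \<epsilon> M \<union> ?R"
  proof
    fix p assume p: "p \<in> ?P"
    then have "real p \<le> real N"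
      by simp
    then have "real p \<le> M"
      using assms by linarith
    then show "p \<in> prime_window \<epsilon> M \<union> ?R"
      using p by (cases "M powr (1 - \<epsilon>) \<le> real p") (auto simp: prime_window_def le_nat_floor)
  qed
  then have "card ?P \<le> card (prime_window \<epsilon> M \<union> ?R)"
    by (intro card_mono) (auto simp: finite_prime_window)
  also have "\<dots> \<le> card (prime_window \<epsilon> M) + card ?R"
    by (rule card_Un_le)
  finally have "real (card ?P) \<le> real (card (prime_window \<epsilon> M)) + real (card ?R)"
    by linarith
  also have "real (card ?R) \<le> M powr (1 - \<epsilon>) + 1"
    by simp
  finally show ?thesis
    by simp
qed

lemma eventually_card_prime_window_ge:
  fixes \<epsilon> :: real
  assumes "0 < \<epsilon>" "\<epsilon> < 1"
  shows "\<forall>\<^sub>F M in at_top. M powr (1 - \<epsilon>) \<le> card (prime_window \<epsilon> M)"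
proof -
  have "\<forall>\<^sub>F M::real in at_top. (M/2 - 1) * ln 4 - ln M \<ge> (2 * M powr (1 - \<epsilon>) + 1) * ln M"
    using assms by real_asymp
  then show ?thesis
    using eventually_ge_at_top[of 4]
  proof eventually_elim
    case (elim M)
    define n where "n = nat \<lfloor>M / 2\<rfloor>"
    have n: "real n \<le> M / 2" "real n > M / 2 - 1" "n > 0"
      using elim unfolding n_def by linarith+
    have "(2 * M powr (1 - \<epsilon>) + 1) * ln M \<le> (M/2 - 1) * ln 4 - ln M"
      by (rule elim)
    also have "\<dots> \<le> n * ln 4 - ln (2 * real n)"
      using n elim by (intro diff_mono mult_right_mono) auto
    also have "\<dots> \<le> card {p. prime p \<and> p \<le> 2 * n} * ln (2 * real n)"
      by (rule card_primes_lower_bound[OF n(3)])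
    also have "\<dots> \<le> card {p. prime p \<and> p \<le> 2 * n} * ln M"
      using n elim by (intro mult_left_mono) auto
    finally have "2 * M powr (1 - \<epsilon>) + 1 \<le> card {p. prime p \<and> p \<le> 2 * n}"
      using elim by simp
    then show ?case
      using card_primes_le_card_prime_window[of "2 * n" M \<epsilon>] n(1) by simp
  qed
qed

lemma card_prime_divisors_le:
  fixes P :: "nat set" and l :: int
  assumes "finite P" and prime: "\<And>p. p \<in> P \<Longrightarrow> prime p" and large: "\<And>p. p \<in> P \<Longrightarrow> a \<le> real p"
    and "a > 1" "l \<noteq> 0"
  shows "card {p \<in> P. int p dvd l} * ln a \<le> ln \<bar>real_of_int l\<bar>"
proof -
  let ?D = "{p \<in> P. int p dvd l}"
  have prod_dvd: "(\<Prod>p\<in>D. int p) dvd l" if "finite D" "D \<subseteq> ?D" for D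
    using that
  proof (induction D rule: finite_induct)
    case (insert p D)
    have "coprime (int p) (\<Prod>q\<in>D. int q)"
      using insert prime by (intro prod_coprime_right) (auto intro!: primes_coprime)
    then show ?case
      using insert by (auto intro!: divides_mult)
  qed auto
  have "a ^ card ?D = (\<Prod>p\<in>?D. a)"
    by simp
  also have "\<dots> \<le> (\<Prod>p\<in>?D. real p)"
    using large \<open>a > 1\<close> by (intro prod_mono) auto
  also have "\<dots> = real_of_int \<bar>\<Prod>p\<in>?D. int p\<bar>"
    by (simp add: abs_prod)
  also have "\<dots> \<le> \<bar>real_of_int l\<bar>"
    using dvd_imp_le_int[OF \<open>l \<noteq> 0\<close> prod_dvd] \<open>finite P\<close> by (simp flip: of_int_abs)
  finally have "ln (a ^ card ?D) \<le> ln \<bar>real_of_int l\<bar>"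
    using \<open>a > 1\<close> \<open>l \<noteq> 0\<close> by (subst ln_le_cancel_iff) auto
  then show ?thesis
    using \<open>a > 1\<close> by (simp add: ln_realpow)
qed

lemma card_prime_window_divisors_le:
  fixes l :: int
  assumes M: "M > 1" "ln M \<ge> 1" and \<epsilon>: "0 < \<epsilon>" "\<epsilon> \<le> 1/2" and \<kappa>: "\<kappa> > 0" and l: "l \<noteq> 0"
  shows "card {q \<in> prime_window \<epsilon> M. int q dvd l} \<le> 2 * (\<kappa> + 1) * (1 + M powr - \<kappa> * \<bar>of_int l\<bar>)"
    (is "real (card ?D) \<le> _")
proof -
  define u where "u = M powr - \<kappa> * \<bar>real_of_int l\<bar>"
  have u: "u > 0"
    using M l by (simp add: u_def)
  have "card ?D * ((1 - \<epsilon>) * ln M) = card ?D * ln (M powr (1 - \<epsilon>))"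
    using M by (simp add: ln_powr)
  also have "\<dots> \<le> ln \<bar>real_of_int l\<bar>"
    using M \<epsilon> l by (intro card_prime_divisors_le finite_prime_window) (auto dest: prime_windowD)
  also have "\<bar>real_of_int l\<bar> = u * M powr \<kappa>"
    using M by (simp add: u_def powr_minus field_simps)
  also have "ln \<dots> = ln u + \<kappa> * ln M"
    using u M by (subst ln_mult) (auto simp: ln_powr)
  also have "\<dots> \<le> u * ln M + \<kappa> * ln M"
  proof -
    have "ln u \<le> u * 1"
      using ln_le_minus_one[OF u] by simp
    also have "\<dots> \<le> u * ln M"
      using u M by (intro mult_left_mono) auto
    finally show ?thesis
      by simp
  qed
  finally have "(card ?D * (1 - \<epsilon>)) * ln M \<le> (u + \<kappa>) * ln M"
    by (simp add: algebra_simps)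
  then have "card ?D * (1 - \<epsilon>) \<le> u + \<kappa>"
    using M by simp
  moreover have "card ?D * (1/2) \<le> card ?D * (1 - \<epsilon>)"
    using \<epsilon> by (intro mult_left_mono) auto
  ultimately have "card ?D * (1/2) \<le> u + \<kappa>"
    by (rule order_trans[rotated])
  then have "card ?D \<le> 2 * (u + \<kappa>)"
    by simp
  also have "\<dots> \<le> 2 * (\<kappa> + 1) * (1 + u)"
    using \<kappa> u by (simp add: algebra_simps)
  finally show ?thesis
    by (simp add: u_def)
qed

lemma norm_prime_window_average_coeff_le:
  fixes l :: int
  assumes M: "M > 1" "ln M \<ge> 1" and \<epsilon>: "0 < \<epsilon>" "\<epsilon> \<le> 1/2" and \<kappa>: "\<kappa> > 0" and l: "l \<noteq> 0"
    and many: "M powr (1 - \<epsilon>) \<le> card (prime_window \<epsilon> M)" and large: "16 * (\<kappa> + 1) \<le> M powr \<epsilon>"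
  shows "norm (bump_average_coeff (prime_window \<epsilon> M) (M powr - \<kappa>) s l)
    \<le> M powr (2 * \<epsilon> - 1) / (1 + (M powr - \<kappa> * of_int l)\<^sup>2)"
proof -
  define u where "u = M powr - \<kappa> * \<bar>real_of_int l\<bar>"
  let ?P = "prime_window \<epsilon> M"
  have u: "u > 0"
    using M l by (simp add: u_def)
  have M_pos: "M powr (1 - \<epsilon>) > 0"
    using M by simp
  have "norm (bump_average_coeff ?P (M powr - \<kappa>) s l)
      \<le> card {q \<in> ?P. int q dvd l} / card ?P * (8 / (1 + u) ^ 3)"
    unfolding u_def using M
    by (intro norm_bump_average_coeff_le finite_prime_window) (auto dest: prime_windowD)
  also have "\<dots> \<le> (2 * (\<kappa> + 1) * (1 + u)) / M powr (1 - \<epsilon>) * (8 / (1 + u) ^ 3)"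
    using card_prime_window_divisors_le[OF M \<epsilon> \<kappa> l] u \<kappa> many M_pos
    by (intro mult_right_mono frac_le) (auto simp: u_def)
  also have "\<dots> = 16 * (\<kappa> + 1) / (1 + u)\<^sup>2 / M powr (1 - \<epsilon>)"
    using u by (simp add: power2_eq_square power3_eq_cube)
  also have "\<dots> \<le> M powr \<epsilon> / (1 + u\<^sup>2) / M powr (1 - \<epsilon>)"
    using u large by (intro divide_right_mono frac_le) (auto simp: power2_sum add_pos_nonneg)
  also have "\<dots> = M powr (2 * \<epsilon> - 1) / (1 + u\<^sup>2)"
    using powr_diff[of M \<epsilon> "1 - \<epsilon>"] by (simp add: mult.commute)
  finally show ?thesis
    by (simp add: u_def power_mult_distrib)
qed

section \<open>Multiplication by a Fourier series\<close>

definition spectral_bounds :: "(real \<Rightarrow> complex) \<Rightarrow> real \<Rightarrow> real \<Rightarrow> bool" where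
  "spectral_bounds f L C \<longleftrightarrow> integrable lborel f \<and>
     (\<forall>\<xi> S. finite S \<longrightarrow> (\<Sum>l\<in>S. norm (fourier_integral f (\<xi> - of_int l))) \<le> L) \<and>
     (\<forall>\<xi>. \<xi>\<^sup>2 * norm (fourier_integral f \<xi>) \<le> C)"

lemma spectral_boundsD:
  assumes "spectral_bounds f L C"
  shows "integrable lborel f"
    and "finite S \<Longrightarrow> (\<Sum>l\<in>S. norm (fourier_integral f (\<xi> - of_int l))) \<le> L"
    and "\<xi>\<^sup>2 * norm (fourier_integral f \<xi>) \<le> C"
  using assms by (auto simp: spectral_bounds_def)

lemma spectral_bounds_nonneg:
  assumes "spectral_bounds f L C"
  shows "L \<ge> 0" "C \<ge> 0"
  using spectral_boundsD(2)[OF assms, of "{}"] spectral_boundsD(3)[OF assms, of 0] by auto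

lemma spectral_bounds_mono:
  assumes "spectral_bounds f L C" "L \<le> L'" "C \<le> C'"
  shows "spectral_bounds f L' C'"
  using assms unfolding spectral_bounds_def by (meson order_trans)

lemma spectral_bounds_scaled_bump:
  assumes v: "0 < v" "v \<le> 1"
  shows "spectral_bounds (\<lambda>x. scaled_bump x0 v x) (80 / v) (8 / v\<^sup>2)"
  unfolding spectral_bounds_def
proof (intro conjI allI impI)
  let ?f = "\<lambda>x. complex_of_real (scaled_bump x0 v x)"
  have quad: "norm (fourier_integral ?f \<xi>) \<le> 8 * (1 / (1 + (v * \<xi>)\<^sup>2))" for \<xi>
    using norm_fourier_integral_scaled_bump_le[OF v(1), of x0 \<xi>]
      inverse_cubic_le_inverse_quadratic[of "v * \<xi>"] v
    by (simp add: abs_mult)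
  show "integrable lborel ?f"
    using v by (intro integrable_scaled_bump)
  show "(\<Sum>l\<in>S. norm (fourier_integral ?f (\<xi> - of_int l))) \<le> 80 / v" if "finite S"
    for \<xi> and S :: "int set"
  proof -
    have "(\<Sum>l\<in>S. norm (fourier_integral ?f (\<xi> - of_int l)))
        \<le> 8 * (\<Sum>l\<in>S. 1 / (1 + (v * (\<xi> - of_int l))\<^sup>2))"
      unfolding sum_distrib_left by (intro sum_mono quad)
    also have "\<dots> \<le> 8 * (10 / v)"
      using v that by (intro mult_left_mono sum_inverse_quadratic_le) auto
    finally show ?thesis
      by simp
  qed
  show "\<xi>\<^sup>2 * norm (fourier_integral ?f \<xi>) \<le> 8 / v\<^sup>2" for \<xi>
  proof -
    have "1 + (v * \<xi>)\<^sup>2 > 0"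
      by (simp add: add_pos_nonneg)
    then have "\<xi>\<^sup>2 * (8 * (1 / (1 + (v * \<xi>)\<^sup>2))) \<le> 8 / v\<^sup>2"
      using v by (simp add: divide_simps power_mult_distrib algebra_simps)
    then show ?thesis
      using mult_left_mono[OF quad[of \<xi>], of "\<xi>\<^sup>2"] by simp
  qed
qed

lemma norm_fourier_integral_scaled_bump_le_powr:
  assumes v: "0 < v" "v \<le> 1" and \<sigma>: "\<sigma> \<le> 3"
  shows "norm (fourier_integral (\<lambda>x. scaled_bump x0 v x) \<xi>) \<le> 8 / v ^ 3 * (1 + \<bar>\<xi>\<bar>) powr - \<sigma>"
proof -
  let ?z = "1 + \<bar>\<xi>\<bar>"
  have "v * ?z \<le> 1 + v * \<bar>\<xi>\<bar>"
    using v by (simp add: distrib_left)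
  have "norm (fourier_integral (\<lambda>x. scaled_bump x0 v x) \<xi>) \<le> 8 / (1 + v * \<bar>\<xi>\<bar>) ^ 3"
    using v by (intro norm_fourier_integral_scaled_bump_le)
  also have "\<dots> \<le> 8 / (v * ?z) ^ 3"
    using v \<open>v * ?z \<le> _\<close>
    by (intro divide_left_mono power_mono mult_pos_pos zero_less_power) (auto simp: add_pos_nonneg)
  also have "\<dots> = 8 / v ^ 3 * ?z powr - 3"
    by (simp add: power_mult_distrib powr_minus powr_numeral divide_inverse)
  also have "\<dots> \<le> 8 / v ^ 3 * ?z powr - \<sigma>"
    using v \<sigma> by (intro mult_left_mono powr_mono) auto
  finally show ?thesis .
qed

lemma norm_has_sum_le:
  assumes "(g has_sum s) A" "\<And>X. finite X \<Longrightarrow> X \<subseteq> A \<Longrightarrow> (\<Sum>x\<in>X. norm (g x)) \<le> B"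
  shows "norm s \<le> B"
proof (rule tendsto_upperbound)
  show "((\<lambda>X. norm (\<Sum>x\<in>X. g x)) \<longlongrightarrow> norm s) (finite_subsets_at_top A)"
    using assms(1) unfolding has_sum_def by (rule tendsto_norm)
  show "\<forall>\<^sub>F X in finite_subsets_at_top A. norm (\<Sum>x\<in>X. g x) \<le> B"
    by (rule eventually_finite_subsets_at_top_weakI) (meson assms(2) norm_sum order_trans)
qed simp

lemma norm_fourier_integral_mult_series_le:
  assumes f: "spectral_bounds f L C" and F: "abs_fourier_series F c" and D: "\<And>l. norm (c l) \<le> D"
  shows "norm (fourier_integral (\<lambda>x. f x * F x) \<xi>) \<le> D * L"
proof (rule norm_has_sum_le
    [OF fourier_integral_mult_series_has_sum[OF spectral_boundsD(1)[OF f] F]])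
  fix X :: "int set" assume "finite X"
  have "(\<Sum>l\<in>X. norm (c l * fourier_integral f (\<xi> - of_int l)))
      \<le> (\<Sum>l\<in>X. D * norm (fourier_integral f (\<xi> - of_int l)))"
    by (intro sum_mono) (simp add: norm_mult D mult_right_mono)
  also have "\<dots> \<le> D * L"
    using spectral_boundsD(2)[OF f \<open>finite X\<close>] order_trans[OF norm_ge_zero D]
    by (simp add: mult_left_mono flip: sum_distrib_left)
  finally show "(\<Sum>l\<in>X. norm (c l * fourier_integral f (\<xi> - of_int l))) \<le> D * L" .
qed

lemma square_mult_norm_fourier_integral_mult_series_le:
  assumes f: "spectral_bounds f L C" and F: "abs_fourier_series F c"
    and A: "\<And>X. finite X \<Longrightarrow> (\<Sum>l\<in>X. norm (c l)) \<le> A" and B: "\<And>l. (of_int l)\<^sup>2 * norm (c l) \<le> B"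
  shows "\<xi>\<^sup>2 * norm (fourier_integral (\<lambda>x. f x * F x) \<xi>) \<le> 2 * (B * L + A * C)"
proof -
  define \<phi> where "\<phi> l = norm (fourier_integral f (\<xi> - of_int l))" for l :: int
  have split: "\<xi>\<^sup>2 * (norm (c l) * \<phi> l) \<le> 2 * (B * \<phi> l + norm (c l) * C)" for l
  proof -
    have "\<xi>\<^sup>2 \<le> 2 * ((of_int l)\<^sup>2 + (\<xi> - of_int l)\<^sup>2)"
      using zero_le_power2[of "\<xi> - 2 * of_int l"] by (simp add: power2_eq_square algebra_simps)
    then have "\<xi>\<^sup>2 * (norm (c l) * \<phi> l)
        \<le> 2 * ((of_int l)\<^sup>2 + (\<xi> - of_int l)\<^sup>2) * (norm (c l) * \<phi> l)"
      by (intro mult_right_mono) (auto simp: \<phi>_def)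
    also have "\<dots> = 2 * (((of_int l)\<^sup>2 * norm (c l)) * \<phi> l + norm (c l) * ((\<xi> - of_int l)\<^sup>2 * \<phi> l))"
      by (simp add: algebra_simps)
    also have "\<dots> \<le> 2 * (B * \<phi> l + norm (c l) * C)"
      using B[of l] spectral_boundsD(3)[OF f, of "\<xi> - of_int l"]
      by (intro mult_left_mono add_mono mult_right_mono) (auto simp: \<phi>_def)
    finally show ?thesis .
  qed
  have "norm (of_real (\<xi>\<^sup>2) * fourier_integral (\<lambda>x. f x * F x) \<xi>) \<le> 2 * (B * L + A * C)"
  proof (rule norm_has_sum_le[OF has_sum_cmult_right[OF
          fourier_integral_mult_series_has_sum[OF spectral_boundsD(1)[OF f] F]]])
    fix X :: "int set" assume X: "finite X"
    have "(\<Sum>l\<in>X. norm (of_real (\<xi>\<^sup>2) * (c l * fourier_integral f (\<xi> - of_int l))))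
        = (\<Sum>l\<in>X. \<xi>\<^sup>2 * (norm (c l) * \<phi> l))"
      by (simp add: norm_mult \<phi>_def norm_power)
    also have "\<dots> \<le> (\<Sum>l\<in>X. 2 * (B * \<phi> l + norm (c l) * C))"
      by (intro sum_mono split)
    also have "\<dots> = 2 * (B * (\<Sum>l\<in>X. \<phi> l) + (\<Sum>l\<in>X. norm (c l)) * C)"
      by (simp add: sum.distrib flip: sum_distrib_left sum_distrib_right)
    also have "\<dots> \<le> 2 * (B * L + A * C)"
      using B[of 0] spectral_bounds_nonneg[OF f] spectral_boundsD(2)[OF f X] A[OF X]
      by (intro mult_left_mono add_mono mult_right_mono) (auto simp: \<phi>_def)
    finally show "(\<Sum>l\<in>X. norm (of_real (\<xi>\<^sup>2) * (c l * fourier_integral f (\<xi> - of_int l))))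
        \<le> 2 * (B * L + A * C)" .
  qed
  then show ?thesis
    by (simp add: norm_mult norm_power)
qed

lemma sum_norm_fourier_integral_mult_series_le:
  assumes f: "spectral_bounds f L C" and F: "abs_fourier_series F c"
    and A: "\<And>X. finite X \<Longrightarrow> (\<Sum>l\<in>X. norm (c l)) \<le> A" and S: "finite S"
  shows "(\<Sum>m\<in>S. norm (fourier_integral (\<lambda>x. f x * F x) (\<xi> - of_int m))) \<le> A * L"
proof (rule tendsto_upperbound)
  let ?s = "\<lambda>X m. \<Sum>l\<in>X. c l * fourier_integral f (\<xi> - of_int m - of_int l)"
  show "((\<lambda>X. \<Sum>m\<in>S. norm (?s X m)) \<longlongrightarrow>
      (\<Sum>m\<in>S. norm (fourier_integral (\<lambda>x. f x * F x) (\<xi> - of_int m)))) (finite_subsets_at_top UNIV)"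
    using fourier_integral_mult_series_has_sum[OF spectral_boundsD(1)[OF f] F]
    by (intro tendsto_sum tendsto_norm) (simp add: has_sum_def)
  show "\<forall>\<^sub>F X in finite_subsets_at_top UNIV. (\<Sum>m\<in>S. norm (?s X m)) \<le> A * L"
  proof (rule eventually_finite_subsets_at_top_weakI)
    fix X :: "int set" assume X: "finite X"
    have "(\<Sum>m\<in>S. norm (?s X m))
        \<le> (\<Sum>m\<in>S. \<Sum>l\<in>X. norm (c l) * norm (fourier_integral f (\<xi> - of_int l - of_int m)))"
      by (intro sum_mono sum_norm_le) (auto simp: norm_mult algebra_simps)
    also have "\<dots> = (\<Sum>l\<in>X. norm (c l) * (\<Sum>m\<in>S. norm (fourier_integral f (\<xi> - of_int l - of_int m))))"
      by (subst sum.swap) (simp add: sum_distrib_left)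
    also have "\<dots> \<le> (\<Sum>l\<in>X. norm (c l) * L)"
      by (intro sum_mono mult_left_mono spectral_boundsD(2)[OF f S]) auto
    also have "\<dots> \<le> A * L"
      using A[OF X] spectral_bounds_nonneg[OF f]
      by (simp add: mult_right_mono flip: sum_distrib_right)
    finally show "(\<Sum>m\<in>S. norm (?s X m)) \<le> A * L" .
  qed
qed simp

definition quadratic_coeff_decay :: "(int \<Rightarrow> complex) \<Rightarrow> real \<Rightarrow> real \<Rightarrow> bool" where
  "quadratic_coeff_decay c D w \<longleftrightarrow> 0 \<le> D \<and> 0 < w \<and> w \<le> 1 \<and> c 0 = 1 \<and>
     (\<forall>l. l \<noteq> 0 \<longrightarrow> norm (c l) \<le> D / (1 + (w * of_int l)\<^sup>2))"

lemma quadratic_coeff_decay_norm_le: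
  assumes "quadratic_coeff_decay c D w" "l \<noteq> 0"
  shows "norm (c l) \<le> D"
proof -
  have "norm (c l) \<le> D / (1 + (w * of_int l)\<^sup>2)"
    using assms by (simp add: quadratic_coeff_decay_def)
  also have "\<dots> \<le> D / 1"
    using assms by (intro divide_left_mono) (auto simp: quadratic_coeff_decay_def add_pos_nonneg)
  finally show ?thesis
    by simp
qed

lemma quadratic_coeff_decay_square_mult_norm_le:
  assumes "quadratic_coeff_decay c D w"
  shows "(of_int l)\<^sup>2 * norm (c l) \<le> D / w\<^sup>2"
proof (cases "l = 0")
  case False
  have "1 + (w * of_int l)\<^sup>2 > 0"
    by (simp add: add_pos_nonneg)
  moreover have "(of_int l)\<^sup>2 * norm (c l) \<le> (of_int l)\<^sup>2 * (D / (1 + (w * of_int l)\<^sup>2))"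
    using assms False by (intro mult_left_mono) (auto simp: quadratic_coeff_decay_def)
  moreover have "\<dots> \<le> D / w\<^sup>2"
    using assms \<open>1 + (w * of_int l)\<^sup>2 > 0\<close>
    by (auto simp: quadratic_coeff_decay_def divide_simps power_mult_distrib algebra_simps)
  ultimately show ?thesis
    by linarith
qed (use assms in \<open>auto simp: quadratic_coeff_decay_def\<close>)

lemma quadratic_coeff_decay_sum_norm_le:
  assumes c: "quadratic_coeff_decay c D w" and X: "finite X"
  shows "(\<Sum>l\<in>X. norm (c l)) \<le> 1 + 10 * D / w"
proof -
  let ?q = "\<lambda>l. 1 / (1 + (w * (0 - of_int l))\<^sup>2)"
  have "(\<Sum>l\<in>X. norm (c l)) \<le> (\<Sum>l\<in>X. (if l = 0 then 1 else 0) + D * ?q l)"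
    using c by (intro sum_mono) (auto simp: quadratic_coeff_decay_def power_mult_distrib)
  also have "\<dots> = (\<Sum>l\<in>X. if l = 0 then 1 else 0) + D * (\<Sum>l\<in>X. ?q l)"
    by (simp add: sum.distrib sum_distrib_left)
  also have "\<dots> \<le> 1 + D * (10 / w)"
    using c X
    by (intro add_mono mult_left_mono sum_inverse_quadratic_le)
       (auto simp: quadratic_coeff_decay_def)
  finally show ?thesis
    by (simp add: mult.commute)
qed

lemma spectral_bounds_mult_series:
  assumes f: "spectral_bounds f L C" and F: "abs_fourier_series F c"
    and c: "quadratic_coeff_decay c D w"
  defines "A \<equiv> 1 + 10 * D / w"
  shows "spectral_bounds (\<lambda>x. f x * F x) (A * L) (2 * (D / w\<^sup>2 * L + A * C))"
  unfolding spectral_bounds_def A_def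
  using integrable_mult_fourier_series[OF spectral_boundsD(1)[OF f] F]
    sum_norm_fourier_integral_mult_series_le[OF f F quadratic_coeff_decay_sum_norm_le[OF c]]
    square_mult_norm_fourier_integral_mult_series_le[OF f F
      quadratic_coeff_decay_sum_norm_le[OF c] quadratic_coeff_decay_square_mult_norm_le[OF c]]
  by blast

text \<open>Since \<open>c 0 = 1\<close>, passing from \<open>f\<close> to \<open>f F\<close> changes the transform by that of \<open>f (F - 1)\<close>,
  and the Fourier series of \<open>F - 1\<close> has no constant term.\<close>

lemma fourier_integral_mult_series_diff_bounds:
  assumes f: "spectral_bounds f L C" and F: "abs_fourier_series F c"
    and c: "quadratic_coeff_decay c D w"
  defines "A \<equiv> 1 + 10 * D / w"
    and "d \<equiv> \<lambda>\<xi>. norm (fourier_integral (\<lambda>x. f x * F x) \<xi> - fourier_integral f \<xi>)"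
  shows "d \<xi> \<le> D * L" and "\<xi>\<^sup>2 * d \<xi> \<le> 2 * (D / w\<^sup>2 * L + A * C)"
proof -
  define c' where "c' l = c l + (if l = 0 then -1 else 0)" for l
  have c': "c' l = (if l = 0 then 0 else c l)" for l
    using c by (simp add: c'_def quadratic_coeff_decay_def)
  have series: "abs_fourier_series (\<lambda>x. F x - 1) c'"
    using abs_fourier_series_add[OF F abs_fourier_series_const[of "-1"]]
    by (simp add: c'_def[abs_def])
  have d_eq: "d \<xi> = norm (fourier_integral (\<lambda>x. f x * (F x - 1)) \<xi>)"
    unfolding d_def
    using fourier_integral_diff[OF integrable_mult_fourier_series[OF spectral_boundsD(1)[OF f] F]
        spectral_boundsD(1)[OF f]]
    by (simp add: right_diff_distrib)
  have bounds: "norm (c' l) \<le> D" "(of_int l)\<^sup>2 * norm (c' l) \<le> D / w\<^sup>2" for l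
    using quadratic_coeff_decay_norm_le[OF c]
      quadratic_coeff_decay_square_mult_norm_le[OF c, of l] c
    by (auto simp: c' quadratic_coeff_decay_def)
  have sum_bound: "(\<Sum>l\<in>X. norm (c' l)) \<le> A" if "finite X" for X
  proof -
    have "(\<Sum>l\<in>X. norm (c' l)) \<le> (\<Sum>l\<in>X. norm (c l))"
      by (intro sum_mono) (simp add: c')
    then show ?thesis
      using quadratic_coeff_decay_sum_norm_le[OF c that] by (simp add: A_def)
  qed
  show "d \<xi> \<le> D * L"
    unfolding d_eq by (rule norm_fourier_integral_mult_series_le[OF f series bounds(1)])
  show "\<xi>\<^sup>2 * d \<xi> \<le> 2 * (D / w\<^sup>2 * L + A * C)"
    unfolding d_eq
    by (rule square_mult_norm_fourier_integral_mult_series_le[OF f series sum_bound bounds(2)])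
qed

lemma powr_decay_interpolation:
  fixes X Y R \<sigma> \<xi> d E :: real
  assumes R: "R \<ge> 1" and \<sigma>: "0 \<le> \<sigma>" "\<sigma> \<le> 1" and d: "d \<ge> 0"
    and X: "d \<le> X" "X * R powr \<sigma> \<le> E" and Y: "\<xi>\<^sup>2 * d \<le> Y" "Y * R powr (\<sigma> - 2) \<le> E"
  shows "d \<le> 2 * E * (1 + \<bar>\<xi>\<bar>) powr - \<sigma>"
proof -
  define m where "m = max \<bar>\<xi>\<bar> R"
  have m: "m \<ge> 1" "m \<ge> R" "1 + \<bar>\<xi>\<bar> \<le> 2 * m"
    using R by (auto simp: m_def)
  have "d * m powr \<sigma> \<le> E"
  proof (cases "\<bar>\<xi>\<bar> \<le> R")
    case True
    then have "d * m powr \<sigma> \<le> X * R powr \<sigma>"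
      using X by (auto simp: m_def intro: mult_right_mono)
    with X(2) show ?thesis
      by linarith
  next
    case False
    then have "m = \<bar>\<xi>\<bar>"
      by (simp add: m_def)
    have "d * m powr \<sigma> = (\<xi>\<^sup>2 * d) * m powr (\<sigma> - 2)"
      using m \<open>m = \<bar>\<xi>\<bar>\<close> by (simp add: powr_diff powr_numeral)
    also have "\<dots> \<le> Y * R powr (\<sigma> - 2)"
      using Y(1) R m \<sigma> d by (intro mult_mono powr_mono2' order_trans[OF _ Y(1)]) auto
    finally show ?thesis
      using Y(2) by linarith
  qed
  moreover have "(1 + \<bar>\<xi>\<bar>) powr \<sigma> \<le> 2 * m powr \<sigma>"
  proof -
    have "(1 + \<bar>\<xi>\<bar>) powr \<sigma> \<le> (2 * m) powr \<sigma>"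
      using m \<sigma> by (intro powr_mono2) auto
    also have "\<dots> \<le> 2 * m powr \<sigma>"
      using \<sigma> powr_mono[of \<sigma> 1 "2::real"] by (simp add: powr_mult mult_right_mono)
    finally show ?thesis .
  qed
  ultimately have "d * (1 + \<bar>\<xi>\<bar>) powr \<sigma> \<le> 2 * E"
    using mult_left_mono[of "(1 + \<bar>\<xi>\<bar>) powr \<sigma>" "2 * m powr \<sigma>" d] d by linarith
  moreover have "(1 + \<bar>\<xi>\<bar>) powr \<sigma> > 0"
    by simp
  ultimately show ?thesis
    by (simp add: powr_minus field_simps)
qed

locale scale_exponents =
  fixes \<kappa> \<sigma> b \<epsilon> :: real
  assumes eps_pos: "0 < \<epsilon>" and eps_less: "\<epsilon> < 1/2" and kappa_gt_1: "1 < \<kappa>" and sigma_nonneg: "0 \<le> \<sigma>"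
    and b_large: "1 < b * (1 - \<epsilon>)" and sigma_small: "(\<kappa> - 1 + 3 * \<epsilon>) / (b - 1) + \<kappa> * \<sigma> \<le> 1 - 4 * \<epsilon>"
begin

text \<open>At scale \<open>M\<close> the bounds in \<open>spectral_bounds\<close> are \<open>M powr \<Lambda>\<close> and \<open>M powr (\<zeta> / b)\<close>.
  A factor multiplies the first by about \<open>M powr (\<kappa> - 1)\<close>, and the next scale is \<open>M powr b\<close>; this
  determines \<open>\<Lambda>\<close>. The exponent \<open>\<zeta>\<close> is what the interpolation at frequency \<open>M powr \<kappa>\<close> tolerates.\<close>

definition \<Lambda> :: real where
  "\<Lambda> = (\<kappa> - 1 + 3 * \<epsilon>) / (b - 1)"

definition \<zeta> :: real where
  "\<zeta> = \<kappa> * (2 - \<sigma>) - \<epsilon>"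

lemma b_gt_1: "b > 1"
proof -
  have "\<not> b \<le> 0"
    using b_large eps_less mult_nonpos_nonneg[of b "1 - \<epsilon>"] by auto
  then have "b * (1 - \<epsilon>) < b * 1"
    using eps_pos by (intro mult_strict_left_mono) auto
  then show ?thesis
    using b_large by simp
qed

lemma Lambda_pos: "\<Lambda> > 0"
  using kappa_gt_1 eps_pos b_gt_1 by (simp add: \<Lambda>_def)

lemma Lambda_step: "\<kappa> - 1 + 3 * \<epsilon> + \<Lambda> = b * \<Lambda>"
proof -
  have "\<Lambda> * (b - 1) = \<kappa> - 1 + 3 * \<epsilon>"
    using b_gt_1 by (simp add: \<Lambda>_def)
  then show ?thesis
    by (simp add: algebra_simps)
qed

lemma Lambda_bound: "\<Lambda> + \<kappa> * \<sigma> \<le> 1 - 4 * \<epsilon>"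
  using sigma_small by (simp add: \<Lambda>_def)

lemma sigma_le_1: "\<sigma> \<le> 1"
proof -
  have "\<sigma> \<le> \<kappa> * \<sigma>"
    using kappa_gt_1 sigma_nonneg mult_right_mono[of 1 \<kappa> \<sigma>] by simp
  then show ?thesis
    using Lambda_bound Lambda_pos eps_pos by linarith
qed

lemma zeta_step: "\<kappa> - 1 + 4 * \<epsilon> + \<zeta> / b \<le> \<zeta>"
proof -
  have "\<kappa> + b * \<Lambda> \<le> \<zeta>"
    using Lambda_step Lambda_bound by (simp add: \<zeta>_def algebra_simps)
  moreover have "b * \<epsilon> < (b - 1) * \<kappa>"
    using b_large mult_strict_left_mono[OF kappa_gt_1, of "b - 1"] b_gt_1
    by (simp add: algebra_simps)
  ultimately have "b * \<epsilon> + (b - 1) * (b * \<Lambda>) \<le> (b - 1) * \<zeta>"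
    using mult_left_mono[of "\<kappa> + b * \<Lambda>" \<zeta> "b - 1"] b_gt_1 by (simp add: distrib_left)
  moreover have "(b - 1) * (b * \<Lambda>) = b * (\<kappa> - 1 + 3 * \<epsilon>)"
    using b_gt_1 by (simp add: \<Lambda>_def)
  ultimately have "b * (\<kappa> - 1 + 4 * \<epsilon>) + \<zeta> \<le> b * \<zeta>"
    by (simp add: algebra_simps)
  then have "(b * (\<kappa> - 1 + 4 * \<epsilon>) + \<zeta>) / b \<le> \<zeta>"
    using b_gt_1 by (simp add: pos_divide_le_eq mult.commute)
  then show ?thesis
    using b_gt_1 by (simp add: add_divide_distrib)
qed

lemma zeta_pos: "\<zeta> > 0"
proof -
  have "1 * 1 \<le> \<kappa> * (2 - \<sigma>)"
    using kappa_gt_1 sigma_le_1 by (intro mult_mono) auto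
  then show ?thesis
    using eps_less by (simp add: \<zeta>_def)
qed

context
  fixes M :: real
  assumes M: "M > 1" "11 \<le> M powr \<epsilon>"
begin

lemma sum_coeff_bound: "1 + 10 * M powr (2 * \<epsilon> - 1) / M powr - \<kappa> \<le> M powr (\<kappa> - 1 + 3 * \<epsilon>)"
proof -
  have "M powr (2 * \<epsilon> - 1) / M powr - \<kappa> = M powr (\<kappa> - 1 + 2 * \<epsilon>)"
    by (simp add: powr_diff[symmetric] algebra_simps)
  moreover have "1 \<le> M powr (\<kappa> - 1 + 2 * \<epsilon>)"
    using M eps_pos kappa_gt_1 by (intro ge_one_powr_ge_zero) auto
  ultimately have "1 + 10 * M powr (2 * \<epsilon> - 1) / M powr - \<kappa> \<le> 11 * M powr (\<kappa> - 1 + 2 * \<epsilon>)"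
    by simp
  also have "\<dots> \<le> M powr \<epsilon> * M powr (\<kappa> - 1 + 2 * \<epsilon>)"
    using M by (intro mult_right_mono) auto
  also have "\<dots> = M powr (\<kappa> - 1 + 3 * \<epsilon>)"
    by (simp add: powr_add[symmetric] algebra_simps)
  finally show ?thesis .
qed

lemma quadratic_bound:
  assumes "A \<le> M powr (\<kappa> - 1 + 3 * \<epsilon>)"
  shows "2 * (M powr (2 * \<epsilon> - 1) / (M powr - \<kappa>)\<^sup>2 * M powr \<Lambda> + A * M powr (\<zeta> / b)) \<le> M powr \<zeta>"
proof -
  have "M powr (2 * \<epsilon> - 1) / (M powr - \<kappa>)\<^sup>2 * M powr \<Lambda> = M powr (2 * \<epsilon> - 1 + 2 * \<kappa> + \<Lambda>)"
    using M by (simp add: powr_add powr_minus powr_power divide_simps mult_ac)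
  also have "\<dots> \<le> M powr (\<zeta> - \<epsilon>)"
    using M Lambda_bound by (intro powr_mono) (auto simp: \<zeta>_def algebra_simps)
  finally have first: "M powr (2 * \<epsilon> - 1) / (M powr - \<kappa>)\<^sup>2 * M powr \<Lambda> \<le> M powr (\<zeta> - \<epsilon>)" .
  have "A * M powr (\<zeta> / b) \<le> M powr (\<kappa> - 1 + 3 * \<epsilon>) * M powr (\<zeta> / b)"
    using assms by (intro mult_right_mono) auto
  also have "\<dots> \<le> M powr (\<zeta> - \<epsilon>)"
    unfolding powr_add[symmetric] using M zeta_step by (intro powr_mono) auto
  finally have "2 * (M powr (2 * \<epsilon> - 1) / (M powr - \<kappa>)\<^sup>2 * M powr \<Lambda> + A * M powr (\<zeta> / b))
      \<le> 4 * M powr (\<zeta> - \<epsilon>)"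
    using first by simp
  also have "\<dots> \<le> M powr \<epsilon> * M powr (\<zeta> - \<epsilon>)"
    using M by (intro mult_right_mono) auto
  finally show ?thesis
    by (simp add: powr_add[symmetric])
qed

context
  fixes f F :: "real \<Rightarrow> complex" and c :: "int \<Rightarrow> complex"
  assumes f: "spectral_bounds f (M powr \<Lambda>) (M powr (\<zeta> / b))"
    and F: "abs_fourier_series F c"
    and c: "quadratic_coeff_decay c (M powr (2 * \<epsilon> - 1)) (M powr - \<kappa>)"
begin

lemma spectral_bounds_next_scale:
  "spectral_bounds (\<lambda>x. f x * F x) ((M powr b) powr \<Lambda>) ((M powr b) powr (\<zeta> / b))"
proof (rule spectral_bounds_mono[OF spectral_bounds_mult_series[OF f F c]])
  have "(1 + 10 * M powr (2 * \<epsilon> - 1) / M powr - \<kappa>) * M powr \<Lambda> \<le> M powr (\<kappa> - 1 + 3 * \<epsilon>) * M powr \<Lambda>"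
    by (intro mult_right_mono sum_coeff_bound) auto
  also have "\<dots> = (M powr b) powr \<Lambda>"
    by (simp add: powr_powr Lambda_step flip: powr_add)
  finally show "(1 + 10 * M powr (2 * \<epsilon> - 1) / M powr - \<kappa>) * M powr \<Lambda> \<le> (M powr b) powr \<Lambda>" .
  show "2 * (M powr (2 * \<epsilon> - 1) / (M powr - \<kappa>)\<^sup>2 * M powr \<Lambda>
      + (1 + 10 * M powr (2 * \<epsilon> - 1) / M powr - \<kappa>) * M powr (\<zeta> / b)) \<le> (M powr b) powr (\<zeta> / b)"
    using quadratic_bound[OF sum_coeff_bound] b_gt_1 by (simp add: powr_powr)
qed

lemma fourier_integral_next_scale_diff_le:
  "norm (fourier_integral (\<lambda>x. f x * F x) \<xi> - fourier_integral f \<xi>)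
      \<le> 2 * M powr - \<epsilon> * (1 + \<bar>\<xi>\<bar>) powr - \<sigma>"
proof (rule powr_decay_interpolation[where R = "M powr \<kappa>"])
  note diff = fourier_integral_mult_series_diff_bounds[OF f F c, of \<xi>]
  show "norm (fourier_integral (\<lambda>x. f x * F x) \<xi> - fourier_integral f \<xi>)
      \<le> M powr (2 * \<epsilon> - 1) * M powr \<Lambda>"
    by (rule diff(1))
  show "\<xi>\<^sup>2 * norm (fourier_integral (\<lambda>x. f x * F x) \<xi> - fourier_integral f \<xi>) \<le> M powr \<zeta>"
    by (rule order_trans[OF diff(2) quadratic_bound[OF sum_coeff_bound]])
  show "M powr (2 * \<epsilon> - 1) * M powr \<Lambda> * (M powr \<kappa>) powr \<sigma> \<le> M powr - \<epsilon>"
    unfolding powr_powr powr_add[symmetric] using Lambda_bound M eps_pos by (intro powr_mono) auto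
  show "M powr \<zeta> * (M powr \<kappa>) powr (\<sigma> - 2) \<le> M powr - \<epsilon>"
    unfolding powr_powr powr_add[symmetric] by (simp add: \<zeta>_def algebra_simps)
  show "1 \<le> M powr \<kappa>"
    using M kappa_gt_1 by (intro ge_one_powr_ge_zero) auto
qed (use sigma_nonneg sigma_le_1 in auto)

end

end

end

section \<open>Weak limits of densities\<close>

lemma fourier_transform_eq_char: "fourier_transform M \<xi> = char M (- (2 * pi * \<xi>))"
  unfolding fourier_transform_def char_def
  by (intro Bochner_Integration.integral_cong refl) (simp add: algebra_simps)

lemma fourier_transform_density:
  fixes p :: "real \<Rightarrow> real"
  assumes [measurable]: "p \<in> borel_measurable borel" and nonneg: "\<And>x. p x \<ge> 0"
  shows "fourier_transform (density lborel p) \<xi> = fourier_integral (\<lambda>x. p x) \<xi>"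
proof -
  have "fourier_transform (density lborel p) \<xi>
      = (\<integral>x. p x *\<^sub>R exp (- 2 * pi * \<i> * complex_of_real (x * \<xi>)) \<partial>lborel)"
    unfolding fourier_transform_def by (rule integral_density) (use nonneg in auto)
  then show ?thesis
    by (simp add: fourier_integral_def cis2pi_def cis_conv_exp scaleR_conv_of_real mult_ac)
qed

lemma real_distribution_density:
  fixes p :: "real \<Rightarrow> real"
  assumes int: "integrable lborel p" and nonneg: "\<And>x. p x \<ge> 0" and total: "(\<integral>x. p x \<partial>lborel) = 1"
  shows "real_distribution (density lborel p)"
proof -
  have [measurable]: "p \<in> borel_measurable borel"
    using int by auto
  have "(\<integral>\<^sup>+x. ennreal (p x) \<partial>lborel) = 1"
    using nn_integral_eq_integral[OF int] nonneg total by simp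
  then have "prob_space (density lborel p)"
    by (intro prob_spaceI) (simp add: emeasure_density)
  then show ?thesis
    by (simp add: real_distribution_def real_distribution_axioms_def)
qed

lemma integral_min_infdist_eq_0_iff:
  assumes M: "real_distribution M" and K: "closed K" "K \<noteq> {}"
  shows "(\<integral>x. min 1 (infdist x K) \<partial>M) = 0 \<longleftrightarrow> (AE x in M. x \<in> K)"
proof -
  interpret real_distribution M
    by (rule M)
  have [measurable]: "(\<lambda>x. min 1 (infdist x K)) \<in> borel_measurable borel"
    by (intro borel_measurable_continuous_onI continuous_intros)
  have "integrable M (\<lambda>x. min 1 (infdist x K))"
    by (rule integrable_const_bound[of _ 1]) (auto simp: infdist_nonneg)
  then have "(\<integral>x. min 1 (infdist x K) \<partial>M) = 0 \<longleftrightarrow> (AE x in M. min 1 (infdist x K) = 0)"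
    by (rule integral_nonneg_eq_0_iff_AE) (simp add: infdist_nonneg)
  also have "(\<lambda>x. min 1 (infdist x K) = 0) = (\<lambda>x. x \<in> K)"
    using in_closed_iff_infdist_zero[OF K] by (auto simp: min_def)
  finally show ?thesis .
qed

lemma weak_conv_m_AE_closed:
  assumes \<mu>: "\<And>n. real_distribution (\<mu> n)" and M: "real_distribution M" and conv: "weak_conv_m \<mu> M"
    and K: "closed K" and support: "\<forall>\<^sub>F n in sequentially. AE x in \<mu> n. x \<in> K"
  shows "AE x in M. x \<in> K"
proof -
  have "K \<noteq> {}"
  proof
    assume "K = {}"
    with support obtain n where "AE x in \<mu> n. False"
      by (auto simp: eventually_sequentially)
    then show False
      using real_distribution.axioms(1)[OF \<mu>[of n]] prob_space.AE_False by blast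
  qed
  let ?I = "\<lambda>N. \<integral>x. min 1 (infdist x K) \<partial>N"
  have "(\<lambda>n. ?I (\<mu> n)) \<longlonglongrightarrow> ?I M"
    by (rule weak_conv_imp_integral_bdd_continuous_conv[OF \<mu> M conv, of _ 1])
       (auto simp: infdist_nonneg intro!: continuous_intros)
  moreover have "(\<lambda>n. ?I (\<mu> n)) \<longlonglongrightarrow> 0"
    using support by (intro tendsto_eventually)
      (simp add: integral_min_infdist_eq_0_iff[OF \<mu> K \<open>K \<noteq> {}\<close>])
  ultimately have "?I M = 0"
    by (rule LIMSEQ_unique)
  then show ?thesis
    by (simp add: integral_min_infdist_eq_0_iff[OF M K \<open>K \<noteq> {}\<close>])
qed

lemma tight_bounded_support:
  fixes \<mu> :: "nat \<Rightarrow> real measure"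
  assumes \<mu>: "\<And>n. real_distribution (\<mu> n)" and K: "bounded K" and support: "\<And>n. AE x in \<mu> n. x \<in> K"
  shows "tight \<mu>"
  unfolding tight_def
proof (intro conjI allI impI \<mu>)
  fix e :: real assume "e > 0"
  obtain a where a: "\<And>x. x \<in> K \<Longrightarrow> \<bar>x\<bar> \<le> a" "a > 0"
    using K by (auto simp: bounded_pos)
  have "measure (\<mu> n) {- a - 1<..a} = 1" for n
  proof -
    interpret real_distribution "\<mu> n"
      by (rule \<mu>)
    have "AE x in \<mu> n. x \<in> {- a - 1<..a}"
      using support[of n] by eventually_elim (use a(1) in force)
    then show ?thesis
      by (subst prob_eq_1) auto
  qed
  then show "\<exists>a b. a < b \<and> (\<forall>n. 1 - e < measure (\<mu> n) {a<..b})"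
    using a(2) \<open>e > 0\<close> by (intro exI[of _ "- a - 1"] exI[of _ a]) auto
qed

lemma real_distributions_weak_limit:
  fixes \<mu> :: "nat \<Rightarrow> real measure"
  assumes \<mu>: "\<And>n. real_distribution (\<mu> n)"
    and closed: "\<And>n. closed (K n)" and bounded: "bounded (K 0)"
    and support: "\<And>m n. n \<le> m \<Longrightarrow> AE x in \<mu> m. x \<in> K n"
    and decay: "\<And>n \<xi>. norm (fourier_transform (\<mu> n) \<xi>) \<le> B \<xi>"
  obtains M where "real_distribution M" "\<And>n. AE x in M. x \<in> K n"
    "\<And>\<xi>. norm (fourier_transform M \<xi>) \<le> B \<xi>"
proof -
  have "tight \<mu>"
    using tight_bounded_support[OF \<mu> bounded support] by simp
  from tight_imp_convergent_subsubsequence[OF this strict_mono_id] obtain r M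
    where r: "strict_mono r" and M: "real_distribution M" and "weak_conv_m (\<mu> \<circ> id \<circ> r) M"
    by blast
  then have conv: "weak_conv_m (\<lambda>k. \<mu> (r k)) M"
    by (simp add: o_def)
  show ?thesis
  proof (rule that[OF M])
    show "AE x in M. x \<in> K n" for n
    proof (rule weak_conv_m_AE_closed[OF \<mu> M conv closed])
      show "\<forall>\<^sub>F k in sequentially. AE x in \<mu> (r k). x \<in> K n"
        using eventually_ge_at_top[of n]
        by eventually_elim (rule support[OF order_trans[OF _ strict_mono_imp_increasing[OF r]]])
    qed
    show "norm (fourier_transform M \<xi>) \<le> B \<xi>" for \<xi>
    proof (rule tendsto_upperbound)
      show "(\<lambda>k. norm (fourier_transform (\<mu> (r k)) \<xi>)) \<longlonglongrightarrow> norm (fourier_transform M \<xi>)"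
        unfolding fourier_transform_eq_char by (intro tendsto_norm levy_continuity1 \<mu> M conv)
    qed (use decay in auto)
  qed
qed

lemma fourier_admissible_weak_limitI:
  fixes \<mu> :: "nat \<Rightarrow> real measure"
  assumes s: "s \<in> {0..1}" and \<mu>: "\<And>n. real_distribution (\<mu> n)"
    and closed: "\<And>n. closed (K n)" and bounded: "bounded (K 0)" and subset: "(\<Inter>n. K n) \<subseteq> E"
    and support: "\<And>m n. n \<le> m \<Longrightarrow> AE x in \<mu> m. x \<in> K n"
    and decay: "\<And>n \<xi>. norm (fourier_transform (\<mu> n) \<xi>) \<le> B * (1 + \<bar>\<xi>\<bar>) powr (- s / 2)"
  shows "fourier_admissible E s"
proof -
  obtain M where M: "real_distribution M" and M_K: "\<And>n. AE x in M. x \<in> K n"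
    and M_decay: "\<And>\<xi>. norm (fourier_transform M \<xi>) \<le> B * (1 + \<bar>\<xi>\<bar>) powr (- s / 2)"
    using real_distributions_weak_limit[where \<mu> = \<mu> and K = K
        and B = "\<lambda>\<xi>. B * (1 + \<bar>\<xi>\<bar>) powr (- s / 2)", OF \<mu> closed bounded support decay] by blast
  interpret M: real_distribution M
    by (rule M)
  have "AE x in M. x \<in> (\<Inter>n. K n)"
    using M_K by (simp add: AE_all_countable)
  moreover have "closed (\<Inter>n. K n)"
    using closed by auto
  ultimately have "UNIV - (\<Inter>n. K n) \<in> null_sets M"
    by (subst AE_iff_null_sets) (auto simp: borel_closed)
  then have "emeasure M (UNIV - (\<Inter>n. K n)) = 0"
    by auto
  moreover have "compact (\<Inter>n. K n)"
    using \<open>closed (\<Inter>n. K n)\<close> bounded bounded_subset[of "K 0" "\<Inter>n. K n"]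
    by (auto simp: compact_eq_bounded_closed)
  ultimately show ?thesis
    unfolding fourier_admissible_def
    using s subset M_decay M.emeasure_space_1 M.finite_measure_axioms M.events_eq_borel
    by (intro conjI exI[of _ M] exI[of _ "\<Inter>n. K n"] exI[of _ B]) auto
qed

lemma fourier_admissible_densitiesI:
  fixes f :: "nat \<Rightarrow> real \<Rightarrow> real"
  assumes s: "s \<in> {0..1}" and nonneg: "\<And>n x. f n x \<ge> 0" and int: "\<And>n. integrable lborel (f n)"
    and mass: "\<And>n. (\<integral>x. f n x \<partial>lborel) \<ge> m" and m: "m > 0"
    and closed: "\<And>n. closed (K n)" and bounded: "bounded (K 0)"
    and support: "\<And>m n x. n \<le> m \<Longrightarrow> x \<notin> K n \<Longrightarrow> f m x = 0" and subset: "(\<Inter>n. K n) \<subseteq> E"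
    and decay: "\<And>n \<xi>. norm (fourier_integral (\<lambda>x. f n x) \<xi>) \<le> B * (1 + \<bar>\<xi>\<bar>) powr (- s / 2)"
  shows "fourier_admissible E s"
proof -
  define I where "I n = (\<integral>x. f n x \<partial>lborel)" for n
  define p where "p n x = f n x / I n" for n x
  have I: "I n \<ge> m" "I n > 0" for n
    using mass[of n] m by (auto simp: I_def)
  have p_meas [measurable]: "p n \<in> borel_measurable borel" for n
    using int[of n] by (auto simp: p_def[abs_def])
  have p_nonneg: "p n x \<ge> 0" for n x
    using nonneg I(2)[of n] by (simp add: p_def)
  have distribution: "real_distribution (density lborel (p n))" for n
    using int[of n] p_nonneg I(2)[of n]
    by (intro real_distribution_density) (auto simp: p_def[abs_def] I_def)
  have p_decay: "norm (fourier_transform (density lborel (p n)) \<xi>)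
      \<le> B / m * (1 + \<bar>\<xi>\<bar>) powr (- s / 2)" for n \<xi>
  proof -
    have "(\<lambda>x. complex_of_real (p n x)) = (\<lambda>x. (1 / I n) * complex_of_real (f n x))"
      by (simp add: p_def)
    then have "norm (fourier_transform (density lborel (p n)) \<xi>)
        = norm (fourier_integral (\<lambda>x. f n x) \<xi>) / I n"
      using I(2)[of n] unfolding fourier_transform_density[OF p_meas p_nonneg]
      by (simp only: fourier_integral_cmult) (simp add: norm_divide)
    also have "\<dots> \<le> B * (1 + \<bar>\<xi>\<bar>) powr (- s / 2) / m"
      using I[of n] m decay[of n \<xi>] by (intro frac_le order_trans[OF norm_ge_zero]) auto
    finally show ?thesis
      by simp
  qed
  have p_support: "AE x in density lborel (p m). x \<in> K n" if "n \<le> m" for m n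
  proof (subst AE_density)
    show "AE x in lborel. 0 < ennreal (p m x) \<longrightarrow> x \<in> K n"
      using support[OF that] by (intro AE_I2) (force simp: p_def)
  qed measurable
  show ?thesis
    by (rule fourier_admissible_weak_limitI
        [OF s distribution closed bounded subset p_support p_decay])
qed

section \<open>Exactness\<close>

lemma lambda_exp_eventually_bounds:
  assumes lam: "lambda_exp \<psi> \<tau>" and pos: "\<And>q. \<psi> q > 0"
  shows "t < \<tau> \<Longrightarrow> \<forall>\<^sub>F q in sequentially. \<psi> q < real q powr - t"
    and "\<tau> < t \<Longrightarrow> \<forall>\<^sub>F q in sequentially. real q powr - t < \<psi> q"
proof -
  have lim: "((\<lambda>q. - log (real q) (\<psi> q)) \<longlongrightarrow> \<tau>) sequentially"
    using lam by (simp add: lambda_exp_def log_def)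
  show "\<forall>\<^sub>F q in sequentially. \<psi> q < real q powr - t" if "t < \<tau>"
    using order_tendstoD(1)[OF lim that] eventually_gt_at_top[of 1]
    by eventually_elim (use pos in \<open>simp add: log_less_iff[symmetric]\<close>)
  show "\<forall>\<^sub>F q in sequentially. real q powr - t < \<psi> q" if "\<tau> < t"
    using order_tendstoD(2)[OF lim that] eventually_gt_at_top[of 1]
    by eventually_elim (use pos in \<open>simp add: less_log_iff[symmetric]\<close>)
qed

definition good_approximations :: "real \<Rightarrow> real \<Rightarrow> (int \<times> int) set" where
  "good_approximations \<theta> g = {(p, q). q > 0 \<and> \<bar>\<theta> - of_int p / of_int q\<bar> \<le> of_int q powr - g}"

lemma dioph_exponent_eq_Inf:
  "dioph_exponent \<theta> = Inf {ereal g | g. finite (good_approximations \<theta> g)}"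
  by (simp add: dioph_exponent_def good_approximations_def)

lemma infinite_good_approximations:
  assumes "g < 1"
  shows "infinite (good_approximations \<theta> g)"
proof -
  define a where "a n = (round (\<theta> * real (Suc n)), int (Suc n))" for n
  have "a n \<in> good_approximations \<theta> g" for n
  proof -
    define N where "N = real (Suc n)"
    have N: "N \<ge> 1"
      by (simp add: N_def)
    have "\<theta> - of_int (round (\<theta> * N)) / N = (\<theta> * N - of_int (round (\<theta> * N))) / N"
      using N by (simp add: field_simps)
    then have "\<bar>\<theta> - of_int (round (\<theta> * N)) / N\<bar> = \<bar>of_int (round (\<theta> * N)) - \<theta> * N\<bar> / N"
      using N by (simp add: abs_minus_commute)
    also have "\<dots> \<le> 1 / N"
      using of_int_round_abs_le[of "\<theta> * N"] N by (intro divide_right_mono) auto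
    also have "\<dots> = N powr - 1"
      using N by (simp add: powr_minus divide_inverse)
    also have "\<dots> \<le> N powr - g"
      using assms N by (intro powr_mono) auto
    finally show ?thesis
      by (simp add: a_def good_approximations_def N_def)
  qed
  then have "range a \<subseteq> good_approximations \<theta> g"
    by blast
  moreover have "infinite (range a)"
    by (intro range_inj_infinite) (auto simp: inj_def a_def)
  ultimately show ?thesis
    using finite_subset by blast
qed

lemma dioph_exponent_ge_1: "dioph_exponent \<theta> \<ge> 1"
  unfolding dioph_exponent_eq_Inf
  using infinite_good_approximations by (intro Inf_greatest) (force simp: one_ereal_def)

lemma irrational_mult_neq_of_int:
  fixes \<theta> :: real
  assumes "\<theta> \<notin> \<rat>" "n \<noteq> 0"
  shows "\<theta> * of_int n \<noteq> of_int p"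
proof
  assume "\<theta> * of_int n = of_int p"
  then have "\<theta> = of_int p / of_int n"
    using assms(2) by (simp add: field_simps)
  then show False
    using assms(1) by simp
qed

lemma finite_good_approximations_imp_lower_bound:
  assumes irrational: "\<theta> \<notin> \<rat>" and fin: "finite (good_approximations \<theta> g)"
  obtains c where "c > 0" "c \<le> 1"
    "\<And>n p :: int. n > 0 \<Longrightarrow> c * of_int n powr (1 - g) \<le> \<bar>\<theta> * of_int n - of_int p\<bar>"
proof -
  define c where
    "c = Min (insert 1 ((\<lambda>(p, q). \<bar>\<theta> * of_int q - of_int p\<bar>) ` good_approximations \<theta> g))"
  have "g \<ge> 1"
    using infinite_good_approximations[of g \<theta>] fin by linarith
  have c: "c > 0" "c \<le> 1"
    unfolding c_def using fin irrational_mult_neq_of_int[OF irrational]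
    by (auto simp: good_approximations_def)
  have "c * of_int n powr (1 - g) \<le> \<bar>\<theta> * of_int n - of_int p\<bar>" if n: "n > 0" for n p :: int
  proof (cases "(p, n) \<in> good_approximations \<theta> g")
    case True
    have "of_int n powr (1 - g) \<le> (1::real)"
      using n \<open>g \<ge> 1\<close> powr_mono[of "1 - g" 0 "real_of_int n"] by simp
    then have "c * of_int n powr (1 - g) \<le> c"
      using c by (simp add: mult_left_le)
    also have "c \<le> \<bar>\<theta> * of_int n - of_int p\<bar>"
      unfolding c_def using fin True by (intro Min_le) force+
    finally show ?thesis .
  next
    case False
    have "c * of_int n powr (1 - g) \<le> 1 * of_int n powr (1 - g)"
      using c by (intro mult_right_mono) auto
    also have "\<dots> = of_int n powr - g * of_int n"
      using n powr_add[of "of_int n" "- g" 1] by (simp add: add.commute)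
    also have "\<dots> \<le> \<bar>\<theta> - of_int p / of_int n\<bar> * of_int n"
      using False n by (intro mult_right_mono) (auto simp: good_approximations_def)
    also have "\<dots> = \<bar>\<theta> * of_int n - of_int p\<bar>"
      using n by (subst abs_mult_pos) (auto simp: left_diff_distrib)
    finally show ?thesis .
  qed
  then show ?thesis
    using c that by blast
qed

lemma dioph_exponent_lower_bound:
  assumes "\<theta> \<notin> \<rat>" "dioph_exponent \<theta> = ereal \<gamma>" "\<gamma> < g"
  obtains c where "c > 0" "c \<le> 1"
    "\<And>n p :: int. n > 0 \<Longrightarrow> c * of_int n powr (1 - g) \<le> \<bar>\<theta> * of_int n - of_int p\<bar>"
proof -
  have "dioph_exponent \<theta> < ereal g"
    using assms by simp
  then obtain g' where g': "g' < g" "finite (good_approximations \<theta> g')"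
    unfolding dioph_exponent_eq_Inf Inf_less_iff by auto
  obtain c where c: "c > 0" "c \<le> 1"
    "\<And>n p :: int. n > 0 \<Longrightarrow> c * of_int n powr (1 - g') \<le> \<bar>\<theta> * of_int n - of_int p\<bar>"
    using finite_good_approximations_imp_lower_bound[OF assms(1) g'(2)] by metis
  have "c * of_int n powr (1 - g) \<le> \<bar>\<theta> * of_int n - of_int p\<bar>" if "n > 0" for n p :: int
  proof -
    have "c * of_int n powr (1 - g) \<le> c * of_int n powr (1 - g')"
      using c(1) g'(1) that by (intro mult_left_mono powr_mono) auto
    also have "\<dots> \<le> \<bar>\<theta> * of_int n - of_int p\<bar>"
      by (rule c(3)[OF that])
    finally show ?thesis .
  qed
  then show ?thesis
    using c that by blast
qed

definition shifted_fraction :: "real \<Rightarrow> int \<Rightarrow> nat \<Rightarrow> real" where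
  "shifted_fraction \<theta> r q = (of_int r - \<theta>) / real q"

definition shifted_fractions_separated :: "real \<Rightarrow> real \<Rightarrow> real \<Rightarrow> bool" where
  "shifted_fractions_separated \<theta> g c \<longleftrightarrow>
    (\<forall>r q r' q'. 0 < q \<longrightarrow> q \<le> q' \<longrightarrow> coprime r (int q) \<longrightarrow> coprime r' (int q') \<longrightarrow> (r, q) \<noteq> (r', q') \<longrightarrow>
      c * real q' powr (1 - g)
        \<le> \<bar>shifted_fraction \<theta> r q - shifted_fraction \<theta> r' q'\<bar> * (real q * real q'))"

lemma abs_shifted_fraction_diff:
  assumes "0 < q" "0 < q'"
  shows "\<bar>shifted_fraction \<theta> r q - shifted_fraction \<theta> r' q'\<bar> * (real q * real q')
    = \<bar>\<theta> * of_int (int q' - int q) - of_int (r * int q' - r' * int q)\<bar>"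
proof -
  have "(shifted_fraction \<theta> r q - shifted_fraction \<theta> r' q') * (real q * real q')
      = of_int (r * int q' - r' * int q) - \<theta> * of_int (int q' - int q)"
    using assms by (simp add: shifted_fraction_def field_simps)
  then show ?thesis
    by (metis abs_minus_commute abs_mult abs_of_nat of_nat_mult)
qed

lemma coprime_cross_mult_neq:
  fixes r r' :: int and q q' :: nat
  assumes "coprime r (int q)" "coprime r' (int q')" "0 < q" "(r, q) \<noteq> (r', q')"
  shows "r * int q' \<noteq> r' * int q"
proof
  assume eq: "r * int q' = r' * int q"
  then have "\<bar>r\<bar> * \<bar>int q'\<bar> = \<bar>r'\<bar> * \<bar>int q\<bar>"
    by (metis abs_mult)
  then have "q = q'"
    using coprime_crossproduct_int[OF assms(1,2)] by simp
  then show False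
    using eq assms(3,4) by simp
qed

lemma shifted_fractions_separatedI:
  assumes c: "0 < c" "c \<le> 1" and g: "g \<ge> 1"
    and lower: "\<And>n p :: int. \<theta> \<noteq> 0 \<Longrightarrow> n > 0 \<Longrightarrow> c * of_int n powr (1 - g) \<le> \<bar>\<theta> * of_int n - of_int p\<bar>"
  shows "shifted_fractions_separated \<theta> g c"
  unfolding shifted_fractions_separated_def
proof (intro allI impI)
  fix r q r' q'
  assume q: "0 < q" "q \<le> q'" and coprime: "coprime r (int q)" "coprime r' (int q')"
    and neq: "(r, q) \<noteq> (r', q')"
  let ?n = "int q' - int q" and ?z = "r * int q' - r' * int q"
  have diff: "\<bar>shifted_fraction \<theta> r q - shifted_fraction \<theta> r' q'\<bar> * (real q * real q')
      = \<bar>\<theta> * of_int ?n - of_int ?z\<bar>"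
    using q by (intro abs_shifted_fraction_diff) auto
  show "c * real q' powr (1 - g)
      \<le> \<bar>shifted_fraction \<theta> r q - shifted_fraction \<theta> r' q'\<bar> * (real q * real q')"
  proof (cases "\<theta> * of_int ?n = 0")
    case True
    have "real q' powr (1 - g) \<le> 1"
      using q g powr_mono[of "1 - g" 0 "real q'"] by simp
    then have "c * real q' powr (1 - g) \<le> 1"
      using c by (simp add: mult_le_one)
    also have "1 \<le> \<bar>?z\<bar>"
      using coprime_cross_mult_neq[OF coprime q(1) neq] by simp
    then have "1 \<le> \<bar>real_of_int ?z\<bar>"
      by linarith
    finally show ?thesis
      unfolding diff True by simp
  next
    case False
    then have "?n > 0" "\<theta> \<noteq> 0"
      using q by auto
    have "c * real q' powr (1 - g) \<le> c * of_int ?n powr (1 - g)"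
      using \<open>?n > 0\<close> g c by (intro mult_left_mono powr_mono2') auto
    also have "\<dots> \<le> \<bar>\<theta> * of_int ?n - of_int ?z\<bar>"
      by (rule lower[OF \<open>\<theta> \<noteq> 0\<close> \<open>?n > 0\<close>])
    finally show ?thesis
      unfolding diff .
  qed
qed

lemma shifted_fractions_separated_exists:
  assumes theta_cases: "(\<theta> = 0 \<and> \<gamma> = 1) \<or> (\<theta> \<notin> \<rat> \<and> dioph_exponent \<theta> = ereal \<gamma>)" and g: "\<gamma> < g"
  obtains c where "c > 0" "shifted_fractions_separated \<theta> g c"
proof -
  have "g \<ge> 1"
    using theta_cases g dioph_exponent_ge_1[of \<theta>] by (auto simp: one_ereal_def)
  show ?thesis
  proof (cases "\<theta> = 0")
    case True
    then have "shifted_fractions_separated \<theta> g 1"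
      using \<open>g \<ge> 1\<close> by (intro shifted_fractions_separatedI) auto
    then show ?thesis
      using that[of 1] by simp
  next
    case False
    then obtain c where "c > 0" "c \<le> 1"
      "\<And>n p :: int. n > 0 \<Longrightarrow> c * of_int n powr (1 - g) \<le> \<bar>\<theta> * of_int n - of_int p\<bar>"
      using theta_cases g by (metis dioph_exponent_lower_bound)
    then have "shifted_fractions_separated \<theta> g c"
      using \<open>g \<ge> 1\<close> by (intro shifted_fractions_separatedI) auto
    then show ?thesis
      using that \<open>c > 0\<close> by blast
  qed
qed

definition approximates :: "(nat \<Rightarrow> real) \<Rightarrow> real \<Rightarrow> real \<Rightarrow> int \<Rightarrow> nat \<Rightarrow> bool" where
  "approximates \<psi> \<theta> x r q \<longleftrightarrow> q > 0 \<and> coprime r (int q) \<and> \<bar>x - shifted_fraction \<theta> r q\<bar> \<le> \<psi> q"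

lemma mem_Exact_iff:
  "x \<in> Exact \<psi> \<theta> \<longleftrightarrow> infinite {(r, q). approximates \<psi> \<theta> x r q} \<and>
    (\<forall>d>0. finite {(r, q). approximates (\<lambda>q. \<psi> q - d * \<psi> q) \<theta> x r q})"
  by (simp add: Exact_def approximates_def shifted_fraction_def)

lemma approximates_mono: "approximates \<phi> \<theta> x r q \<Longrightarrow> \<phi> q \<le> \<psi> q \<Longrightarrow> approximates \<psi> \<theta> x r q"
  by (simp add: approximates_def)

lemma finite_approximates_below: "finite {(r, q). q < Q \<and> approximates \<psi> \<theta> x r q}"
proof (rule finite_subset)
  let ?R = "\<lambda>q. {\<lfloor>real q * (x - \<psi> q) + \<theta>\<rfloor>..\<lceil>real q * (x + \<psi> q) + \<theta>\<rceil>}"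
  show "{(r, q). q < Q \<and> approximates \<psi> \<theta> x r q} \<subseteq> (\<Union>q<Q. ?R q \<times> {q})"
  proof clarify
    fix r q assume q: "q < Q" "approximates \<psi> \<theta> x r q"
    then have "shifted_fraction \<theta> r q \<le> x + \<psi> q" "x - \<psi> q \<le> shifted_fraction \<theta> r q" "q > 0"
      unfolding approximates_def by linarith+
    then have "of_int r \<le> real q * (x + \<psi> q) + \<theta>" "real q * (x - \<psi> q) + \<theta> \<le> of_int r"
      by (simp_all add: shifted_fraction_def field_simps)
    then have "r \<le> \<lceil>real q * (x + \<psi> q) + \<theta>\<rceil>" "\<lfloor>real q * (x - \<psi> q) + \<theta>\<rfloor> \<le> r"
      by linarith+
    then show "(r, q) \<in> (\<Union>q<Q. ?R q \<times> {q})"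
      using q by auto
  qed
qed auto

lemma strict_mono_nat_bracket:
  fixes f :: "nat \<Rightarrow> nat"
  assumes f: "strict_mono f" and "f k0 \<le> n"
  obtains k where "k0 \<le> k" "f k \<le> n" "n < f (Suc k)"
proof -
  have bound: "k \<le> n" if "f k \<le> n" for k
    using strict_mono_imp_increasing[OF f, of k] that by linarith
  define k where "k = (GREATEST k. f k \<le> n)"
  have "f k \<le> n" "k0 \<le> k"
    unfolding k_def
    using GreatestI_nat[of "\<lambda>k. f k \<le> n" k0 n] Greatest_le_nat[of "\<lambda>k. f k \<le> n" k0 n]
      assms(2) bound by auto
  moreover have "\<not> f (Suc k) \<le> n"
    using Greatest_le_nat[of "\<lambda>k. f k \<le> n" "Suc k" n] bound unfolding k_def by fastforce
  ultimately show ?thesis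
    using that by auto
qed

lemma Exact_sequenceI:
  fixes qs :: "nat \<Rightarrow> nat" and rs :: "nat \<Rightarrow> int"
  assumes pos: "\<And>q. \<psi> q > 0" and mono: "strict_mono qs"
    and approx: "\<And>k. approximates \<psi> \<theta> x (rs k) (qs k)"
    and sharp: "\<And>d. d > 0 \<Longrightarrow>
      \<forall>\<^sub>F k in sequentially. \<not> approximates (\<lambda>q. \<psi> q - d * \<psi> q) \<theta> x (rs k) (qs k)"
    and unique: "\<forall>\<^sub>F k in sequentially. \<forall>r q. approximates \<psi> \<theta> x r q \<longrightarrow>
      q \<in> {qs k..<qs (Suc k)} \<longrightarrow> (r, q) = (rs k, qs k)"
  shows "x \<in> Exact \<psi> \<theta>"
  unfolding mem_Exact_iff
proof (intro conjI allI impI)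
  have "range (\<lambda>k. (rs k, qs k)) \<subseteq> {(r, q). approximates \<psi> \<theta> x r q}"
    using approx by auto
  moreover have "infinite (range (\<lambda>k. (rs k, qs k)))"
    using mono by (intro range_inj_infinite) (auto simp: inj_def dest: strict_mono_eq)
  ultimately show "infinite {(r, q). approximates \<psi> \<theta> x r q}"
    using finite_subset by blast
next
  fix d :: real assume "d > 0"
  let ?sharper = "approximates (\<lambda>q. \<psi> q - d * \<psi> q) \<theta> x"
  obtain k0 where k0: "\<And>k. k \<ge> k0 \<Longrightarrow> \<not> ?sharper (rs k) (qs k)"
    "\<And>k r q. k \<ge> k0 \<Longrightarrow> approximates \<psi> \<theta> x r q \<Longrightarrow> q \<in> {qs k..<qs (Suc k)} \<Longrightarrow> (r, q) = (rs k, qs k)"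
    using eventually_conj[OF sharp[OF \<open>d > 0\<close>] unique] unfolding eventually_sequentially by blast
  have "{(r, q). ?sharper r q} \<subseteq> {(r, q). q < qs k0 \<and> approximates \<psi> \<theta> x r q}"
  proof clarify
    fix r q assume sharper: "?sharper r q"
    then have approx_q: "approximates \<psi> \<theta> x r q"
      using pos[of q] \<open>d > 0\<close> by (auto elim: approximates_mono)
    have "q < qs k0"
    proof (rule ccontr)
      assume "\<not> q < qs k0"
      then obtain k where k: "k0 \<le> k" "qs k \<le> q" "q < qs (Suc k)"
        using strict_mono_nat_bracket[OF mono, of k0 q] by auto
      then have "(r, q) = (rs k, qs k)"
        by (intro k0(2) approx_q) auto
      then show False
        using k0(1)[OF k(1)] sharper by simp
    qed
    with approx_q show "q < qs k0 \<and> approximates \<psi> \<theta> x r q"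
      by simp
  qed
  then show "finite {(r, q). ?sharper r q}"
    by (rule finite_subset) (rule finite_approximates_below)
qed

lemma powr_le_if_close:
  fixes c \<delta> g t y z :: real
  assumes "c * z powr (1 - g) \<le> \<delta> * (y * z)" "\<delta> \<le> 2 * y powr - t" "c > 0" "y > 0" "z > 0"
  shows "y powr (t - 1) \<le> 2 / c * z powr g"
proof -
  have "c * z powr - g * z = c * z powr (1 - g)"
    using assms powr_add[of z "- g" 1] by (simp add: add.commute)
  also have "\<dots> \<le> 2 * y powr - t * (y * z)"
    using assms by (intro order_trans[OF assms(1)] mult_right_mono) auto
  also have "\<dots> = 2 * y powr - (t - 1) * z"
    using assms powr_add[of y "- t" 1] by simp
  finally have "c * z powr - g \<le> 2 * y powr - (t - 1)"
    using assms by simp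
  then have "c / z powr g \<le> 2 / y powr (t - 1)"
    by (simp only: powr_minus divide_inverse)
  then show ?thesis
    using assms by (simp add: field_simps)
qed

text \<open>An approximation with denominator \<open>q\<close> between \<open>q1\<close> and \<open>q2\<close> is repelled by the first
  fraction unless \<open>q\<^sup>g \<ge> C q1\<^bsup>t - 1\<^esup>\<close>, and by the second unless \<open>q\<^bsup>t - 1\<^esup> \<le> C q2\<^sup>g\<close>.\<close>

lemma approximates_imp_powr_le:
  assumes c: "c > 0" and separated: "shifted_fractions_separated \<theta> g c" and t: "t > 0"
    and approx: "approximates (\<lambda>q. real q powr - t) \<theta> x r q"
      "approximates (\<lambda>q. real q powr - t) \<theta> x r' q'"
    and q: "q \<le> q'" and neq: "(r, q) \<noteq> (r', q')"
  shows "real q powr (t - 1) \<le> 2 / c * real q' powr g"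
proof (rule powr_le_if_close[OF _ _ c])
  show "c * real q' powr (1 - g)
      \<le> \<bar>shifted_fraction \<theta> r q - shifted_fraction \<theta> r' q'\<bar> * (real q * real q')"
    using separated approx q neq unfolding shifted_fractions_separated_def approximates_def by blast
  have "real q' powr - t \<le> real q powr - t"
    using q t approx by (intro powr_mono2') (auto simp: approximates_def)
  then show "\<bar>shifted_fraction \<theta> r q - shifted_fraction \<theta> r' q'\<bar> \<le> 2 * real q powr - t"
    using approx unfolding approximates_def by linarith
qed (use approx in \<open>auto simp: approximates_def\<close>)

lemma intermediate_approximation_bound:
  fixes q1 q q2 :: nat
  assumes c: "c > 0" and separated: "shifted_fractions_separated \<theta> g c" and t: "t > 1"
    and g: "g > 0"
    and approx: "approximates (\<lambda>q. real q powr - t) \<theta> x r1 q1"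
      "approximates (\<lambda>q. real q powr - t) \<theta> x r q" "approximates (\<lambda>q. real q powr - t) \<theta> x r2 q2"
    and q: "q1 \<le> q" "q \<le> q2" and neq: "(r1, q1) \<noteq> (r, q)" "(r, q) \<noteq> (r2, q2)"
  shows "real q1 powr (t - 1)\<^sup>2 \<le> (2 / c) powr (t - 1 + g) * real q2 powr g\<^sup>2"
proof -
  have repelled: "real q1 powr (t - 1) \<le> 2 / c * real q powr g"
      "real q powr (t - 1) \<le> 2 / c * real q2 powr g"
    using approximates_imp_powr_le[OF c separated _ approx(1,2) q(1) neq(1)]
      approximates_imp_powr_le[OF c separated _ approx(2,3) q(2) neq(2)] t by auto
  have "real q1 powr (t - 1)\<^sup>2 = (real q1 powr (t - 1)) powr (t - 1)"
    by (simp add: powr_powr power2_eq_square)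
  also have "\<dots> \<le> (2 / c * real q powr g) powr (t - 1)"
    using repelled(1) t by (intro powr_mono2) auto
  also have "\<dots> = (2 / c) powr (t - 1) * (real q powr (t - 1)) powr g"
    unfolding powr_mult powr_powr by (simp only: mult.commute[of g])
  also have "\<dots> \<le> (2 / c) powr (t - 1) * (2 / c * real q2 powr g) powr g"
    using repelled(2) g by (intro mult_left_mono powr_mono2) auto
  also have "\<dots> = (2 / c) powr (t - 1 + g) * real q2 powr g\<^sup>2"
    unfolding powr_mult powr_powr powr_add power2_eq_square by (simp only: mult.assoc)
  finally show ?thesis .
qed

locale approximating_sequence =
  fixes \<psi> :: "nat \<Rightarrow> real" and \<theta> x t g b \<epsilon> c :: real
    and M :: "nat \<Rightarrow> real" and rs :: "nat \<Rightarrow> int" and qs :: "nat \<Rightarrow> nat"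
  assumes psi_pos: "\<And>q. \<psi> q > 0" and psi_le: "\<forall>\<^sub>F q in sequentially. \<psi> q \<le> real q powr - t"
    and t_gt_1: "t > 1" and g_pos: "g > 0" and eps: "0 < \<epsilon>" "\<epsilon> < 1"
    and b_large: "b * (1 - \<epsilon>) > 1" and gap: "b * g\<^sup>2 < (1 - \<epsilon>) * (t - 1)\<^sup>2"
    and c_pos: "c > 0" and separated: "shifted_fractions_separated \<theta> g c"
    and M_gt_1: "\<And>k. M k > 1" and M_Suc: "\<And>k. M (Suc k) = M k powr b"
    and M_at_top: "filterlim M at_top sequentially"
    and coprime: "\<And>k. coprime (rs k) (int (qs k))"
    and qs_bounds: "\<And>k. M k powr (1 - \<epsilon>) \<le> real (qs k)" "\<And>k. real (qs k) \<le> M k"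
    and position: "\<And>k. x - shifted_fraction \<theta> (rs k) (qs k)
        \<in> {(1 - 2 * M k powr - \<epsilon>) * \<psi> (qs k)..\<psi> (qs k)}"
begin

lemma qs_pos: "qs k > 0"
proof -
  have "M k powr (1 - \<epsilon>) > 0"
    using M_gt_1[of k] by simp
  then have "real (qs k) > 0"
    using qs_bounds(1)[of k] by linarith
  then show ?thesis
    by simp
qed

lemma strict_mono_qs: "strict_mono qs"
proof -
  have "qs k < qs (Suc k)" for k
  proof -
    have "real (qs k) \<le> M k powr 1"
      using qs_bounds(2)[of k] M_gt_1[of k] by simp
    also have "\<dots> < M k powr (b * (1 - \<epsilon>))"
      using M_gt_1[of k] b_large by (intro powr_less_mono)
    also have "\<dots> \<le> real (qs (Suc k))"
      using qs_bounds(1)[of "Suc k"] by (simp add: M_Suc powr_powr)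
    finally show ?thesis
      by simp
  qed
  then show ?thesis
    by (simp add: strict_mono_Suc_iff)
qed

lemma approximates_qs: "approximates \<psi> \<theta> x (rs k) (qs k)"
proof -
  have "M k powr - \<epsilon> \<le> 1"
    using M_gt_1[of k] eps powr_mono[of "- \<epsilon>" 0 "M k"] by simp
  then have "-1 * \<psi> (qs k) \<le> (1 - 2 * M k powr - \<epsilon>) * \<psi> (qs k)"
    using psi_pos[of "qs k"] by (intro mult_right_mono) auto
  then have "\<bar>x - shifted_fraction \<theta> (rs k) (qs k)\<bar> \<le> \<psi> (qs k)"
    using position[of k] unfolding atLeastAtMost_iff by linarith
  then show ?thesis
    using qs_pos coprime by (simp add: approximates_def)
qed

lemma eventually_not_sharper:
  assumes "d > 0"
  shows "\<forall>\<^sub>F k in sequentially. \<not> approximates (\<lambda>q. \<psi> q - d * \<psi> q) \<theta> x (rs k) (qs k)"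
proof -
  have "\<forall>\<^sub>F k in sequentially. M k powr - \<epsilon> < d / 2"
    using tendsto_neg_powr[OF _ M_at_top, of "- \<epsilon>"] eps assms by (intro order_tendstoD) auto
  then show ?thesis
  proof eventually_elim
    case (elim k)
    then have "(1 - d) * \<psi> (qs k) < (1 - 2 * M k powr - \<epsilon>) * \<psi> (qs k)"
      using psi_pos[of "qs k"] by (intro mult_strict_right_mono) auto
    also have "\<dots> \<le> \<bar>x - shifted_fraction \<theta> (rs k) (qs k)\<bar>"
      using position[of k] by auto
    finally show ?case
      by (simp add: approximates_def left_diff_distrib)
  qed
qed

lemma competitor_imp_scale_bounded:
  assumes upper: "\<And>q. qs k \<le> q \<Longrightarrow> \<psi> q \<le> real q powr - t"
    and competitor: "approximates \<psi> \<theta> x r q" "q \<in> {qs k..<qs (Suc k)}" "(r, q) \<noteq> (rs k, qs k)"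
  shows "M k powr ((1 - \<epsilon>) * (t - 1)\<^sup>2 - b * g\<^sup>2) \<le> (2 / c) powr (t - 1 + g)"
proof -
  have le: "qs k \<le> q" "q \<le> qs (Suc k)" "qs k \<le> qs (Suc k)"
    using competitor(2) by auto
  have "M k powr ((1 - \<epsilon>) * (t - 1)\<^sup>2) = (M k powr (1 - \<epsilon>)) powr (t - 1)\<^sup>2"
    by (simp add: powr_powr)
  also have "\<dots> \<le> real (qs k) powr (t - 1)\<^sup>2"
    using qs_bounds(1) by (intro powr_mono2) auto
  also have "\<dots> \<le> (2 / c) powr (t - 1 + g) * real (qs (Suc k)) powr g\<^sup>2"
  proof (rule intermediate_approximation_bound[OF c_pos separated t_gt_1 g_pos])
    show "approximates (\<lambda>q. real q powr - t) \<theta> x (rs k) (qs k)"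
      "approximates (\<lambda>q. real q powr - t) \<theta> x r q"
      "approximates (\<lambda>q. real q powr - t) \<theta> x (rs (Suc k)) (qs (Suc k))"
      using upper le
      by (auto intro!: approximates_mono[OF approximates_qs] approximates_mono[OF competitor(1)])
  qed (use le competitor in auto)
  also have "\<dots> \<le> (2 / c) powr (t - 1 + g) * M (Suc k) powr g\<^sup>2"
    using qs_bounds(2) by (intro mult_left_mono powr_mono2) auto
  also have "M (Suc k) powr g\<^sup>2 = M k powr (b * g\<^sup>2)"
    by (simp add: M_Suc powr_powr)
  finally show ?thesis
    using M_gt_1[of k] by (simp add: powr_diff divide_le_eq)
qed

lemma eventually_unique:
  "\<forall>\<^sub>F k in sequentially. \<forall>r q. approximates \<psi> \<theta> x r q \<longrightarrow> q \<in> {qs k..<qs (Suc k)} \<longrightarrow>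
    (r, q) = (rs k, qs k)"
proof -
  define H where "H = (2 / c) powr (t - 1 + g)"
  define \<delta> where "\<delta> = (1 - \<epsilon>) * (t - 1)\<^sup>2 - b * g\<^sup>2"
  have "H > 0" "\<delta> > 0"
    using c_pos gap by (simp_all add: H_def \<delta>_def)
  then have "\<forall>\<^sub>F k in sequentially. M k powr - \<delta> < 1 / H"
    using tendsto_neg_powr[OF _ M_at_top, of "- \<delta>"] by (intro order_tendstoD) auto
  moreover have "\<forall>\<^sub>F k in sequentially. \<forall>q\<ge>k. \<psi> q \<le> real q powr - t"
    using psi_le by (rule eventually_all_ge_at_top)
  ultimately show ?thesis
  proof eventually_elim
    case (elim k)
    have "H < M k powr \<delta>"
      using elim(1) \<open>H > 0\<close> M_gt_1[of k] by (simp add: powr_minus field_simps)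
    moreover have "\<psi> q \<le> real q powr - t" if "qs k \<le> q" for q
      using elim(2) that strict_mono_imp_increasing[OF strict_mono_qs, of k] order_trans by blast
    ultimately show ?case
      using competitor_imp_scale_bounded[of k] unfolding H_def \<delta>_def by (meson not_less)
  qed
qed

lemma mem_Exact: "x \<in> Exact \<psi> \<theta>"
  by (rule Exact_sequenceI
      [OF psi_pos strict_mono_qs approximates_qs eventually_not_sharper eventually_unique])

end

section \<open>Iteration of the scales\<close>

lemma growth_exponent_exists:
  fixes \<beta> \<tau> \<sigma> :: real
  assumes \<tau>: "\<tau> > 1" and \<beta>: "\<beta> > \<tau>" and \<sigma>: "0 \<le> \<sigma>" "\<sigma> < (\<beta> - \<tau>) / (\<tau> * (\<beta> - 1))"
  obtains b where "1 < b" "b < \<beta>" "(\<tau> - 1) / (b - 1) + \<tau> * \<sigma> < 1"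
proof -
  have "\<beta> > 1"
    using \<beta> \<tau> by simp
  then have "\<sigma> * (\<tau> * (\<beta> - 1)) < \<beta> - \<tau>"
    using \<sigma>(2) \<tau> by (simp add: pos_less_divide_eq)
  then have less: "\<tau> - 1 < (1 - \<tau> * \<sigma>) * (\<beta> - 1)"
    by (simp add: algebra_simps)
  then have pos: "1 - \<tau> * \<sigma> > 0"
    using \<tau> \<open>\<beta> > 1\<close> by (smt (verit) mult_nonpos_nonneg)
  define b0 where "b0 = 1 + (\<tau> - 1) / (1 - \<tau> * \<sigma>)"
  have "(\<tau> - 1) / (1 - \<tau> * \<sigma>) < \<beta> - 1"
    using less pos by (simp add: pos_divide_less_eq mult.commute)
  then have "b0 < \<beta>"
    by (simp add: b0_def)
  then obtain b where b: "b0 < b" "b < \<beta>"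
    using dense by blast
  have "(\<tau> - 1) / (1 - \<tau> * \<sigma>) > 0"
    using \<tau> pos by simp
  then have "b > 1"
    using b(1) by (simp add: b0_def)
  moreover have "(\<tau> - 1) / (1 - \<tau> * \<sigma>) < b - 1"
    using b(1) by (simp add: b0_def)
  then have "(\<tau> - 1) / (b - 1) < 1 - \<tau> * \<sigma>"
    using pos \<open>b > 1\<close> by (simp add: pos_divide_less_eq mult.commute)
  ultimately show ?thesis
    using that[OF _ b(2)] by simp
qed

lemma eventually_at_right_0_less:
  fixes f g :: "real \<Rightarrow> real"
  assumes "isCont f 0" "isCont g 0" "f 0 < g 0"
  shows "\<forall>\<^sub>F \<epsilon> in at_right 0. f \<epsilon> < g \<epsilon>"
proof -
  have "((\<lambda>\<epsilon>. g \<epsilon> - f \<epsilon>) \<longlongrightarrow> g 0 - f 0) (at_right 0)"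
    using assms(1,2) unfolding isCont_def
    by (intro tendsto_diff) (auto intro: tendsto_within_subset)
  then have "\<forall>\<^sub>F \<epsilon> in at_right 0. 0 < g \<epsilon> - f \<epsilon>"
    using assms(3) by (intro order_tendstoD(1)) auto
  then show ?thesis
    by eventually_elim simp
qed

lemma scale_exponents_exist:
  fixes \<tau> \<gamma> \<sigma> :: real
  defines "\<beta> \<equiv> (\<tau> - 1)\<^sup>2 / \<gamma>\<^sup>2"
  assumes \<gamma>: "\<gamma> \<ge> 1" and \<tau>: "\<tau> > 1" and \<beta>: "\<beta> > \<tau>"
    and \<sigma>: "0 \<le> \<sigma>" "\<sigma> < (\<beta> - \<tau>) / (\<tau> * (\<beta> - 1))"
  obtains b \<epsilon> where "scale_exponents (\<tau> + 2 * \<epsilon>) \<sigma> b \<epsilon>" "1 < \<tau> - \<epsilon>"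
    "b * (\<gamma> + \<epsilon>)\<^sup>2 < (1 - \<epsilon>) * (\<tau> - \<epsilon> - 1)\<^sup>2"
proof -
  obtain b where b: "1 < b" "b < \<beta>" "(\<tau> - 1) / (b - 1) + \<tau> * \<sigma> < 1"
    using growth_exponent_exists[OF \<tau> \<beta> \<sigma>] .
  have gap: "b * \<gamma>\<^sup>2 < (\<tau> - 1)\<^sup>2"
    using b(2) \<gamma> by (simp add: \<beta>_def pos_less_divide_eq)
  have "\<forall>\<^sub>F \<epsilon> in at_right 0. 0 < (\<epsilon>::real)"
    by (rule eventually_at_right_less)
  moreover have "\<forall>\<^sub>F \<epsilon> in at_right 0. \<epsilon> < (1/2::real)"
    by (rule eventually_at_right_0_less) auto
  moreover have "\<forall>\<^sub>F \<epsilon> in at_right 0. 1 < b * (1 - \<epsilon>)"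
    by (rule eventually_at_right_0_less) (use b(1) in auto)
  moreover have "\<forall>\<^sub>F \<epsilon> in at_right 0. 1 < \<tau> - \<epsilon>"
    by (rule eventually_at_right_0_less) (use \<tau> in auto)
  moreover have "\<forall>\<^sub>F \<epsilon> in at_right 0. b * (\<gamma> + \<epsilon>)\<^sup>2 < (1 - \<epsilon>) * (\<tau> - \<epsilon> - 1)\<^sup>2"
    by (rule eventually_at_right_0_less) (use gap in \<open>auto intro!: continuous_intros\<close>)
  moreover have "\<forall>\<^sub>F \<epsilon> in at_right 0.
      (\<tau> + 2 * \<epsilon> - 1 + 3 * \<epsilon>) / (b - 1) + (\<tau> + 2 * \<epsilon>) * \<sigma> < 1 - 4 * \<epsilon>"
    by (rule eventually_at_right_0_less) (use b in \<open>auto intro!: continuous_intros\<close>)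
  ultimately have "\<forall>\<^sub>F \<epsilon> in at_right 0. scale_exponents (\<tau> + 2 * \<epsilon>) \<sigma> b \<epsilon> \<and> 1 < \<tau> - \<epsilon> \<and>
      b * (\<gamma> + \<epsilon>)\<^sup>2 < (1 - \<epsilon>) * (\<tau> - \<epsilon> - 1)\<^sup>2"
    by eventually_elim (use \<tau> \<sigma>(1) in \<open>auto simp: scale_exponents_def\<close>)
  from eventually_happens'[OF trivial_limit_at_right_real this] show ?thesis
    using that by blast
qed

lemma eventually_ge_powr:
  fixes a C :: real
  assumes "a > 0"
  shows "\<forall>\<^sub>F M in at_top. C \<le> M powr a"
proof -
  have "filterlim (\<lambda>M::real. M powr a) at_top at_top"
    using assms by real_asymp
  then show ?thesis
    by (simp add: filterlim_at_top)
qed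

lemma shifted_fraction_interior:
  assumes q: "q \<ge> 8" and \<theta>: "0 \<le> \<theta>" "\<theta> < 1" and x: "x \<in> {1/4..3/4}"
    and near: "\<bar>x - shifted_fraction \<theta> r q\<bar> \<le> 1/8"
  shows "0 < r" "r < int q"
proof -
  have "shifted_fraction \<theta> r q \<ge> 1/8" "shifted_fraction \<theta> r q \<le> 7/8"
    using x near unfolding atLeastAtMost_iff by linarith+
  then have "of_int r - \<theta> \<ge> real q / 8" "of_int r - \<theta> \<le> real q * 7 / 8"
    using q by (simp_all add: shifted_fraction_def field_simps)
  then have "real_of_int r > 0" "real_of_int r < real q"
    using q \<theta> by linarith+
  then show "0 < r" "r < int q"
    by linarith+
qed

locale exact_construction = scale_exponents "\<tau> + 2 * \<epsilon>" \<sigma> b \<epsilon> for \<tau> \<sigma> b \<epsilon> :: real +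
  fixes \<theta> \<gamma> :: real and \<psi> :: "nat \<Rightarrow> real"
  assumes theta_range: "0 \<le> \<theta>" "\<theta> < 1"
    and theta_cases: "(\<theta> = 0 \<and> \<gamma> = 1) \<or> (\<theta> \<notin> \<rat> \<and> dioph_exponent \<theta> = ereal \<gamma>)"
    and gamma_ge_1: "1 \<le> \<gamma>" and psi_pos: "\<And>q. \<psi> q > 0" and lambda_psi: "lambda_exp \<psi> \<tau>"
    and tau_large: "1 < \<tau> - \<epsilon>" and gap: "b * (\<gamma> + \<epsilon>)\<^sup>2 < (1 - \<epsilon>) * (\<tau> - \<epsilon> - 1)\<^sup>2"
begin

abbreviation \<kappa> :: real where
  "\<kappa> \<equiv> \<tau> + 2 * \<epsilon>"

text \<open>The peaks of half-width \<open>w = M powr - \<kappa>\<close> are centred at \<open>\<psi> q - w\<close> above the shifted fractions, so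
  that they cover the distances from \<open>\<psi> q - 2 w\<close> to \<open>\<psi> q\<close>.\<close>

definition factor :: "real \<Rightarrow> real \<Rightarrow> real" where
  "factor M =
    bump_average (prime_window \<epsilon> M) (M powr - \<kappa>) (\<lambda>q. \<psi> q - M powr - \<kappa> - \<theta> / q)"

definition factor_coeff :: "real \<Rightarrow> int \<Rightarrow> complex" where
  "factor_coeff M =
    bump_average_coeff (prime_window \<epsilon> M) (M powr - \<kappa>) (\<lambda>q. \<psi> q - M powr - \<kappa> - \<theta> / q)"

text \<open>The constants 320 and 128 are the spectral bounds \<open>80 / v\<close> and \<open>8 / v\<^sup>2\<close> of the initial bump,
  which has half-width \<open>v = 1/4\<close>.\<close>

definition good_scale :: "real \<Rightarrow> bool" where
  "good_scale M \<longleftrightarrow> 1 < M \<and> 1 \<le> ln M \<and> M powr (1 - \<epsilon>) \<le> card (prime_window \<epsilon> M) \<and>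
     16 * (\<kappa> + 1) \<le> M powr \<epsilon> \<and> 2 \<le> M powr (\<kappa> - 1) \<and>
     (\<forall>q. M powr (1 - \<epsilon>) \<le> real q \<longrightarrow> 8 \<le> q \<and> real q powr - (\<tau> + \<epsilon>) < \<psi> q \<and> \<psi> q \<le> 1/8) \<and>
     320 \<le> M powr \<Lambda> \<and> 128 \<le> M powr (\<zeta> / b) \<and> 2 \<le> M powr (\<epsilon> * (b - 1))"

lemma eventually_psi_le: "\<forall>\<^sub>F q in sequentially. \<psi> q \<le> real q powr - (\<tau> - \<epsilon>)"
  using lambda_exp_eventually_bounds(1)[OF lambda_psi psi_pos, of "\<tau> - \<epsilon>"] eps_pos
  by (auto elim: eventually_mono)

lemma eventually_good_scale: "\<forall>\<^sub>F M in at_top. good_scale M"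
proof -
  have "\<forall>\<^sub>F q in sequentially. real q powr - (\<tau> - \<epsilon>) < 1/8"
    using tendsto_neg_powr[OF _ filterlim_real_sequentially, of "- (\<tau> - \<epsilon>)"] tau_large
    by (intro order_tendstoD) auto
  moreover have "\<forall>\<^sub>F q in sequentially. real q powr - (\<tau> + \<epsilon>) < \<psi> q"
    using eps_pos by (intro lambda_exp_eventually_bounds(2)[OF lambda_psi psi_pos]) auto
  ultimately have "\<forall>\<^sub>F q in sequentially. 8 \<le> q \<and> real q powr - (\<tau> + \<epsilon>) < \<psi> q \<and> \<psi> q \<le> 1/8"
    using eventually_psi_le eventually_ge_at_top[of 8] by eventually_elim auto
  then obtain q0 where q0: "\<And>q. q0 \<le> q \<Longrightarrow> 8 \<le> q \<and> real q powr - (\<tau> + \<epsilon>) < \<psi> q \<and> \<psi> q \<le> 1/8"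
    unfolding eventually_sequentially by blast
  have "\<forall>\<^sub>F M in at_top. real q0 \<le> M powr (1 - \<epsilon>)"
    using eps_less by (intro eventually_ge_powr) auto
  then have "\<forall>\<^sub>F M in at_top. \<forall>q. M powr (1 - \<epsilon>) \<le> real q \<longrightarrow>
      8 \<le> q \<and> real q powr - (\<tau> + \<epsilon>) < \<psi> q \<and> \<psi> q \<le> 1/8"
  proof eventually_elim
    case (elim M)
    then show ?case
      using q0 by (meson of_nat_le_iff order_trans)
  qed
  moreover have "\<forall>\<^sub>F M::real in at_top. 1 \<le> ln M"
    by real_asymp
  ultimately show ?thesis
    unfolding good_scale_def
    using eps_pos eps_less kappa_gt_1 b_gt_1 Lambda_pos zeta_pos
    by (intro eventually_conj eventually_card_prime_window_ge eventually_ge_powr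
          eventually_gt_at_top) auto
qed

context
  fixes M :: real
  assumes good: "good_scale M"
begin

lemma good_scale_gt_1: "M > 1"
  using good by (simp add: good_scale_def)

lemma good_scale_powr_eps: "11 \<le> M powr \<epsilon>"
  using good kappa_gt_1 by (auto simp: good_scale_def)

lemma prime_window_mult_width_le:
  assumes "q \<in> prime_window \<epsilon> M"
  shows "q * M powr - \<kappa> \<le> 1/2"
proof -
  have "q * M powr - \<kappa> \<le> M powr 1 * M powr - \<kappa>"
    using assms good_scale_gt_1 by (intro mult_right_mono) (auto dest: prime_windowD)
  also have "\<dots> = inverse (M powr (\<kappa> - 1))"
    unfolding powr_add[symmetric] powr_minus[symmetric] by (simp add: algebra_simps)
  also have "\<dots> \<le> inverse 2"
    using good by (intro le_imp_inverse_le) (auto simp: good_scale_def)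
  finally show ?thesis
    by simp
qed

lemma factor_nonneg: "factor M x \<ge> 0"
  unfolding factor_def using good_scale_gt_1
  by (intro bump_average_nonneg) (auto dest: prime_windowD)

lemma abs_fourier_series_factor: "abs_fourier_series (\<lambda>x. factor M x) (factor_coeff M)"
  unfolding factor_def factor_coeff_def using good_scale_gt_1
  by (intro abs_fourier_series_bump_average finite_prime_window prime_window_mult_width_le)
     (auto dest: prime_windowD)

lemma quadratic_coeff_decay_factor:
  "quadratic_coeff_decay (factor_coeff M) (M powr (2 * \<epsilon> - 1)) (M powr - \<kappa>)"
  unfolding quadratic_coeff_decay_def
proof (intro conjI allI impI)
  have "M powr (1 - \<epsilon>) > 0"
    using good_scale_gt_1 by simp
  then have "prime_window \<epsilon> M \<noteq> {}"
    using good by (auto simp: good_scale_def)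
  then show "factor_coeff M 0 = 1"
    unfolding factor_coeff_def using good_scale_gt_1
    by (intro bump_average_coeff_0 finite_prime_window) (auto dest: prime_windowD)
  show "norm (factor_coeff M l) \<le> M powr (2 * \<epsilon> - 1) / (1 + (M powr - \<kappa> * of_int l)\<^sup>2)"
    if "l \<noteq> 0" for l
    unfolding factor_coeff_def using good eps_pos eps_less kappa_gt_1 that
    by (intro norm_prime_window_average_coeff_le) (auto simp: good_scale_def)
  show "M powr - \<kappa> \<le> 1"
    using good_scale_gt_1 kappa_gt_1 powr_mono[of "- \<kappa>" 0 M] by simp
qed (use good_scale_gt_1 in auto)

lemma width_le_psi:
  assumes "q \<in> prime_window \<epsilon> M"
  shows "M powr - \<kappa> \<le> M powr - \<epsilon> * \<psi> q"
proof -
  have "M powr - \<kappa> = M powr (- \<epsilon> + - (\<tau> + \<epsilon>))"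
    by (rule arg_cong[where f = "\<lambda>t. M powr t"]) simp
  also have "\<dots> = M powr - \<epsilon> * M powr - (\<tau> + \<epsilon>)"
    by (rule powr_add)
  also have "\<dots> \<le> M powr - \<epsilon> * \<psi> q"
  proof (intro mult_left_mono)
    have "M powr - (\<tau> + \<epsilon>) \<le> real q powr - (\<tau> + \<epsilon>)"
      using prime_windowD[OF assms] eps_pos tau_large by (intro powr_mono2') auto
    then show "M powr - (\<tau> + \<epsilon>) \<le> \<psi> q"
      using good prime_windowD[OF assms] unfolding good_scale_def by (meson less_imp_le order_trans)
  qed auto
  finally show ?thesis .
qed

lemma factor_support:
  assumes "factor M x \<noteq> 0"
  obtains q r where "q \<in> prime_window \<epsilon> M"
    "x - shifted_fraction \<theta> r q \<in> {(1 - 2 * M powr - \<epsilon>) * \<psi> q..\<psi> q}"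
proof -
  obtain q r where q: "q \<in> prime_window \<epsilon> M"
    and near: "\<bar>x - (\<psi> q - M powr - \<kappa> - \<theta> / q) - of_int r / real q\<bar> < M powr - \<kappa>"
    using assms good_scale_gt_1 unfolding factor_def
    by (auto elim!: bump_average_neq_0 dest: prime_windowD)
  have "x - (\<psi> q - M powr - \<kappa> - \<theta> / q) - of_int r / real q
      = x - shifted_fraction \<theta> r q - \<psi> q + M powr - \<kappa>"
    by (simp add: shifted_fraction_def diff_divide_distrib)
  then have "\<psi> q - 2 * M powr - \<kappa> \<le> x - shifted_fraction \<theta> r q" "x - shifted_fraction \<theta> r q \<le> \<psi> q"
    using near by linarith+
  then show ?thesis
    using that[OF q, of r] width_le_psi[OF q] by (simp add: algebra_simps)
qed

end

definition approximation_set :: "real \<Rightarrow> real set" where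
  "approximation_set M = (\<Union>q\<in>prime_window \<epsilon> M. \<Union>r\<in>{0<..<int q}.
     {shifted_fraction \<theta> r q + (1 - 2 * M powr - \<epsilon>) * \<psi> q..shifted_fraction \<theta> r q + \<psi> q})"

lemma closed_approximation_set: "closed (approximation_set M)"
  unfolding approximation_set_def by (intro closed_UN finite_prime_window) auto

lemma approximation_setD:
  assumes "x \<in> approximation_set M"
  shows "\<exists>q r. coprime r (int q) \<and> M powr (1 - \<epsilon>) \<le> real q \<and> real q \<le> M \<and>
    x - shifted_fraction \<theta> r q \<in> {(1 - 2 * M powr - \<epsilon>) * \<psi> q..\<psi> q}"
proof -
  obtain q r where q: "q \<in> prime_window \<epsilon> M" and r: "0 < r" "r < int q"
    and x: "x - shifted_fraction \<theta> r q \<in> {(1 - 2 * M powr - \<epsilon>) * \<psi> q..\<psi> q}"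
    using assms by (auto simp: approximation_set_def algebra_simps)
  have "\<not> int q dvd r"
    using r zdvd_not_zless by blast
  then have "coprime (int q) r"
    using prime_windowD(1)[OF q] by (intro prime_imp_coprime) auto
  then show ?thesis
    using prime_windowD[OF q] x by (auto simp: coprime_commute)
qed

lemma factor_eq_0:
  assumes good: "good_scale M" and x: "x \<in> {1/4..3/4}" "x \<notin> approximation_set M"
  shows "factor M x = 0"
proof (rule ccontr)
  assume "factor M x \<noteq> 0"
  then obtain q r where q: "q \<in> prime_window \<epsilon> M"
    and below: "x - shifted_fraction \<theta> r q \<in> {(1 - 2 * M powr - \<epsilon>) * \<psi> q..\<psi> q}"
    using factor_support[OF good] by blast
  have large: "8 \<le> q" "\<psi> q \<le> 1/8"
    using good prime_windowD(2)[OF q] by (auto simp: good_scale_def)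
  have "M powr - \<epsilon> \<le> 1"
    using good_scale_gt_1[OF good] eps_pos powr_mono[of "- \<epsilon>" 0 M] by simp
  then have "-1 * \<psi> q \<le> (1 - 2 * M powr - \<epsilon>) * \<psi> q"
    using psi_pos[of q] by (intro mult_right_mono) auto
  then have "\<bar>x - shifted_fraction \<theta> r q\<bar> \<le> 1/8"
    using below large(2) unfolding atLeastAtMost_iff by linarith
  then have "0 < r" "r < int q"
    using shifted_fraction_interior[OF large(1) theta_range x(1)] by auto
  then show False
    using x(2) q below by (auto simp: approximation_set_def algebra_simps)
qed

end

locale exact_scales = exact_construction +
  fixes M0 :: real
  assumes good_scale_ge: "\<And>M. M \<ge> M0 \<Longrightarrow> good_scale M"
begin

definition scale :: "nat \<Rightarrow> real" where
  "scale k = M0 powr (b ^ k)"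

lemma M0_gt_1: "M0 > 1"
  using good_scale_ge[of M0] by (simp add: good_scale_def)

lemma good_scale_scale: "good_scale (scale k)"
proof (rule good_scale_ge)
  have "M0 powr 1 \<le> M0 powr (b ^ k)"
    using M0_gt_1 b_gt_1 by (intro powr_mono) auto
  then show "M0 \<le> scale k"
    using M0_gt_1 by (simp add: scale_def)
qed

lemma scale_gt_1: "scale k > 1"
  by (rule good_scale_gt_1[OF good_scale_scale])

lemma scale_Suc: "scale (Suc k) = scale k powr b"
  by (simp add: scale_def powr_powr mult.commute)

lemma filterlim_scale: "filterlim scale at_top sequentially"
  unfolding scale_def[abs_def] using M0_gt_1 b_gt_1 by real_asymp

lemma scale_powr_neg_eps_le: "scale k powr - \<epsilon> \<le> 1/8 * (1/2) ^ k"
proof (induction k)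
  case 0
  have "inverse (scale 0 powr \<epsilon>) \<le> inverse 8"
    using good_scale_powr_eps[OF good_scale_scale, of 0] by (intro le_imp_inverse_le) auto
  then show ?case
    by (simp add: powr_minus)
next
  case (Suc k)
  have "scale (Suc k) powr - \<epsilon> = scale k powr - \<epsilon> * scale k powr - (\<epsilon> * (b - 1))"
    unfolding scale_Suc powr_powr powr_add[symmetric] by (simp add: algebra_simps)
  also have "\<dots> \<le> (1/8 * (1/2) ^ k) * (1/2)"
  proof (intro mult_mono Suc)
    have "inverse (scale k powr (\<epsilon> * (b - 1))) \<le> inverse 2"
      using good_scale_scale[of k] by (intro le_imp_inverse_le) (auto simp: good_scale_def)
    then show "scale k powr - (\<epsilon> * (b - 1)) \<le> 1/2"
      by (simp add: powr_minus)
  qed auto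
  finally show ?case
    by simp
qed

definition approx_density :: "nat \<Rightarrow> real \<Rightarrow> real" where
  "approx_density n x = scaled_bump (1/2) (1/4) x * (\<Prod>k<n. factor (scale k) x)"

lemma approx_density_nonneg: "approx_density n x \<ge> 0"
  unfolding approx_density_def
  by (intro mult_nonneg_nonneg prod_nonneg scaled_bump_nonneg factor_nonneg good_scale_scale) auto

lemma approx_density_Suc:
  "(\<lambda>x. complex_of_real (approx_density (Suc n) x))
      = (\<lambda>x. complex_of_real (approx_density n x) * complex_of_real (factor (scale n) x))"
  by (auto simp: approx_density_def)

lemma spectral_bounds_approx_density:
  "spectral_bounds (\<lambda>x. approx_density n x) (scale n powr \<Lambda>) (scale n powr (\<zeta> / b))"
proof (induction n)
  case 0
  have "spectral_bounds (\<lambda>x. approx_density 0 x) (80 / (1/4)) (8 / (1/4)\<^sup>2)"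
    using spectral_bounds_scaled_bump[of "1/4" "1/2"] by (simp add: approx_density_def)
  then show ?case
    by (rule spectral_bounds_mono)
       (use good_scale_scale[of 0] in \<open>auto simp: good_scale_def power2_eq_square\<close>)
next
  case (Suc n)
  show ?case
    unfolding approx_density_Suc scale_Suc
    by (rule spectral_bounds_next_scale[OF scale_gt_1 good_scale_powr_eps Suc
          abs_fourier_series_factor quadratic_coeff_decay_factor]) (rule good_scale_scale)+
qed

lemma fourier_integral_approx_density_step:
  "norm (fourier_integral (\<lambda>x. approx_density (Suc n) x) \<xi>
      - fourier_integral (\<lambda>x. approx_density n x) \<xi>)
    \<le> 1/4 * (1/2) ^ n * (1 + \<bar>\<xi>\<bar>) powr - \<sigma>"
proof -
  have "norm (fourier_integral (\<lambda>x. approx_density (Suc n) x) \<xi>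
      - fourier_integral (\<lambda>x. approx_density n x) \<xi>)
      \<le> 2 * scale n powr - \<epsilon> * (1 + \<bar>\<xi>\<bar>) powr - \<sigma>"
    unfolding approx_density_Suc
    by (rule fourier_integral_next_scale_diff_le
        [OF scale_gt_1 good_scale_powr_eps spectral_bounds_approx_density
          abs_fourier_series_factor quadratic_coeff_decay_factor]) (rule good_scale_scale)+
  also have "\<dots> \<le> 2 * (1/8 * (1/2) ^ n) * (1 + \<bar>\<xi>\<bar>) powr - \<sigma>"
    by (intro mult_right_mono mult_left_mono scale_powr_neg_eps_le) auto
  finally show ?thesis
    by simp
qed

lemma fourier_integral_approx_density_diff:
  "norm (fourier_integral (\<lambda>x. approx_density n x) \<xi> - fourier_integral (\<lambda>x. approx_density 0 x) \<xi>)
    \<le> 1/2 * (1 + \<bar>\<xi>\<bar>) powr - \<sigma>"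
proof -
  let ?F = "\<lambda>n. fourier_integral (\<lambda>x. approx_density n x) \<xi>"
  have "norm (?F n - ?F 0) = norm (\<Sum>k<n. ?F (Suc k) - ?F k)"
    by (simp only: sum_lessThan_telescope[of ?F])
  also have "\<dots> \<le> (\<Sum>k<n. 1/4 * (1/2) ^ k * (1 + \<bar>\<xi>\<bar>) powr - \<sigma>)"
    by (intro sum_norm_le fourier_integral_approx_density_step)
  also have "\<dots> = 1/4 * (1 + \<bar>\<xi>\<bar>) powr - \<sigma> * (\<Sum>k<n. (1/2) ^ k)"
    by (simp add: sum_distrib_left mult_ac)
  also have "\<dots> \<le> 1/4 * (1 + \<bar>\<xi>\<bar>) powr - \<sigma> * 2"
    by (intro mult_left_mono) (auto simp: sum_gp_strict)
  finally show ?thesis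
    by simp
qed

lemma norm_fourier_integral_approx_density_le:
  "norm (fourier_integral (\<lambda>x. approx_density n x) \<xi>) \<le> 513 * (1 + \<bar>\<xi>\<bar>) powr - \<sigma>"
proof -
  have "norm (fourier_integral (\<lambda>x. approx_density 0 x) \<xi>) \<le> 512 * (1 + \<bar>\<xi>\<bar>) powr - \<sigma>"
    using norm_fourier_integral_scaled_bump_le_powr[of "1/4" \<sigma> "1/2" \<xi>] sigma_le_1
    by (simp add: approx_density_def power_divide)
  moreover have "1/2 * (1 + \<bar>\<xi>\<bar>) powr - \<sigma> \<le> (1 + \<bar>\<xi>\<bar>) powr - \<sigma>"
    by simp
  ultimately show ?thesis
    using norm_triangle_sub[of "fourier_integral (\<lambda>x. approx_density n x) \<xi>"
        "fourier_integral (\<lambda>x. approx_density 0 x) \<xi>"]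
      fourier_integral_approx_density_diff[of n \<xi>]
    by linarith
qed

lemma integrable_approx_density: "integrable lborel (approx_density n)"
  using integrable_Re[OF spectral_boundsD(1)[OF spectral_bounds_approx_density[of n]]] by simp

lemma approx_density_mass: "(\<integral>x. approx_density n x \<partial>lborel) \<ge> 1/2"
proof -
  have "fourier_integral (\<lambda>x. approx_density n x) 0
      = complex_of_real (\<integral>x. approx_density n x \<partial>lborel)" for n
    by (simp add: fourier_integral_def)
  moreover have "fourier_integral (\<lambda>x. approx_density 0 x) 0 = 1"
    by (simp add: approx_density_def fourier_integral_scaled_bump fourier_integral_bump_0)
  ultimately have "norm (complex_of_real ((\<integral>x. approx_density n x \<partial>lborel) - 1)) \<le> 1/2"
    using fourier_integral_approx_density_diff[of n 0] by simp
  then show ?thesis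
    unfolding norm_of_real by linarith
qed

definition support_set :: "nat \<Rightarrow> real set" where
  "support_set n = (case n of 0 \<Rightarrow> {1/4..3/4} | Suc k \<Rightarrow> approximation_set (scale k))"

lemma closed_support_set: "closed (support_set n)"
  by (simp add: support_set_def closed_approximation_set split: nat.split)

lemma approx_density_eq_0:
  assumes "n \<le> m" "x \<notin> support_set n"
  shows "approx_density m x = 0"
proof (cases "x \<in> {1/4..3/4}")
  case True
  with assms obtain k where "n = Suc k" "x \<notin> approximation_set (scale k)"
    by (auto simp: support_set_def split: nat.splits)
  then have "k < m" "factor (scale k) x = 0"
    using assms True factor_eq_0[OF good_scale_scale] by auto
  then have "(\<Prod>k<m. factor (scale k) x) = 0"
    by (intro prod_zero) auto
  then show ?thesis
    by (simp add: approx_density_def)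
next
  case False
  then have "scaled_bump (1/2) (1/4) x = 0"
    by (intro scaled_bump_eq_0) (auto simp: abs_if)
  then show ?thesis
    by (simp add: approx_density_def)
qed

lemma Inter_support_set_subset: "(\<Inter>n. support_set n) \<subseteq> Exact \<psi> \<theta>"
proof
  fix x assume "x \<in> (\<Inter>n. support_set n)"
  then have "x \<in> support_set (Suc k)" for k
    by blast
  then have "x \<in> approximation_set (scale k)" for k
    by (simp add: support_set_def)
  from approximation_setD[OF this] obtain qs rs where
    "\<And>k. coprime (rs k) (int (qs k))"
    "\<And>k. scale k powr (1 - \<epsilon>) \<le> real (qs k)" "\<And>k. real (qs k) \<le> scale k"
    "\<And>k. x - shifted_fraction \<theta> (rs k) (qs k) \<in> {(1 - 2 * scale k powr - \<epsilon>) * \<psi> (qs k)..\<psi> (qs k)}"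
    by metis
  moreover obtain c where "c > 0" "shifted_fractions_separated \<theta> (\<gamma> + \<epsilon>) c"
    using shifted_fractions_separated_exists[OF theta_cases, of "\<gamma> + \<epsilon>"] eps_pos by auto
  ultimately interpret approximating_sequence \<psi> \<theta> x "\<tau> - \<epsilon>" "\<gamma> + \<epsilon>" b \<epsilon> c scale rs qs
    using psi_pos eventually_psi_le tau_large eps_pos eps_less gamma_ge_1 b_large gap
      scale_gt_1 scale_Suc filterlim_scale
    by unfold_locales auto
  show "x \<in> Exact \<psi> \<theta>"
    by (rule mem_Exact)
qed

lemma fourier_admissible_Exact_scales:
  assumes "\<sigma> \<le> 1/2"
  shows "fourier_admissible (Exact \<psi> \<theta>) (2 * \<sigma>)"
proof (rule fourier_admissible_densitiesI[where m = "1/2" and B = 513])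
  show "bounded (support_set 0)"
    by (simp add: support_set_def)
  show "norm (fourier_integral (\<lambda>x. approx_density n x) \<xi>)
      \<le> 513 * (1 + \<bar>\<xi>\<bar>) powr (- (2 * \<sigma>) / 2)" for n \<xi>
    using norm_fourier_integral_approx_density_le[of n \<xi>] by simp
qed (use assms sigma_nonneg approx_density_nonneg integrable_approx_density approx_density_mass
      closed_support_set approx_density_eq_0 Inter_support_set_subset in auto)

end

lemma fourier_admissible_Exact:
  fixes \<theta> \<gamma> \<tau> \<sigma> :: real and \<psi> :: "nat \<Rightarrow> real"
  defines "\<beta> \<equiv> (\<tau> - 1)\<^sup>2 / \<gamma>\<^sup>2"
  assumes \<theta>: "0 \<le> \<theta>" "\<theta> < 1"
    and theta_cases: "(\<theta> = 0 \<and> \<gamma> = 1) \<or> (\<theta> \<notin> \<rat> \<and> dioph_exponent \<theta> = ereal \<gamma>)"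
    and psi_pos: "\<And>q. \<psi> q > 0" and lam: "lambda_exp \<psi> \<tau>"
    and \<gamma>: "\<gamma> \<ge> 1" and \<tau>: "\<tau> > 1" and \<beta>: "\<beta> > \<tau>"
    and \<sigma>: "0 \<le> \<sigma>" "\<sigma> \<le> 1/2" "\<sigma> < (\<beta> - \<tau>) / (\<tau> * (\<beta> - 1))"
  shows "fourier_admissible (Exact \<psi> \<theta>) (2 * \<sigma>)"
proof -
  obtain b \<epsilon> where exponents: "scale_exponents (\<tau> + 2 * \<epsilon>) \<sigma> b \<epsilon>" and "1 < \<tau> - \<epsilon>"
    "b * (\<gamma> + \<epsilon>)\<^sup>2 < (1 - \<epsilon>) * (\<tau> - \<epsilon> - 1)\<^sup>2"
    using scale_exponents_exist[OF \<gamma> \<tau>] \<beta> \<sigma> unfolding \<beta>_def by metis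
  then interpret exact_construction \<tau> \<sigma> b \<epsilon> \<theta> \<gamma> \<psi>
    using \<theta> theta_cases psi_pos lam \<gamma>
    by (intro exact_construction.intro exact_construction_axioms.intro) auto
  obtain M0 where "\<And>M. M \<ge> M0 \<Longrightarrow> good_scale M"
    using eventually_good_scale by (auto simp: eventually_at_top_linorder)
  then interpret exact_scales \<tau> \<sigma> b \<epsilon> \<theta> \<gamma> \<psi> M0
    by unfold_locales
  show ?thesis
    using \<sigma>(2) by (rule fourier_admissible_Exact_scales)
qed

lemma le_fourier_dimI:
  assumes "S > 0" "\<And>s. 0 \<le> s \<Longrightarrow> s < S \<Longrightarrow> fourier_admissible E s"
  shows "S \<le> fourier_dim E"
proof (rule dense_le)
  fix s assume "s < S"
  have "bdd_above (insert 0 {s. fourier_admissible E s})"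
    by (rule bdd_aboveI[of _ 1]) (auto simp: fourier_admissible_def)
  then have "max 0 s \<le> fourier_dim E"
    unfolding fourier_dim_def using assms \<open>s < S\<close> by (intro cSup_upper) auto
  then show "s \<le> fourier_dim E"
    by simp
qed

lemma tau_less_beta:
  fixes \<gamma> \<tau> :: real
  assumes \<gamma>: "\<gamma> \<ge> 1" and large: "\<tau> > (2 + \<gamma>\<^sup>2 + sqrt ((2 + \<gamma>\<^sup>2)\<^sup>2 - 4)) / 2"
  shows "\<tau> > 2" "\<tau> < (\<tau> - 1)\<^sup>2 / \<gamma>\<^sup>2"
proof -
  define h where "h = 2 + \<gamma>\<^sup>2"
  have "h \<ge> 3"
    using \<gamma> by (simp add: h_def)
  then have "h\<^sup>2 - 4 \<ge> 1"
    using power_mono[of 3 h 2] by simp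
  have root: "sqrt (h\<^sup>2 - 4) < 2 * \<tau> - h"
    using large by (simp add: h_def field_simps)
  moreover have "1 \<le> sqrt (h\<^sup>2 - 4)"
    using \<open>h\<^sup>2 - 4 \<ge> 1\<close> by simp
  ultimately show "\<tau> > 2"
    using \<open>h \<ge> 3\<close> by linarith
  have "(sqrt (h\<^sup>2 - 4))\<^sup>2 < (2 * \<tau> - h)\<^sup>2"
    using root \<open>h\<^sup>2 - 4 \<ge> 1\<close> by (intro power_strict_mono) auto
  then have "h\<^sup>2 - 4 < (2 * \<tau> - h)\<^sup>2"
    using \<open>h\<^sup>2 - 4 \<ge> 1\<close> by simp
  then have "\<gamma>\<^sup>2 * \<tau> < (\<tau> - 1)\<^sup>2"
    by (simp add: h_def power2_eq_square algebra_simps)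
  then show "\<tau> < (\<tau> - 1)\<^sup>2 / \<gamma>\<^sup>2"
    using \<gamma> by (simp add: pos_less_divide_eq mult.commute)
qed

theorem theorem1:
  fixes \<theta> \<gamma> \<tau> :: real and \<psi> :: "nat \<Rightarrow> real"
  assumes theta_range: "0 \<le> \<theta>" "\<theta> < 1"
    and theta_cases: "(\<theta> = 0 \<and> \<gamma> = 1) \<or> (\<theta> \<notin> \<rat> \<and> dioph_exponent \<theta> = ereal \<gamma>)"
    and psi_pos: "\<And>q. \<psi> q > 0"
    and psi_decr: "antimono \<psi>"
    and tau: "lambda_exp \<psi> \<tau>"
    and tau_big: "\<tau> > (2 + \<gamma>\<^sup>2 + sqrt ((2 + \<gamma>\<^sup>2)\<^sup>2 - 4)) / 2"
  shows "fourier_dim (Exact \<psi> \<theta>) > 0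
     \<and> fourier_dim (Exact \<psi> \<theta>) \<ge>
         (let \<beta> = (\<tau> - 1)\<^sup>2 / \<gamma>\<^sup>2 in 2 * (\<beta> - \<tau>) / (\<tau> * (\<beta> - 1)))"
proof -
  define \<beta> where "\<beta> = (\<tau> - 1)\<^sup>2 / \<gamma>\<^sup>2"
  define S where "S = 2 * ((\<beta> - \<tau>) / (\<tau> * (\<beta> - 1)))"
  have \<gamma>: "\<gamma> \<ge> 1"
    using theta_cases dioph_exponent_ge_1[of \<theta>] by (auto simp: one_ereal_def)
  have \<beta>: "2 < \<tau>" "\<tau> < \<beta>"
    using tau_less_beta[OF \<gamma> tau_big] by (auto simp: \<beta>_def)
  then have "2 * (\<beta> - \<tau>) \<le> \<tau> * (\<beta> - 1)"
    by (intro mult_mono) auto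
  with \<beta> have S: "0 < S" "S \<le> 1"
    by (auto simp: S_def)
  have "S \<le> fourier_dim (Exact \<psi> \<theta>)"
  proof (rule le_fourier_dimI[OF S(1)])
    fix s assume s: "0 \<le> s" "s < S"
    then have "s / 2 < (\<beta> - \<tau>) / (\<tau> * (\<beta> - 1))"
      unfolding S_def by linarith
    with s \<beta> S show "fourier_admissible (Exact \<psi> \<theta>) s"
      using fourier_admissible_Exact[OF theta_range theta_cases psi_pos tau \<gamma>, of "s / 2"]
      unfolding \<beta>_def[symmetric] by simp
  qed
  then show ?thesis
    using S(1) unfolding S_def \<beta>_def[symmetric] Let_def times_divide_eq_right by linarith
qed

end
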